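(* Let $A = \begin{pmatrix}E & F \end{pmatrix}$ be an $n \times m$ matrix with $n < m$, where $E \in \mathbb{R}^{n \times n}$ is invertible and $E^{-1}$ is an $\mathcal{H}_r(\mathcal{P})$-matrix with an associated dendrogram $\mathcal{P}$ of maximum degree $d$ and height $h$. Further, let $F \in \mathbb{R}^{n \times (m-n)}$ be $f$-column sparse. Then one can compute an approximation of $x^* := \arg\min_{Ax = b} \|x\|$ by applying $N$ iterations of the form $$x_{t+1} = x_t - \frac{x_t^Tq_i}{q_i^Tq_i}\, q_i$$ in time $$\mathcal{O}(N frd^2h + mf^2r^2d^4h^2) + Cost(CD),$$ where $Cost(CD)$ is the cost of computing an $(rd^2(h+1))$-sparse factorization of $E^{-1}$. The number of iterations to gain one order of magnitude on the error is at most $N_1 = \mathcal{O}(\|E^{-1}F\|_{\mathrm{Frob}}^2+m)$.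
   Context: Iterations: they start from the feasible solution $x_0=\begin{pmatrix}E^{-1}b\\0\end{pmatrix}$ and the directions $q_i$ are columns of the matrix $$Q=\begin{pmatrix}E^{-1}F\\-I_{m-n}\end{pmatrix},$$ whose columns form a basis of the null space of $A$. At each step the column $q_i$ is selected independently at random with probability proportional to $\|q_i\|^2$. "Gaining one order of magnitude on the error" means decreasing the expected squared error $\mathbb{E}\|x_t-x^*\|^2$ by a fixed constant factor such as $10$. Time is counted in elementary scalar operations. $\|\cdot\|$ is the Euclidean norm and $\|\cdot\|_{\mathrm{Frob}}$ the Frobenius norm. A matrix is $f$-column sparse if each of its columns has at most $f$ nonzero entries. Dendrogram: a dendrogram $\mathcal{P}$ is a sequence of increasingly finer partitions $P_h,\dots,P_0$ of $\{1,\dots,n\}$, where $P_h$ is the one-block partition and $P_0$ the partition into singletons. It is represented as a rooted tree whose nodes at height $i$ are the sets of $P_i$; the children of a node at height $i$ are its subsets belonging to $P_{i-1}$. The number $h$ is the height; the maximum number of children of a node is the maximum degree $d$. Every node is assumed to consist of consecutive integers. $\mathcal{H}_r(\mathcal{P})$-matrix: an $n\times n$ matrix $M$ is block-partitioned, in rows and columns, according to $P_{h-1}=\{I_1,\dots,I_t\}$ into blocks $M_{I_i\times I_j}$; the diagonal blocks are recursively sub-partitioned according to $P_{h-2}$, etc. Elementary blocks are the blocks not further subdivided (off-diagonal blocks arising at any level of this recursion, and $1\times1$ diagonal blocks). $M$ is an $\mathcal{H}_r(\mathcal{P})$-matrix if all elementary blocks have rank at most $r$. $k$-sparse factorization: for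 $M=CD$ with $c_i$, $d_j$ the columns of $C$, $D$, the forward-overlap $FO(c_i)$ is the list of columns $c_j$, $j\ge i$, whose support intersects that of $c_i$. The factorization is $k$-sparse if $\left|\bigcup_{i\in\mathrm{supp}(d_j)}FO(c_i)\right|\le k$ for all $j$ (each column of $C$ and row of $D$ being nonzero, without loss of generality). *)

theory Defs
  imports
    "HOL-Probability.Probability_Mass_Function"
    "HOL-Library.Disjoint_Sets"
    "Jordan_Normal_Form.DL_Rank"
    "Jordan_Normal_Form.DL_Submatrix"
begin

no_notation inner (infix \<open>\<bullet>\<close> 70)

text \<open>
  Indices are 0-based throughout: an \<open>n\<close>-element index set is \<open>{..<n}\<close>.
\<close>


section \<open>Norms and supports\<close>

definition l2norm :: "real Matrix.vec \<Rightarrow> real" where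
  "l2norm x = sqrt (x \<bullet> x)"

definition frob_norm :: "real mat \<Rightarrow> real" where
  "frob_norm M = sqrt (\<Sum>i<dim_row M. \<Sum>j<dim_col M. (M $$ (i, j))\<^sup>2)"

definition mat_support :: "real mat \<Rightarrow> (nat \<times> nat) set" where
  "mat_support M = {(i, j). i < dim_row M \<and> j < dim_col M \<and> M $$ (i, j) \<noteq> 0}"

definition col_support :: "real mat \<Rightarrow> nat \<Rightarrow> nat set" where
  "col_support M j = {i. i < dim_row M \<and> M $$ (i, j) \<noteq> 0}"

definition column_sparse :: "nat \<Rightarrow> real mat \<Rightarrow> bool" where
  "column_sparse f M \<longleftrightarrow> (\<forall>j<dim_col M. card (col_support M j) \<le> f)"


section \<open>Dendrograms and hierarchical matrices\<close>

text \<open>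
  \<open>P i\<close> is the partition at height \<open>i\<close>; values of \<open>P\<close> above \<open>h\<close> are irrelevant.
  Consecutive partitions need not be distinct.
\<close>

definition dendrogram :: "nat \<Rightarrow> nat \<Rightarrow> (nat \<Rightarrow> nat set set) \<Rightarrow> bool" where
  "dendrogram n h P \<longleftrightarrow>
     (\<forall>i\<le>h. partition_on {..<n} (P i)) \<and>
     (\<forall>i<h. refines {..<n} (P i) (P (Suc i))) \<and>
     P h = {{..<n}} \<and>
     P 0 = (\<lambda>i. {i}) ` {..<n} \<and>
     (\<forall>i\<le>h. \<forall>I\<in>P i. \<exists>a b. I = {a..<b})"

fun children :: "(nat \<Rightarrow> nat set set) \<Rightarrow> nat \<Rightarrow> nat set \<Rightarrow> nat set set" where
  "children P 0 I = {}"
| "children P (Suc i) I = {J \<in> P i. J \<subseteq> I}"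

definition max_degree :: "nat \<Rightarrow> (nat \<Rightarrow> nat set set) \<Rightarrow> nat" where
  "max_degree h P = Max (\<Union>i\<in>{..h}. (\<lambda>I. card (children P i I)) ` P i)"

text \<open>
  \<open>elementary_blocks P i I\<close> are the elementary blocks of the diagonal block \<open>I \<times> I\<close> of a
  node \<open>I\<close> at height \<open>i\<close>.
\<close>

primrec elementary_blocks ::
  "(nat \<Rightarrow> nat set set) \<Rightarrow> nat \<Rightarrow> nat set \<Rightarrow> (nat set \<times> nat set) set" where
  "elementary_blocks P 0 I = {(I, I)}"
| "elementary_blocks P (Suc i) I =
     {(J, J'). J \<in> children P (Suc i) I \<and> J' \<in> children P (Suc i) I \<and> J \<noteq> J'} \<union>
     (\<Union>J\<in>children P (Suc i) I. elementary_blocks P i J)"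

definition mat_rank :: "real mat \<Rightarrow> nat" where
  "mat_rank M = vec_space.rank (dim_row M) M"

definition hierarchical_matrix ::
  "nat \<Rightarrow> nat \<Rightarrow> (nat \<Rightarrow> nat set set) \<Rightarrow> nat \<Rightarrow> real mat \<Rightarrow> bool" where
  "hierarchical_matrix n h P r M \<longleftrightarrow>
     M \<in> carrier_mat n n \<and>
     (\<forall>(I, J)\<in>elementary_blocks P h {..<n}. mat_rank (submatrix M I J) \<le> r)"


section \<open>Sparse factorizations\<close>

definition forward_overlap :: "real mat \<Rightarrow> nat \<Rightarrow> nat set" where
  "forward_overlap C i =
     {j. i \<le> j \<and> j < dim_col C \<and> col_support C i \<inter> col_support C j \<noteq> {}}"

definition sparse_factorization ::
  "nat \<Rightarrow> real mat \<Rightarrow> real mat \<Rightarrow> real mat \<Rightarrow> bool" where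
  "sparse_factorization k M C D \<longleftrightarrow>
     dim_row C = dim_row M \<and> dim_col C = dim_row D \<and> dim_col D = dim_col M \<and>
     M = C * D \<and>
     (\<forall>i<dim_col C. col C i \<noteq> 0\<^sub>v (dim_row C)) \<and>
     (\<forall>i<dim_row D. row D i \<noteq> 0\<^sub>v (dim_col D)) \<and>
     (\<forall>j<dim_col D. card (\<Union>i\<in>col_support D j. forward_overlap C i) \<le> k)"


section \<open>The randomized iterations\<close>

definition system_matrix :: "real mat \<Rightarrow> real mat \<Rightarrow> real mat" where
  "system_matrix E F = mat_of_cols (dim_row E) (cols E @ cols F)"

definition min_norm_solution :: "nat \<Rightarrow> real mat \<Rightarrow> real Matrix.vec \<Rightarrow> real Matrix.vec" where
  "min_norm_solution m A b = arg_min l2norm (\<lambda>x. x \<in> carrier_vec m \<and> A *\<^sub>v x = b)"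

text \<open>In the next two definitions \<open>B\<close> plays the role of the inverse of \<open>E\<close>.\<close>

definition directions :: "real mat \<Rightarrow> real mat \<Rightarrow> real mat" where
  "directions B F = (B * F) @\<^sub>r (- 1\<^sub>m (dim_col F))"

definition start_point :: "real mat \<Rightarrow> real mat \<Rightarrow> real Matrix.vec \<Rightarrow> real Matrix.vec" where
  "start_point B F b = (B *\<^sub>v b) @\<^sub>v 0\<^sub>v (dim_col F)"

definition iteration_step :: "real Matrix.vec \<Rightarrow> real Matrix.vec \<Rightarrow> real Matrix.vec" where
  "iteration_step q x = x - ((x \<bullet> q) / (q \<bullet> q)) \<cdot>\<^sub>v q"

definition column_law :: "real mat \<Rightarrow> nat pmf" where
  "column_law Q = embed_pmf (\<lambda>j.
     if j < dim_col Q
     then (l2norm (col Q j))\<^sup>2 / (\<Sum>i<dim_col Q. (l2norm (col Q i))\<^sup>2)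
     else 0)"

primrec iterate_law :: "real mat \<Rightarrow> real Matrix.vec \<Rightarrow> nat \<Rightarrow> real Matrix.vec pmf" where
  "iterate_law Q x\<^sub>0 0 = return_pmf x\<^sub>0"
| "iterate_law Q x\<^sub>0 (Suc t) =
     bind_pmf (iterate_law Q x\<^sub>0 t) (\<lambda>x.
       map_pmf (\<lambda>j. iteration_step (col Q j) x) (column_law Q))"

definition expected_sq_error :: "real Matrix.vec pmf \<Rightarrow> real Matrix.vec \<Rightarrow> real" where
  "expected_sq_error p y = measure_pmf.expectation p (\<lambda>x. (l2norm (x - y))\<^sup>2)"


section \<open>Algebraic computation trees\<close>

text \<open>
  Time is the number of elementary scalar operations in a randomized algebraic computation
  tree over the reals. The memory is a list of reals that contains the input at the start;
  an arithmetic instruction appends its result. Only integer constants are built in, so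
  real data can enter a computation only through the memory, and can influence the control
  flow only through comparisons and coin flips. Each instruction costs one unit; in
  particular only a uniform choice of an index and a single biased coin flip are available as
  primitive sources of randomness, whereas drawing from a general weighted distribution is
  not. Addressing of memory cells is free.
\<close>

datatype arith = Plus | Minus | Times | Divide

primrec arith_op :: "arith \<Rightarrow> real \<Rightarrow> real \<Rightarrow> real" where
  "arith_op Plus x y = x + y"
| "arith_op Minus x y = x - y"
| "arith_op Times x y = x * y"
| "arith_op Divide x y = x / y"

text \<open>
  \<open>Uniform k p\<close> draws \<open>j\<close> uniformly from \<open>{..k}\<close>, that is, among \<open>k + 1\<close> values.
  The bias in \<open>Coin i p q\<close> is the content of cell \<open>i\<close>, clipped to \<open>[0, 1]\<close> by
  \<^const>\<open>bernoulli_pmf\<close>.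
\<close>

datatype 'a comp =
    Return 'a
  | Const int "'a comp"
  | Arith arith nat nat "'a comp"
  | If_Le nat nat "'a comp" "'a comp"
  | Uniform nat "nat \<Rightarrow> 'a comp"
  | Coin nat "'a comp" "'a comp"

definition tick :: "('a \<times> real list \<times> nat) pmf \<Rightarrow> ('a \<times> real list \<times> nat) pmf" where
  "tick = map_pmf (\<lambda>(a, s, c). (a, s, Suc c))"

text \<open>\<open>run p s\<close> is the joint law of the returned value, the final memory and the time.\<close>

primrec run :: "'a comp \<Rightarrow> real list \<Rightarrow> ('a \<times> real list \<times> nat) pmf" where
  "run (Return a) s = return_pmf (a, s, 0)"
| "run (Const z p) s = tick (run p (s @ [of_int z]))"
| "run (Arith f i j p) s = tick (run p (s @ [arith_op f (s ! i) (s ! j)]))"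
| "run (If_Le i j p q) s = tick (if s ! i \<le> s ! j then run p s else run q s)"
| "run (Uniform k p) s = tick (bind_pmf (pmf_of_set {..k}) (\<lambda>j. run (p j) s))"
| "run (Coin i p q) s =
     tick (bind_pmf (bernoulli_pmf (s ! i)) (\<lambda>t. if t then run p s else run q s))"

definition initial_memory :: "real mat \<Rightarrow> real mat \<Rightarrow> real Matrix.vec \<Rightarrow> real list" where
  "initial_memory E F b = concat (mat_to_list E) @ concat (mat_to_list F) @ list_of_vec b"

text \<open>
  A computed vector is returned as the list of the cells containing its entries.
\<close>

definition output_law :: "nat list comp \<Rightarrow> real list \<Rightarrow> real Matrix.vec pmf" where
  "output_law p s = map_pmf (\<lambda>(cells, s', c). vec_of_list (map (\<lambda>i. s' ! i) cells)) (run p s)"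

text \<open>
  A sparse matrix is returned in coordinate format: its nonzero positions, each with the
  cell containing the entry.
\<close>

type_synonym coordinate_format = "((nat \<times> nat) \<times> nat) list"

definition represents :: "real list \<Rightarrow> coordinate_format \<Rightarrow> real mat \<Rightarrow> bool" where
  "represents s T M \<longleftrightarrow>
     distinct (map fst T) \<and> fst ` set T = mat_support M \<and>
     (\<forall>(pos, a)\<in>set T. a < length s \<and> s ! a = M $$ pos)"

text \<open>
  \<open>computes_factorization k M p s \<kappa>\<close>: on the initial memory \<open>s\<close>, the program \<open>p\<close> computes a
  \<open>k\<close>-sparse factorization \<open>C * D\<close> of \<open>M\<close> in time at most \<open>\<kappa>\<close>. The first returned component
  is the number of columns of \<open>C\<close>.
\<close>

definition computes_factorization ::
  "nat \<Rightarrow> real mat \<Rightarrow> (nat \<times> coordinate_format \<times> coordinate_format) comp \<Rightarrow>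
     real list \<Rightarrow> nat \<Rightarrow> bool" where
  "computes_factorization k M p s \<kappa> \<longleftrightarrow>
     (\<forall>((l, T\<^sub>C, T\<^sub>D), s', c)\<in>set_pmf (run p s).
        c \<le> \<kappa> \<and>
        (\<exists>C D. C \<in> carrier_mat (dim_row M) l \<and> D \<in> carrier_mat l (dim_col M) \<and>
           sparse_factorization k M C D \<and> represents s' T\<^sub>C C \<and> represents s' T\<^sub>D D))"


section \<open>The standing hypotheses\<close>

text \<open>\<open>B\<close> is the inverse of \<open>E\<close>.\<close>

definition setting ::
  "nat \<Rightarrow> nat \<Rightarrow> nat \<Rightarrow> nat \<Rightarrow> nat \<Rightarrow> nat \<Rightarrow> (nat \<Rightarrow> nat set set) \<Rightarrow>
     real mat \<Rightarrow> real mat \<Rightarrow> real mat \<Rightarrow> bool" where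
  "setting n m r d h f P E B F \<longleftrightarrow>
     n < m \<and>
     E \<in> carrier_mat n n \<and> B \<in> carrier_mat n n \<and> inverts_mat E B \<and> inverts_mat B E \<and>
     dendrogram n h P \<and> d = max_degree h P \<and> hierarchical_matrix n h P r B \<and>
     F \<in> carrier_mat n (m - n) \<and> column_sparse f F"

end

(*
  Sparse factorization.  Every entry of the hierarchical matrix lies in exactly one block of rank at
  most r between siblings (or in a 1x1 diagonal block); a rank factorization of each block yields
  the columns of C and rows of D.  If the columns of C are ordered by the height of their supports,
  then an overlap with a later column can only be with an ancestor, so that at each height
  the overlaps counted for column j of D come from pairs of children of one single node.

  Running time.  With B = CD and v_i = D f_i, the iterate is stored as x = (C u, w), and the direction
  is q_i = (C v_i, -e_i).  Write the Gram matrix of C as T + T^t with T upper triangular.  Then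
  x . q_i = (T^t v_i) . u + v_i . (T^t u) - w_i, and only forward overlaps enter T^t v_i.  So maintaining
  u together with y = T^t u makes an iteration touch only the at most f k forward overlaps of v_i.
  The directions are drawn in constant time from a precomputed alias table.

  Convergence.  The error x - x* is Q y for some y, and the bottom block of Q is -I, hence
  |Q^t e| >= |e|.  So a step contracts the expected squared error by 1 - 1 / |Q|_Frob^2.
*)

theory Submission
  imports Defs
begin

unbundle no vec_syntax

section \<open>Sparse factorization of a hierarchical matrix\<close>

text \<open>A column of \<open>C\<close> belonging to a child of the root may be supported on all
  rows of that child, so a step can afford neither \<open>x\<close> nor \<open>C v_i\<close>; it has
  to work on the coordinates \<open>u\<close> alone. There \<open>v_i . (G u)\<close>, with
  \<open>G\<close> the Gram matrix of \<open>C\<close>, would read for each index in the support of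
  \<open>v_i\<close> its overlaps in both directions, and sparsity bounds only the forward ones. The
  splitting of \<open>G\<close> puts the backward ones into \<open>y\<close>, which is never
  recomputed: a step subtracts from it a multiple of the tabulated vector \<open>T^t v_i\<close>, a
  combination of at most \<open>f\<close> columns of \<open>T^t D\<close>. The sparsity bound also
  bounds rows of \<open>C\<close>, which pays for the Gram matrix and for writing out the last
  iterate. A computation tree resolves addresses and loop bounds while it is built, so programs may
  depend freely on supports but not on real entries. That is why the supports of \<open>C\<close>
  and \<open>D\<close> are taken from the value that the factorization returns, and why sampling,
  for which only uniform draws and single coins exist, needs a table whose shape is decided by
  comparisons.\<close>

text \<open>A maximal independent set \<open>S\<close> of columns has \<open>rank A\<close> elements
  and spans every column, since a column outside its span could be added. Its elements give
  \<open>u\<close>, the coefficients give \<open>v\<close>.\<close>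

lemma (in vec_space) rank_le_imp_sum_products:
  assumes A: "A \<in> carrier_mat n nc" and "rank A \<le> r"
  shows "\<exists>u v. \<forall>i<n. \<forall>j<nc. A $$ (i, j) = (\<Sum>s<r. u s i * v s j)"
proof -
  let ?P = "\<lambda>T. T \<subseteq> set (cols A) \<and> lin_indpt T"
  have carrier: "set (cols A) \<subseteq> carrier_vec n"
    using A cols_dim by blast
  obtain S where S: "maximal S ?P"
    using maximal_exists_superset[of "set (cols A)" ?P "{}"]
    by (metis (no_types, lifting) List.finite_set empty_subsetI finite_lin_indpt2 empty_iff finite.emptyI)
  have sub: "S \<subseteq> set (cols A)" and ind: "lin_indpt S" using S by (auto simp: maximal_def)
  have fin: "finite S" and Sc: "S \<subseteq> carrier_vec n"
    using sub carrier by (auto intro: finite_subset)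
  have card: "card S \<le> r" using rank_card_indpt[OF A S] assms(2) by simp
  have span: "x \<in> span S" if "x \<in> set (cols A)" for x
  proof (rule ccontr)
    assume x: "x \<notin> span S"
    then have "x \<notin> S" using Sc span_mem by blast
    have "lin_indpt (insert x S)"
      using lin_dep_iff_in_span[OF Sc ind, of x] x \<open>x \<notin> S\<close> that carrier by auto
    then have "insert x S = S"
      using S that unfolding maximal_def by blast
    then show False using \<open>x \<notin> S\<close> by blast
  qed
  have "\<exists>c. \<forall>i<n. A $$ (i, j) = (\<Sum>x\<in>S. c x * x $ i)" if "j < nc" for j
  proof -
    have "col A j \<in> span S" using that A by (intro span) (auto simp: cols_def)
    then obtain c where "col A j = lincomb c S"
      using finite_in_span[OF fin Sc] by metis
    then show ?thesis using lincomb_index[OF _ Sc] A that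
      by (metis carrier_matD index_col)
  qed
  then obtain c where c: "\<And>i j. i < n \<Longrightarrow> j < nc \<Longrightarrow> A $$ (i, j) = (\<Sum>x\<in>S. c j x * x $ i)"
    by metis
  obtain e where e: "bij_betw e {..<card S} S"
    using bij_betw_from_nat_into_finite[OF fin] by blast
  show ?thesis
  proof (intro exI allI impI)
    fix i j assume ij: "i < n" "j < nc"
    have "A $$ (i, j) = (\<Sum>s<card S. e s $ i * c j (e s))"
      using c[OF ij] sum.reindex_bij_betw[OF e, of "\<lambda>x. c j x * x $ i"] by (simp add: mult.commute)
    \<comment> \<open>Zero coefficients pad the sum from \<open>card S\<close> to \<open>r\<close>
      terms, so that all blocks share the index range \<open>{..<r}\<close>.\<close>
    also have "\<dots> = (\<Sum>s<r. e s $ i * (if s < card S then c j (e s) else 0))"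
      by (intro sum.mono_neutral_cong_left) (use card in auto)
    finally show "A $$ (i, j) = (\<Sum>s<r. e s $ i * (if s < card S then c j (e s) else 0))" .
  qed
qed

text \<open>\<open>submatrix\<close> renumbers its rows and columns consecutively: row
  \<open>i\<close> of \<open>M\<close> becomes the row whose number is the count of elements of
  \<open>I\<close> below \<open>i\<close>. Composing the factors of the block with this renumbering
  expresses them in the indices of \<open>M\<close>.\<close>

lemma mat_rank_submatrix_le_imp_sum_products:
  assumes M: "M \<in> carrier_mat n m" and "mat_rank (submatrix M I J) \<le> r"
  shows "\<exists>u v. \<forall>i\<in>I. \<forall>j\<in>J. i < n \<longrightarrow> j < m \<longrightarrow> M $$ (i, j) = (\<Sum>s<r. u s i * v s j)"
proof -
  let ?S = "submatrix M I J"
  let ?p = "\<lambda>i. card {a \<in> I. a < i}" and ?q = "\<lambda>j. card {a \<in> J. a < j}"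
  obtain u v where uv: "\<And>i j. i < dim_row ?S \<Longrightarrow> j < dim_col ?S \<Longrightarrow> ?S $$ (i, j) = (\<Sum>s<r. u s i * v s j)"
    using vec_space.rank_le_imp_sum_products[of ?S "dim_row ?S" "dim_col ?S" r] assms(2)
    unfolding mat_rank_def by auto
  have "M $$ (i, j) = (\<Sum>s<r. u s (?p i) * v s (?q j))"
    if "i \<in> I" "j \<in> J" "i < n" "j < m" for i j
  proof -
    have "{a \<in> I. a < i} \<subset> {a. a < dim_row M \<and> a \<in> I}" "{a \<in> J. a < j} \<subset> {a. a < dim_col M \<and> a \<in> J}"
      using that M by auto
    then have "?p i < dim_row ?S" "?q j < dim_col ?S"
      unfolding dim_submatrix by (auto intro: psubset_card_mono)
    then show ?thesis using uv submatrix_index_card[of i M j I J] that M by auto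
  qed
  then show ?thesis by (intro exI[of _ "\<lambda>s i. u s (?p i)"] exI[of _ "\<lambda>s j. v s (?q j)"]) auto
qed

text \<open>Each \<open>t\<close> is a rank one term, a column of \<open>C\<close> times a row of
  \<open>D\<close>. Vanishing terms are dropped to make all columns and rows nonzero; sorting by
  \<open>lev\<close> turns a larger position into a \<open>lev\<close> that is not smaller, so
  forward overlaps inject into the set counted in \<open>overlap\<close>. Ties in \<open>lev\<close>
  may be ordered arbitrarily.\<close>

lemma sparse_factorization_of_sum:
  fixes lev :: "'t \<Rightarrow> nat" and u v :: "'t \<Rightarrow> nat \<Rightarrow> real"
  assumes "finite X" and M: "M \<in> carrier_mat n m"
    and sum: "\<And>i j. i < n \<Longrightarrow> j < m \<Longrightarrow> M $$ (i, j) = (\<Sum>t\<in>X. u t i * v t j)"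
    and overlap: "\<And>j. j < m \<Longrightarrow>
      card {t' \<in> X. \<exists>t\<in>X. v t j \<noteq> 0 \<and> lev t \<le> lev t' \<and> (\<exists>i<n. u t i \<noteq> 0 \<and> u t' i \<noteq> 0)} \<le> k"
  shows "\<exists>C D. sparse_factorization k M C D"
proof -
  define Y where "Y = {t \<in> X. (\<exists>i<n. u t i \<noteq> 0) \<and> (\<exists>j<m. v t j \<noteq> 0)}"
  have "finite Y" using \<open>finite X\<close> by (simp add: Y_def)
  then obtain ys where ys: "set ys = Y" "distinct ys" using finite_distinct_list by blast
  define ts where "ts = sort_key lev ys"
  have ts: "set ts = Y" "distinct ts" "sorted (map lev ts)" using ys by (auto simp: ts_def)
  have mono: "lev (ts ! a) \<le> lev (ts ! b)" if "a \<le> b" "b < length ts" for a b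
    using sorted_nth_mono[OF ts(3), of a b] that by simp
  have mem: "ts ! a \<in> Y" if "a < length ts" for a using that ts(1) by auto
  define C where "C = mat n (length ts) (\<lambda>(i, a). u (ts ! a) i)"
  define D where "D = mat (length ts) m (\<lambda>(a, j). v (ts ! a) j)"
  have "M = C * D"
  proof (rule eq_matI)
    fix i j assume "i < dim_row (C * D)" "j < dim_col (C * D)"
    then have ij: "i < n" "j < m" by (auto simp: C_def D_def)
    have "(C * D) $$ (i, j) = (\<Sum>a<length ts. u (ts ! a) i * v (ts ! a) j)"
      using ij by (auto simp: C_def D_def scalar_prod_def lessThan_atLeast0)
    also have "\<dots> = (\<Sum>t\<in>Y. u t i * v t j)"
      using sum.reindex_bij_betw[OF bij_betw_nth[OF ts(2) refl refl], of "\<lambda>t. u t i * v t j"] ts(1) by simp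
    also have "\<dots> = (\<Sum>t\<in>X. u t i * v t j)"
      using \<open>finite X\<close> ij by (intro sum.mono_neutral_left) (auto simp: Y_def)
    finally show "M $$ (i, j) = (C * D) $$ (i, j)" using sum[OF ij] by simp
  qed (use M in \<open>auto simp: C_def D_def\<close>)
  moreover have "col C a \<noteq> 0\<^sub>v (dim_row C)" if "a < dim_col C" for a
  proof -
    have "a < length ts" using that by (simp add: C_def)
    then obtain i where "i < n" "u (ts ! a) i \<noteq> 0" using mem by (auto simp: Y_def)
    then have "col C a $ i \<noteq> 0" using that by (simp add: C_def)
    then show ?thesis using \<open>i < n\<close> by (auto simp: C_def)
  qed
  moreover have "row D a \<noteq> 0\<^sub>v (dim_col D)" if "a < dim_row D" for a
  proof -
    have "a < length ts" using that by (simp add: D_def)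
    then obtain j where "j < m" "v (ts ! a) j \<noteq> 0" using mem by (auto simp: Y_def)
    then have "row D a $ j \<noteq> 0" using that by (simp add: D_def)
    then show ?thesis using \<open>j < m\<close> by (auto simp: D_def)
  qed
  moreover have "card (\<Union>a\<in>col_support D j. forward_overlap C a) \<le> k" if "j < dim_col D" for j
  proof -
    let ?U = "\<Union>a\<in>col_support D j. forward_overlap C a"
    let ?T = "{t' \<in> X. \<exists>t\<in>X. v t j \<noteq> 0 \<and> lev t \<le> lev t' \<and> (\<exists>i<n. u t i \<noteq> 0 \<and> u t' i \<noteq> 0)}"
    have j: "j < m" using that by (simp add: D_def)
    have sub: "?U \<subseteq> {..<length ts}" by (auto simp: forward_overlap_def C_def)
    have img: "(!) ts ` ?U \<subseteq> ?T"
    proof clarify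
      fix a b assume a: "a \<in> col_support D j" and b: "b \<in> forward_overlap C a"
      have al: "a < length ts" and v: "v (ts ! a) j \<noteq> 0"
        using a j by (auto simp: col_support_def D_def)
      have bl: "b < length ts" and ab: "a \<le> b"
        using b by (auto simp: forward_overlap_def C_def)
      obtain i where "i < n" "u (ts ! a) i \<noteq> 0" "u (ts ! b) i \<noteq> 0"
        using b al bl by (auto simp: forward_overlap_def col_support_def C_def)
      then show "ts ! b \<in> X \<and> (\<exists>t\<in>X. v t j \<noteq> 0 \<and> lev t \<le> lev (ts ! b) \<and>
          (\<exists>i<n. u t i \<noteq> 0 \<and> u (ts ! b) i \<noteq> 0))"
        using mem[OF al] mem[OF bl] mono[OF ab bl] v by (auto simp: Y_def)
    qed
    have "inj_on ((!) ts) ?U" using sub ts(2) by (intro inj_on_nth) auto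
    then have "card ?U \<le> card ?T"
      using img \<open>finite X\<close> by (intro card_inj_on_le) auto
    then show ?thesis using overlap[OF j] by linarith
  qed
  ultimately have "sparse_factorization k M C D"
    using M by (auto simp: sparse_factorization_def C_def D_def)
  then show ?thesis by blast
qed

section \<open>Nodes of a dendrogram and blocks between siblings\<close>

definition node :: "'a set set \<Rightarrow> 'a \<Rightarrow> 'a set" where
  "node Q x = (THE I. I \<in> Q \<and> x \<in> I)"

lemma node_eq:
  assumes "partition_on A Q" "I \<in> Q" "x \<in> I"
  shows "node Q x = I"
  unfolding node_def using assms by (intro the_equality) (auto simp: partition_on_def disjoint_def)

lemma node_mem:
  assumes "partition_on A Q" "x \<in> A"
  shows "node Q x \<in> Q" "x \<in> node Q x"
proof -
  obtain I where "I \<in> Q" "x \<in> I" using assms by (auto simp: partition_on_def)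
  then show "node Q x \<in> Q" "x \<in> node Q x" using node_eq[OF assms(1)] by auto
qed

context
  fixes n h :: nat and P :: "nat \<Rightarrow> nat set set"
  assumes dendro: "dendrogram n h P"
begin

lemma dendrogram_partition: "i \<le> h \<Longrightarrow> partition_on {..<n} (P i)"
  using dendro by (simp add: dendrogram_def)

lemma dendrogram_size_pos: "0 < n"
  using dendrogram_partition[of h] dendro by (auto simp: dendrogram_def partition_on_def)

lemma dendrogram_finite: "i \<le> h \<Longrightarrow> finite (P i)"
  using dendrogram_partition finite_elements by blast

lemma dendrogram_parent: "i < h \<Longrightarrow> I \<in> P i \<Longrightarrow> \<exists>K\<in>P (Suc i). I \<subseteq> K"
  using dendro by (simp add: dendrogram_def refines_def)

lemma node_subset_node_Suc:
  assumes "i < h" "x < n"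
  shows "node (P i) x \<subseteq> node (P (Suc i)) x"
proof -
  have "node (P i) x \<in> P i" "x \<in> node (P i) x"
    using node_mem[OF dendrogram_partition, of i x] assms by auto
  moreover obtain K where "K \<in> P (Suc i)" "node (P i) x \<subseteq> K"
    using dendrogram_parent \<open>node (P i) x \<in> P i\<close> assms by blast
  ultimately show ?thesis using node_eq[OF dendrogram_partition, of "Suc i" K x] assms by auto
qed

lemma node_eq_mono:
  assumes "node (P i) x = node (P i) y" "i \<le> i'" "i' \<le> h" "x < n" "y < n"
  shows "node (P i') x = node (P i') y"
  using assms(2,3)
proof (induction i' rule: dec_induct)
  case base
  then show ?case using assms(1) by simp
next
  case (step k)
  have "y \<in> node (P k) y" using node_mem[OF dendrogram_partition, of k y] step assms by auto
  then have "y \<in> node (P (Suc k)) x" using node_subset_node_Suc[of k x] step assms by auto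
  then show ?case
    using node_eq[OF dendrogram_partition, of "Suc k" "node (P (Suc k)) x" y]
      node_mem[OF dendrogram_partition, of "Suc k" x] step assms by auto
qed

text \<open>\<open>elementary_blocks\<close> recurses from the root downwards, hence the induction
  on the distance \<open>h - i\<close> to the root, which passes from a node to its parent.\<close>

lemma elementary_blocks_subset:
  assumes "i \<le> h" "I \<in> P i"
  shows "elementary_blocks P i I \<subseteq> elementary_blocks P h {..<n}"
  using assms
proof (induction "h - i" arbitrary: i I)
  case 0
  then have "i = h" by simp
  then show ?case using 0 dendro by (simp add: dendrogram_def)
next
  case (Suc a)
  then have i: "i < h" by simp
  then obtain K where K: "K \<in> P (Suc i)" "I \<subseteq> K"
    using dendrogram_parent Suc(4) by blast
  then have "elementary_blocks P i I \<subseteq> elementary_blocks P (Suc i) K"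
    using Suc(4) by auto
  also have "\<dots> \<subseteq> elementary_blocks P h {..<n}"
    using Suc(2) i K by (intro Suc(1)) auto
  finally show ?case .
qed

definition sibling_blocks :: "(nat \<times> nat set \<times> nat set) set" where
  "sibling_blocks = {(i, J, J'). i < h \<and> J \<in> P i \<and> J' \<in> P i \<and> (J = J' \<longrightarrow> i = 0) \<and>
     (\<exists>K\<in>P (Suc i). J \<subseteq> K \<and> J' \<subseteq> K)}"

lemma sibling_blocks_elementary:
  assumes "(i, J, J') \<in> sibling_blocks"
  shows "(J, J') \<in> elementary_blocks P h {..<n}"
proof (cases "J = J'")
  case True
  then show ?thesis using assms elementary_blocks_subset[of 0 J] by (auto simp: sibling_blocks_def)
next
  case False
  then obtain K where "i < h" "K \<in> P (Suc i)" "(J, J') \<in> elementary_blocks P (Suc i) K"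
    using assms by (auto simp: sibling_blocks_def)
  then show ?thesis using elementary_blocks_subset[of "Suc i" K] by auto
qed

lemma finite_sibling_blocks: "finite sibling_blocks"
proof (rule finite_subset)
  show "sibling_blocks \<subseteq> {..<h} \<times> (\<Union>i<h. P i) \<times> (\<Union>i<h. P i)"
    by (auto simp: sibling_blocks_def)
qed (auto intro!: finite_cartesian_product simp: dendrogram_finite)

text \<open>The heights at which \<open>x\<close> and \<open>y\<close> share a node form an upper
  interval containing \<open>h\<close>. The block sits just below the first shared height above 0:
  there the two nodes are distinct siblings, or equal singletons when \<open>x = y\<close>.\<close>

lemma sibling_blocks_cover:
  assumes "0 < h" "x < n" "y < n"
  shows "\<exists>!t. t \<in> sibling_blocks \<and> x \<in> fst (snd t) \<and> y \<in> snd (snd t)"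
proof -
  note mem = node_mem[OF dendrogram_partition] and eq = node_eq[OF dendrogram_partition]
  define E where "E i \<longleftrightarrow> node (P i) x = node (P i) y" for i
  have block: "(i, J, J') \<in> sibling_blocks \<and> x \<in> J \<and> y \<in> J' \<longleftrightarrow>
      i < h \<and> J = node (P i) x \<and> J' = node (P i) y \<and> (E i \<longrightarrow> i = 0) \<and> E (Suc i)" for i J J'
  proof
    assume L: "(i, J, J') \<in> sibling_blocks \<and> x \<in> J \<and> y \<in> J'"
    then obtain K where K: "K \<in> P (Suc i)" "J \<subseteq> K" "J' \<subseteq> K" and i: "i < h" "J \<in> P i" "J' \<in> P i"
      "J = J' \<longrightarrow> i = 0" by (auto simp: sibling_blocks_def)
    have "node (P i) x = J" "node (P i) y = J'" 
      using i L by (simp_all add: eq[of i J x] eq[of i J' y])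
    moreover have "node (P (Suc i)) x = K" "node (P (Suc i)) y = K" 
      using i K L by (simp_all add: eq[of "Suc i" K x] eq[of "Suc i" K y] subset_iff)
    ultimately
    show "i < h \<and> J = node (P i) x \<and> J' = node (P i) y \<and> (E i \<longrightarrow> i = 0) \<and> E (Suc i)"
      using i by (simp add: E_def)
  next
    assume R: "i < h \<and> J = node (P i) x \<and> J' = node (P i) y \<and> (E i \<longrightarrow> i = 0) \<and> E (Suc i)"
    then have "J \<subseteq> node (P (Suc i)) x" "J' \<subseteq> node (P (Suc i)) x"
      using node_subset_node_Suc[of i] assms by (auto simp: E_def)
    then show "(i, J, J') \<in> sibling_blocks \<and> x \<in> J \<and> y \<in> J'"
      using R mem[of i x] mem[of i y] mem[of "Suc i" x] assms by (auto simp: sibling_blocks_def E_def)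
  qed
  have mono: "E i'" if "E i" "i \<le> i'" "i' \<le> h" for i i'
    using that node_eq_mono[of i x y i'] assms by (simp add: E_def)
  have "P h = {{..<n}}" using dendro by (simp add: dendrogram_def)
  then have "E h" using mem[of h x] mem[of h y] assms by (auto simp: E_def)
  define a where "a = (LEAST i. E (Suc i))"
  have "E (Suc (h - 1))" using \<open>E h\<close> assms by simp
  then have a: "E (Suc a)" "a \<le> h - 1" unfolding a_def by (auto intro: LeastI Least_le)
  have least: "a \<le> i" if "E (Suc i)" for i unfolding a_def using that by (rule Least_le)
  have a0: "E a \<longrightarrow> a = 0" using least[of "a - 1"] by (cases a) auto
  have unique: "i = a" if "i < h" "E i \<longrightarrow> i = 0" "E (Suc i)" for i
    using least[of i] mono[of "Suc a" i] a that by (cases "i = a") auto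
  show ?thesis
  proof (rule ex1I[of _ "(a, node (P a) x, node (P a) y)"])
    show "(a, node (P a) x, node (P a) y) \<in> sibling_blocks \<and>
      x \<in> fst (snd (a, node (P a) x, node (P a) y)) \<and> y \<in> snd (snd (a, node (P a) x, node (P a) y))"
      using block[of a "node (P a) x" "node (P a) y"] a a0 assms by simp
  next
    fix t assume t: "t \<in> sibling_blocks \<and> x \<in> fst (snd t) \<and> y \<in> snd (snd t)"
    obtain i J J' where tt: "t = (i, J, J')" using prod_cases3 by blast
    then show "t = (a, node (P a) x, node (P a) y)"
      using block[of i J J'] t unique[of i] by auto
  qed
qed

text \<open>The row \<open>z\<close> and the column \<open>j\<close> both lie below the parent of
  \<open>J\<close> and \<open>J'\<close>, hence in one node at every greater height. So the parent
  of \<open>K\<close> and \<open>K'\<close> is the node of \<open>j\<close>, whatever the first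
  block was.\<close>

lemma sibling_blocks_overlap:
  assumes "(i, J, J') \<in> sibling_blocks" "(i', K, K') \<in> sibling_blocks"
    and "i \<le> i'" "z \<in> J" "z \<in> K" "j \<in> J'"
  shows "K \<in> children P (Suc i') (node (P (Suc i')) j) \<and> K' \<in> children P (Suc i') (node (P (Suc i')) j)"
proof -
  note eq = node_eq[OF dendrogram_partition]
  obtain L where L: "i < h" "J \<in> P i" "J' \<in> P i" "L \<in> P (Suc i)" "J \<subseteq> L" "J' \<subseteq> L"
    using assms(1) by (auto simp: sibling_blocks_def)
  obtain L' where L': "i' < h" "K \<in> P i'" "K' \<in> P i'" "L' \<in> P (Suc i')" "K \<subseteq> L'" "K' \<subseteq> L'"
    using assms(2) by (auto simp: sibling_blocks_def)
  have "z < n" "j < n"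
    using dendrogram_partition[of i] L assms by (auto simp: partition_on_def)
  moreover have "node (P (Suc i)) z = node (P (Suc i)) j"
    using eq[of "Suc i" L z] eq[of "Suc i" L j] L assms by auto
  ultimately have "node (P (Suc i')) z = node (P (Suc i')) j"
    using node_eq_mono[of "Suc i" z j "Suc i'"] L L' assms(3) by auto
  moreover have "node (P (Suc i')) z = L'" using eq[of "Suc i'" L' z] L' assms by auto
  ultimately show ?thesis using L' by auto
qed

lemma card_children_le_max_degree:
  assumes "i \<le> h" "I \<in> P i"
  shows "finite (children P i I)" "card (children P i I) \<le> max_degree h P"
proof -
  show "finite (children P i I)"
    using dendrogram_finite[of "i - 1"] assms by (cases i) auto
  show "card (children P i I) \<le> max_degree h P"
    unfolding max_degree_def using assms by (intro Max_ge) (auto simp: dendrogram_finite)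
qed

text \<open>Every height below \<open>h\<close> contributes at most \<open>d\<^sup>2\<close> pairs
  of children of one node, with \<open>r\<close> terms each. The 1x1 diagonal blocks are already
  counted among the pairs at height 0, so \<open>h\<close> heights suffice.\<close>

theorem hierarchical_sparse_factorization:
  assumes "0 < h" and M: "hierarchical_matrix n h P r M" and d: "d = max_degree h P"
  shows "\<exists>C D. sparse_factorization (r * d\<^sup>2 * h) M C D"
proof -
  have Mc: "M \<in> carrier_mat n n" using M by (simp add: hierarchical_matrix_def)
  have "\<exists>u v. \<forall>i\<in>fst (snd t). \<forall>j\<in>snd (snd t). i < n \<longrightarrow> j < n \<longrightarrow> M $$ (i, j) = (\<Sum>s<r. u s i * v s j)"
    if "t \<in> sibling_blocks" for t
    using that M sibling_blocks_elementary[of "fst t" "fst (snd t)" "snd (snd t)"]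
    by (intro mat_rank_submatrix_le_imp_sum_products[OF Mc])
      (auto simp: hierarchical_matrix_def split: prod.splits)
  then obtain u v where uv: "\<And>t i j. t \<in> sibling_blocks \<Longrightarrow> i \<in> fst (snd t) \<Longrightarrow> j \<in> snd (snd t) \<Longrightarrow>
      i < n \<Longrightarrow> j < n \<Longrightarrow> M $$ (i, j) = (\<Sum>s<r. u t s i * v t s j)"
    by metis
  let ?X = "sibling_blocks \<times> {..<r}"
  let ?u = "\<lambda>(t, s) i. if i \<in> fst (snd t) then u t s i else 0"
  let ?v = "\<lambda>(t, s) j. if j \<in> snd (snd t) then v t s j else 0"
  show ?thesis
  proof (rule sparse_factorization_of_sum[where X = ?X and u = ?u and v = ?v and lev = "\<lambda>(t, s). fst t"])
    show "finite ?X" using finite_sibling_blocks by simp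
    show "M \<in> carrier_mat n n" by fact
  next
    fix i j assume ij: "i < n" "j < n"
    obtain t where t: "t \<in> sibling_blocks" "i \<in> fst (snd t)" "j \<in> snd (snd t)"
      and unique: "\<And>t'. t' \<in> sibling_blocks \<Longrightarrow> i \<in> fst (snd t') \<Longrightarrow> j \<in> snd (snd t') \<Longrightarrow> t' = t"
      using sibling_blocks_cover[OF \<open>0 < h\<close> ij] by blast
    have "(\<Sum>x\<in>?X. ?u x i * ?v x j) = (\<Sum>x\<in>{t} \<times> {..<r}. ?u x i * ?v x j)"
      using finite_sibling_blocks t by (intro sum.mono_neutral_right) (force dest: unique split: if_splits)+
    also have "\<dots> = (\<Sum>s<r. u t s i * v t s j)"
      using t by (simp add: sum.cartesian_product')
    finally show "M $$ (i, j) = (\<Sum>x\<in>?X. ?u x i * ?v x j)" using uv[OF t ij] by simp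
  next
    fix j assume j: "j < n"
    \<comment> \<open>Only blocks between two elements of \<open>c i\<close> can occur at height
      \<open>i\<close> as forward overlaps counted for column \<open>j\<close>.\<close>
    define c where "c i = children P (Suc i) (node (P (Suc i)) j)" for i
    have c: "finite (c i)" "card (c i) \<le> d" if "i < h" for i
      using card_children_le_max_degree[of "Suc i" "node (P (Suc i)) j"] that d
        node_mem[OF dendrogram_partition, of "Suc i" j] j unfolding c_def by auto
    let ?T = "{t' \<in> ?X. \<exists>t\<in>?X. ?v t j \<noteq> 0 \<and> (case t of (t, s) \<Rightarrow> fst t) \<le> (case t' of (t, s) \<Rightarrow> fst t) \<and>
      (\<exists>i<n. ?u t i \<noteq> 0 \<and> ?u t' i \<noteq> 0)}"
    let ?S = "(SIGMA i:{..<h}. c i \<times> c i) \<times> {..<r}"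
    have "?T \<subseteq> ?S"
    proof
      fix t' assume "t' \<in> ?T"
      moreover obtain i' K K' s' where t': "t' = ((i', K, K'), s')" by (metis surj_pair)
      ultimately obtain t z where "t \<in> ?X" "?v t j \<noteq> 0" "(case t of (t, s) \<Rightarrow> fst t) \<le> i'"
        "?u t z \<noteq> 0" "?u t' z \<noteq> 0" and s': "s' < r" and b': "(i', K, K') \<in> sibling_blocks"
        by auto
      moreover obtain i J J' s where "t = ((i, J, J'), s)" by (metis surj_pair)
      ultimately have "(i, J, J') \<in> sibling_blocks" "i \<le> i'" "j \<in> J'" "z \<in> J" "z \<in> K"
        using t' by (auto split: if_splits)
      then show "t' \<in> ?S"
        using sibling_blocks_overlap[of i J J' i' K K' z j] b' s' t' by (auto simp: c_def sibling_blocks_def)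
    qed
    moreover have "finite ?S" using c by (intro finite_cartesian_product finite_SigmaI) auto
    ultimately have "card ?T \<le> card ?S" by (rule card_mono[rotated])
    also have "\<dots> = (\<Sum>i<h. card (c i) * card (c i)) * r"
      using c by (simp add: card_cartesian_product card_SigmaI)
    also have "\<dots> \<le> (\<Sum>i<h. d * d) * r"
      using c by (intro mult_right_mono sum_mono mult_mono) auto
    finally show "card ?T \<le> r * d\<^sup>2 * h" by (simp add: power2_eq_square mult_ac)
  qed
qed

end

section \<open>The randomized iteration\<close>

lemma scalar_prod_self_nonneg: "0 \<le> (x :: real Matrix.vec) \<bullet> x"
  by (simp add: scalar_prod_def sum_nonneg)

lemma l2norm_power2: "(l2norm x)\<^sup>2 = x \<bullet> x"
  by (simp add: l2norm_def scalar_prod_self_nonneg)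

lemma scalar_prod_self_eq_0:
  assumes "(x :: real Matrix.vec) \<in> carrier_vec n" "x \<bullet> x = 0"
  shows "x = 0\<^sub>v n"
proof -
  have "\<forall>i\<in>{0..<dim_vec x}. x $ i * x $ i = 0"
    using assms(2) by (subst sum_nonneg_eq_0_iff[symmetric]) (auto simp: scalar_prod_def)
  then show ?thesis using assms(1) by (intro eq_vecI) auto
qed

lemma scalar_prod_mult_mat_vec:
  assumes "Q \<in> carrier_mat m k" "w \<in> carrier_vec k" "(e :: real Matrix.vec) \<in> carrier_vec m"
  shows "e \<bullet> (Q *\<^sub>v w) = (\<Sum>j<k. w $ j * (e \<bullet> col Q j))"
proof -
  have "e \<bullet> (Q *\<^sub>v w) = (\<Sum>i<m. \<Sum>j<k. e $ i * (Q $$ (i, j) * w $ j))"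
    using assms by (simp add: scalar_prod_def sum_distrib_left lessThan_atLeast0)
  also have "\<dots> = (\<Sum>j<k. \<Sum>i<m. e $ i * (Q $$ (i, j) * w $ j))" by (rule sum.swap)
  also have "\<dots> = (\<Sum>j<k. w $ j * (e \<bullet> col Q j))"
    using assms by (simp add: scalar_prod_def sum_distrib_left lessThan_atLeast0 mult_ac)
  finally show ?thesis .
qed

lemma mult_mat_unit_vec_smult:
  assumes "(Q :: real mat) \<in> carrier_mat m k" "j < k"
  shows "Q *\<^sub>v (c \<cdot>\<^sub>v unit_vec k j) = c \<cdot>\<^sub>v col Q j"
  using assms by (subst mult_mat_vec[of _ m k]) auto

text \<open>Normal equations: \<open>w\<close> solves \<open>Q^t Q w = Q^t x\<close>. The Gram
  matrix is nonsingular because \<open>Q^t Q w = 0\<close> forces \<open>|Q w| = 0\<close>.\<close>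

lemma ex_orthogonal_residual:
  fixes x :: "real Matrix.vec"
  assumes Q: "Q \<in> carrier_mat m k" and x: "x \<in> carrier_vec m"
    and inj: "\<And>w. w \<in> carrier_vec k \<Longrightarrow> Q *\<^sub>v w = 0\<^sub>v m \<Longrightarrow> w = 0\<^sub>v k"
  shows "\<exists>w\<in>carrier_vec k. \<forall>j<k. (x - Q *\<^sub>v w) \<bullet> col Q j = 0"
proof -
  let ?G = "Q\<^sup>T * Q"
  have G: "?G \<in> carrier_mat k k" using Q by simp
  have "det ?G \<noteq> 0"
  proof
    assume "det ?G = 0"
    then obtain w where w: "w \<in> carrier_vec k" "w \<noteq> 0\<^sub>v k" "?G *\<^sub>v w = 0\<^sub>v k"
      using det_0_iff_vec_prod_zero_field[OF G] by auto
    have "(Q *\<^sub>v w) \<bullet> (Q *\<^sub>v w) = (Q\<^sup>T *\<^sub>v (Q *\<^sub>v w)) \<bullet> w"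
      using Q w by (intro transpose_vec_mult_scalar[symmetric]) auto
    also have "Q\<^sup>T *\<^sub>v (Q *\<^sub>v w) = ?G *\<^sub>v w"
      using Q w by (intro assoc_mult_mat_vec[symmetric]) auto
    finally have "(Q *\<^sub>v w) \<bullet> (Q *\<^sub>v w) = 0" using w by simp
    then have "Q *\<^sub>v w = 0\<^sub>v m" using Q w by (intro scalar_prod_self_eq_0) auto
    then show False using inj w by blast
  qed
  then obtain H where H: "H \<in> carrier_mat k k" "?G * H = 1\<^sub>m k"
    using det_non_zero_imp_unit[OF G, of "()"] G
    by (auto simp: Units_def ring_mat_def)
  define w where "w = H *\<^sub>v (Q\<^sup>T *\<^sub>v x)"
  have w: "w \<in> carrier_vec k" using H Q x by (simp add: w_def)
  have "Q\<^sup>T *\<^sub>v (Q *\<^sub>v w) = ?G *\<^sub>v w"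
    using Q w by (intro assoc_mult_mat_vec[symmetric]) auto
  also have "\<dots> = (?G * H) *\<^sub>v (Q\<^sup>T *\<^sub>v x)"
    unfolding w_def using Q H x by (intro assoc_mult_mat_vec[symmetric]) auto
  also have "\<dots> = Q\<^sup>T *\<^sub>v x" using H Q x by simp
  finally have eq: "Q\<^sup>T *\<^sub>v (Q *\<^sub>v w) = Q\<^sup>T *\<^sub>v x" .
  have "(x - Q *\<^sub>v w) \<bullet> col Q j = 0" if "j < k" for j
  proof -
    have "(Q\<^sup>T *\<^sub>v (Q *\<^sub>v w)) $ j = (Q\<^sup>T *\<^sub>v x) $ j" using eq by simp
    then have "col Q j \<bullet> (Q *\<^sub>v w) = col Q j \<bullet> x" using that Q by simp
    then show ?thesis
      using Q x w that by (simp add: minus_scalar_prod_distrib[of _ m] comm_scalar_prod[of "col Q j" m x]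
          comm_scalar_prod[of "col Q j" m "Q *\<^sub>v w"])
  qed
  then show ?thesis using w by blast
qed

text \<open>A difference of two solutions lies in the kernel, so Pythagoras gives
  \<open>|x|^2 = |y|^2 + |x - y|^2\<close> for every solution \<open>x\<close>. Uniqueness is proved
  along with minimality because \<open>arg_min\<close> only chooses some minimizer.\<close>

lemma arg_min_l2norm_eqI:
  assumes "A \<in> carrier_mat n m" and y: "y \<in> carrier_vec m" "A *\<^sub>v y = b"
    and orth: "\<And>z. z \<in> carrier_vec m \<Longrightarrow> A *\<^sub>v z = 0\<^sub>v n \<Longrightarrow> y \<bullet> z = 0"
  shows "min_norm_solution m A b = y"
proof -
  let ?P = "\<lambda>x. x \<in> carrier_vec m \<and> A *\<^sub>v x = b"
  have pythagoras: "x \<bullet> x = y \<bullet> y + (x - y) \<bullet> (x - y)" if "?P x" for x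
  proof -
    have "A *\<^sub>v (x - y) = 0\<^sub>v n"
      using that y assms(1) by (subst mult_minus_distrib_mat_vec[of _ n m]) auto
    then have "y \<bullet> (x - y) = 0" using that y by (intro orth) auto
    then have "y \<bullet> x = y \<bullet> y" using that y by (simp add: scalar_prod_minus_distrib[of _ m])
    then show ?thesis using that y
      by (simp add: scalar_prod_minus_distrib[of _ m] minus_scalar_prod_distrib[of _ m] comm_scalar_prod[of x m y])
  qed
  have le: "l2norm y \<le> l2norm x" if "?P x" for x
    using pythagoras[OF that] scalar_prod_self_nonneg[of "x - y"] by (simp add: l2norm_def)
  have "is_arg_min l2norm ?P y" using y le by (auto simp: is_arg_min_linorder)
  moreover have "x = y" if "is_arg_min l2norm ?P x" for x
  proof -
    have x: "?P x" "l2norm x \<le> l2norm y" using that y by (auto simp: is_arg_min_linorder)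
    then have "(x - y) \<bullet> (x - y) = 0"
      using pythagoras[OF x(1)] scalar_prod_self_nonneg[of "x - y"] by (simp add: l2norm_def)
    then have "x - y = 0\<^sub>v m" using x y by (intro scalar_prod_self_eq_0) auto
    moreover have "x $ i = (x - y) $ i + y $ i" if "i < m" for i using that x y by simp
    ultimately show ?thesis using x y by (intro eq_vecI) auto
  qed
  ultimately show ?thesis unfolding min_norm_solution_def arg_min_def by (rule some_equality)
qed

section \<open>Linear convergence\<close>

text \<open>The squared Frobenius norm of \<open>Q\<close>, which is the normalizing constant of
  \<open>column_law\<close>.\<close>

definition total_weight :: "real mat \<Rightarrow> real" where
  "total_weight Q = (\<Sum>j<dim_col Q. col Q j \<bullet> col Q j)"

lemma pmf_column_law:
  assumes "0 < total_weight Q"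
  shows "pmf (column_law Q) j = (if j < dim_col Q then col Q j \<bullet> col Q j / total_weight Q else 0)"
proof -
  let ?f = "\<lambda>j. if j < dim_col Q then (l2norm (col Q j))\<^sup>2 / (\<Sum>i<dim_col Q. (l2norm (col Q i))\<^sup>2) else 0"
  have "(\<integral>\<^sup>+ j. ennreal (?f j) \<partial>count_space UNIV) = (\<Sum>j<dim_col Q. ennreal (?f j))"
    by (intro nn_integral_count_space') auto
  also have "\<dots> = ennreal (\<Sum>j<dim_col Q. ?f j)"
    by (intro sum_ennreal) (auto simp: sum_nonneg)
  also have "(\<Sum>j<dim_col Q. ?f j) = 1"
    using assms by (simp add: l2norm_power2 total_weight_def flip: sum_divide_distrib)
  finally have "pmf (embed_pmf ?f) j = ?f j"
    by (intro pmf_embed_pmf) (auto simp: sum_nonneg)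
  then show ?thesis by (simp add: column_law_def l2norm_power2 total_weight_def)
qed

lemma set_column_law:
  assumes "0 < total_weight Q"
  shows "set_pmf (column_law Q) \<subseteq> {..<dim_col Q}"
  using pmf_column_law[OF assms] by (auto simp: set_pmf_iff split: if_splits)

lemma finite_set_iterate_law:
  assumes "0 < total_weight Q"
  shows "finite (set_pmf (iterate_law Q x t))"
proof (induction t)
  case (Suc t)
  have "finite (set_pmf (column_law Q))"
    using set_column_law[OF assms] by (rule finite_subset) simp
  then show ?case using Suc by simp
qed simp

text \<open>Every step moves along a column of \<open>Q\<close>. The invariant is needed since the
  expansion of \<open>Q\<close> controls only errors that lie in its range.\<close>

lemma iterate_law_offset_in_range:
  assumes Q: "Q \<in> carrier_mat m k" and pos: "0 < total_weight Q" and y: "y \<in> carrier_vec m"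
    and x\<^sub>0: "x\<^sub>0 \<in> carrier_vec m" "w\<^sub>0 \<in> carrier_vec k" "x\<^sub>0 = y + Q *\<^sub>v w\<^sub>0"
  shows "x \<in> set_pmf (iterate_law Q x\<^sub>0 t) \<Longrightarrow> \<exists>w\<in>carrier_vec k. x = y + Q *\<^sub>v w"
proof (induction t arbitrary: x)
  case 0
  then show ?case using x\<^sub>0 by auto
next
  case (Suc t)
  then obtain x' j where x': "x' \<in> set_pmf (iterate_law Q x\<^sub>0 t)" and j: "j \<in> set_pmf (column_law Q)"
    and x: "x = iteration_step (col Q j) x'" by auto
  obtain w where w: "w \<in> carrier_vec k" "x' = y + Q *\<^sub>v w" using Suc.IH[OF x'] by blast
  have j: "j < k" using j set_column_law[OF pos] Q by auto
  define c where "c = (x' \<bullet> col Q j) / (col Q j \<bullet> col Q j)"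
  have "x = y + (Q *\<^sub>v w - Q *\<^sub>v (c \<cdot>\<^sub>v unit_vec k j))"
    using Q y w j unfolding x iteration_step_def c_def[symmetric]
    by (subst mult_mat_unit_vec_smult[of _ m]) (auto intro!: eq_vecI)
  also have "Q *\<^sub>v w - Q *\<^sub>v (c \<cdot>\<^sub>v unit_vec k j) = Q *\<^sub>v (w - c \<cdot>\<^sub>v unit_vec k j)"
    using Q w by (intro mult_minus_distrib_mat_vec[symmetric]) auto
  finally show ?case using w by (intro bexI[of _ "w - c \<cdot>\<^sub>v unit_vec k j"]) auto
qed

text \<open>Since \<open>y\<close> is orthogonal to \<open>q\<close>, the coefficient of the step is
  also that of the error, and the step projects the error onto the complement of
  \<open>q\<close>.\<close>

lemma sq_error_iteration_step:
  assumes q: "q \<in> carrier_vec m" "0 < q \<bullet> q" and "x \<in> carrier_vec m" "y \<in> carrier_vec m" "y \<bullet> q = 0"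
  shows "(iteration_step q x - y) \<bullet> (iteration_step q x - y)
    = (x - y) \<bullet> (x - y) - ((x - y) \<bullet> q)\<^sup>2 / (q \<bullet> q)"
proof -
  define e where "e = x - y"
  have e: "e \<in> carrier_vec m" using assms by (simp add: e_def)
  define c where "c = (e \<bullet> q) / (q \<bullet> q)"
  have "x \<bullet> q = e \<bullet> q" using assms by (simp add: e_def minus_scalar_prod_distrib[of _ m])
  then have "iteration_step q x - y = e - c \<cdot>\<^sub>v q"
    using assms by (auto simp: iteration_step_def e_def c_def intro!: eq_vecI)
  then have "(iteration_step q x - y) \<bullet> (iteration_step q x - y) = e \<bullet> e - 2 * c * (e \<bullet> q) + c * c * (q \<bullet> q)"
    using q e by (simp add: scalar_prod_minus_distrib[of _ m] minus_scalar_prod_distrib[of _ m]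
        comm_scalar_prod[of q m e] algebra_simps)
  also have "\<dots> = e \<bullet> e - (e \<bullet> q)\<^sup>2 / (q \<bullet> q)"
    using q by (simp add: c_def power2_eq_square field_simps)
  finally show ?thesis by (simp add: e_def)
qed

text \<open>
  The hypothesis \<open>expand\<close> says that the smallest singular value of \<open>Q\<close> is at least \<open>1\<close>.
\<close>

lemma expected_sq_error_Suc:
  assumes Q: "Q \<in> carrier_mat m k" and nz: "\<And>j. j < k \<Longrightarrow> 0 < col Q j \<bullet> col Q j"
    and pos: "0 < total_weight Q"
    and expand: "\<And>w. w \<in> carrier_vec k \<Longrightarrow> w \<bullet> w \<le> (Q *\<^sub>v w) \<bullet> (Q *\<^sub>v w)"
    and y: "y \<in> carrier_vec m" "\<And>j. j < k \<Longrightarrow> y \<bullet> col Q j = 0"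
    and x\<^sub>0: "x\<^sub>0 \<in> carrier_vec m" "w\<^sub>0 \<in> carrier_vec k" "x\<^sub>0 = y + Q *\<^sub>v w\<^sub>0"
  shows "expected_sq_error (iterate_law Q x\<^sub>0 (Suc t)) y
    \<le> (1 - 1 / total_weight Q) * expected_sq_error (iterate_law Q x\<^sub>0 t) y"
proof -
  let ?p = "iterate_law Q x\<^sub>0 t" and ?\<tau> = "total_weight Q"
  let ?err = "\<lambda>x. (l2norm (x - y))\<^sup>2"
  let ?step = "\<lambda>x. map_pmf (\<lambda>j. iteration_step (col Q j) x) (column_law Q)"
  note fin = finite_set_iterate_law[OF pos, of x\<^sub>0 t]
  have fin_law: "finite (set_pmf (column_law Q))"
    using set_column_law[OF pos] by (rule finite_subset) simp
  have step: "measure_pmf.expectation (?step x) ?err \<le> (1 - 1 / ?\<tau>) * ?err x" if x_in: "x \<in> set_pmf ?p" for x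
  proof -
    obtain w where w: "w \<in> carrier_vec k" "x = y + Q *\<^sub>v w"
      using iterate_law_offset_in_range[OF Q pos y(1) x\<^sub>0 x_in] by blast
    define e where "e = Q *\<^sub>v w"
    have e: "e \<in> carrier_vec m" "x - y = e" "x \<in> carrier_vec m"
      using w y Q by (auto simp: e_def)
    define S where "S = (\<Sum>j<k. (e \<bullet> col Q j)\<^sup>2)"
    have "measure_pmf.expectation (?step x) ?err
        = (\<Sum>j<k. ?err (iteration_step (col Q j) x) * pmf (column_law Q) j)"
      using set_column_law[OF pos] Q by (simp add: integral_measure_pmf_real[of "{..<k}"] subset_iff)
    \<comment> \<open>The factor \<open>col Q j \<bullet> col Q j\<close> of the probability cancels
      the denominator of the decrease.\<close>
    also have "\<dots> = (\<Sum>j<k. (e \<bullet> e) * (col Q j \<bullet> col Q j / ?\<tau>) - (e \<bullet> col Q j)\<^sup>2 / ?\<tau>)"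
    proof (intro sum.cong refl)
      fix j assume "j \<in> {..<k}"
      then have j: "j < k" by simp
      have "?err (iteration_step (col Q j) x) = e \<bullet> e - (e \<bullet> col Q j)\<^sup>2 / (col Q j \<bullet> col Q j)"
        unfolding l2norm_power2
        using sq_error_iteration_step[of "col Q j" m x y] Q j e y nz by auto
      then show "?err (iteration_step (col Q j) x) * pmf (column_law Q) j
          = (e \<bullet> e) * (col Q j \<bullet> col Q j / ?\<tau>) - (e \<bullet> col Q j)\<^sup>2 / ?\<tau>"
        using pmf_column_law[OF pos, of j] j Q nz[OF j] by (simp add: left_diff_distrib diff_divide_distrib)
    qed
    also have "\<dots> = (e \<bullet> e) * (?\<tau> / ?\<tau>) - S / ?\<tau>"
      using Q by (simp add: sum_subtractf S_def total_weight_def flip: sum_distrib_left sum_divide_distrib)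
    also have "\<dots> = e \<bullet> e - S / ?\<tau>" using pos by simp
    \<comment> \<open>With \<open>e = Q w\<close>, Cauchy-Schwarz gives
      \<open>|e|^4 <= |w|^2 * S <= |e|^2 * S\<close>, the second inequality by
      \<open>expand\<close>. Hence \<open>S\<close> is at least \<open>|e|^2\<close>.\<close>
    also have "\<dots> \<le> e \<bullet> e - (e \<bullet> e) / ?\<tau>"
    proof -
      have "(e \<bullet> e)\<^sup>2 = (\<Sum>j<k. w $ j * (e \<bullet> col Q j))\<^sup>2"
        using scalar_prod_mult_mat_vec[OF Q w(1) e(1)] by (simp add: e_def)
      also have "\<dots> \<le> (\<Sum>j<k. (w $ j)\<^sup>2) * S"
        unfolding S_def by (rule Cauchy_Schwarz_ineq_sum)
      also have "(\<Sum>j<k. (w $ j)\<^sup>2) = w \<bullet> w"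
        using w by (simp add: scalar_prod_def power2_eq_square lessThan_atLeast0)
      also have "w \<bullet> w * S \<le> (e \<bullet> e) * S"
        using expand[OF w(1)] by (intro mult_right_mono) (auto simp: e_def S_def sum_nonneg)
      finally have "e \<bullet> e \<le> S"
        using scalar_prod_self_nonneg[of e]
        by (cases "e \<bullet> e = 0") (auto simp: S_def sum_nonneg power2_eq_square)
      then show ?thesis using pos by (simp add: divide_right_mono)
    qed
    finally show ?thesis using pos by (simp add: l2norm_power2 e(2) field_simps)
  qed
  have "expected_sq_error (iterate_law Q x\<^sub>0 (Suc t)) y
      = (\<Sum>x\<in>set_pmf ?p. pmf ?p x *\<^sub>R measure_pmf.expectation (?step x) ?err)"
    unfolding expected_sq_error_def iterate_law.simps
    using fin fin_law by (intro pmf_expectation_bind) auto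
  also have "\<dots> \<le> (\<Sum>x\<in>set_pmf ?p. pmf ?p x *\<^sub>R ((1 - 1 / ?\<tau>) * ?err x))"
    using step by (intro sum_mono) (auto intro!: mult_left_mono)
  also have "\<dots> = (1 - 1 / ?\<tau>) * (\<Sum>x\<in>set_pmf ?p. ?err x * pmf ?p x)"
    by (simp add: sum_distrib_left mult_ac)
  also have "(\<Sum>x\<in>set_pmf ?p. ?err x * pmf ?p x) = expected_sq_error ?p y"
    unfolding expected_sq_error_def by (rule integral_measure_pmf_real[symmetric]) (auto simp: fin)
  finally show ?thesis .
qed

text \<open>From \<open>1 - z <= exp (- z)\<close>: \<open>N\<close> is
  \<open>ln \<rho> * \<tau>\<close> rounded up, and rounding costs at most
  \<open>1 <= \<tau>\<close>, whence the constant \<open>ln \<rho> + 1\<close>.\<close>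

lemma linear_rate:
  fixes e :: "nat \<Rightarrow> real"
  assumes step: "\<And>t. e (Suc t) \<le> (1 - 1 / \<tau>) * e t" and e: "\<And>t. 0 \<le> e t" and "1 \<le> \<tau>" "1 < \<rho>"
  shows "\<exists>N. real N \<le> (ln \<rho> + 1) * \<tau> \<and> (\<forall>t. e (t + N) \<le> e t / \<rho>)"
proof -
  define N where "N = nat \<lceil>ln \<rho> * \<tau>\<rceil>"
  have "0 < ln \<rho>" using assms by simp
  have N: "real N \<le> ln \<rho> * \<tau> + 1" "ln \<rho> * \<tau> \<le> real N"
    unfolding N_def using assms \<open>0 < ln \<rho>\<close> by (auto simp: of_nat_nat zero_le_mult_iff)
  have "(1 - 1 / \<tau>) ^ N \<le> exp (- 1 / \<tau>) ^ N"
    using assms exp_ge_add_one_self[of "- 1 / \<tau>"] by (intro power_mono) auto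
  also have "\<dots> = exp (- (real N / \<tau>))" by (simp flip: exp_of_nat_mult)
  also have "\<dots> \<le> exp (- ln \<rho>)" using N assms by (simp add: field_simps)
  also have "\<dots> = 1 / \<rho>" using assms by (simp add: exp_minus inverse_eq_divide)
  finally have rate: "(1 - 1 / \<tau>) ^ N \<le> 1 / \<rho>" .
  have "e (t + i) \<le> (1 - 1 / \<tau>) ^ i * e t" for t i
  proof (induction i)
    case (Suc i)
    have "e (t + Suc i) \<le> (1 - 1 / \<tau>) * e (t + i)" using step[of "t + i"] by simp
    also have "\<dots> \<le> (1 - 1 / \<tau>) * ((1 - 1 / \<tau>) ^ i * e t)"
      using Suc assms by (intro mult_left_mono) auto
    finally show ?case by (simp add: mult_ac)
  qed simp
  then have "e (t + N) \<le> e t / \<rho>" for t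
    using order_trans[OF _ mult_right_mono[OF rate e[of t]]] by simp
  moreover have "real N \<le> (ln \<rho> + 1) * \<tau>" using N assms by (simp add: algebra_simps)
  ultimately show ?thesis by blast
qed

section \<open>The affine system: null space, orthogonality and the minimum norm solution\<close>

text \<open>Here \<open>k\<close> stands for \<open>m - n\<close>, the number of directions, and
  \<open>B\<close> for the inverse of \<open>E\<close>.\<close>

locale split_system =
  fixes n k :: nat and E B F :: "real mat"
  assumes E: "E \<in> carrier_mat n n" and B: "B \<in> carrier_mat n n" and F: "F \<in> carrier_mat n k"
    and EB: "E * B = 1\<^sub>m n" and BE: "B * E = 1\<^sub>m n" and k_pos: "0 < k"
begin

abbreviation "Q \<equiv> directions B F"
abbreviation "A \<equiv> system_matrix E F"

lemma Q_carrier: "Q \<in> carrier_mat (n + k) k"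
  using B F unfolding directions_def by (intro carrier_append_rows) auto

lemma Q_mult_vec: "w \<in> carrier_vec k \<Longrightarrow> Q *\<^sub>v w = (B * F *\<^sub>v w) @\<^sub>v (- w)"
  unfolding directions_def using B F
  by (subst mat_mult_append[of _ n k _ k]) (auto simp: uminus_mult_mat_vec)

lemma col_Q:
  assumes "j < k"
  shows "col Q j = (B *\<^sub>v col F j) @\<^sub>v (- unit_vec k j)"
proof -
  have "col (B * F) j = B *\<^sub>v col F j" using B F assms by (intro eq_vecI) auto
  then show ?thesis
    using Q_mult_vec[of "unit_vec k j"] mult_mat_unit_vec_smult[OF Q_carrier, of j 1]
      mult_mat_unit_vec_smult[of "B * F" n k j 1] B F assms by simp
qed

lemma A_carrier: "A \<in> carrier_mat n (n + k)"
  using E F by (auto simp: system_matrix_def)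

lemma A_mult_vec:
  assumes "u \<in> carrier_vec n" "w \<in> carrier_vec k"
  shows "A *\<^sub>v (u @\<^sub>v w) = E *\<^sub>v u + F *\<^sub>v w"
proof (rule eq_vecI)
  fix i assume "i < dim_vec (E *\<^sub>v u + F *\<^sub>v w)"
  then have i: "i < n" using F by simp
  have "row A i = row E i @\<^sub>v row F i"
    using E F i by (intro eq_vecI) (auto simp: system_matrix_def mat_of_cols_index nth_append)
  then show "(A *\<^sub>v (u @\<^sub>v w)) $ i = (E *\<^sub>v u + F *\<^sub>v w) $ i"
    using A_carrier E F assms i by (simp add: scalar_prod_append[of _ n _ k])
qed (use A_carrier F in auto)

text \<open>Multiplying \<open>E u + F w = 0\<close> by \<open>B\<close> gives
  \<open>u = B F (- w)\<close>. Thus the columns of \<open>Q\<close> span the whole kernel, and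
  orthogonality to them is orthogonality to every kernel vector, as minimality requires.\<close>

lemma kernel_A:
  assumes z: "z \<in> carrier_vec (n + k)" and Az: "A *\<^sub>v z = 0\<^sub>v n"
  shows "\<exists>w\<in>carrier_vec k. z = Q *\<^sub>v w"
proof -
  obtain u w where uw: "u \<in> carrier_vec n" "w \<in> carrier_vec k" "z = u @\<^sub>v w"
    using z vec_first_last_append by (metis vec_first_carrier vec_last_carrier)
  have eq: "E *\<^sub>v u + F *\<^sub>v w = 0\<^sub>v n" using Az A_mult_vec uw by simp
  have "u = B *\<^sub>v (E *\<^sub>v u)"
    using assoc_mult_mat_vec[of B n n E n u] B E BE uw by simp
  also have "E *\<^sub>v u = - (F *\<^sub>v w)"
  proof (rule eq_vecI)
    fix i assume "i < dim_vec (- (F *\<^sub>v w))"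
    then show "(E *\<^sub>v u) $ i = (- (F *\<^sub>v w)) $ i"
      using arg_cong[OF eq, of "\<lambda>v. v $ i"] E F by (simp add: eq_neg_iff_add_eq_0)
  qed (use E F in auto)
  also have "- (F *\<^sub>v w) = F *\<^sub>v (- w)"
    using F uw by (intro eq_vecI) auto
  also have "B *\<^sub>v (F *\<^sub>v (- w)) = B * F *\<^sub>v (- w)"
    using B F uw by (intro assoc_mult_mat_vec[symmetric]) auto
  finally have "z = Q *\<^sub>v (- w)" using uw by (simp add: Q_mult_vec)
  then show ?thesis using uw by (intro bexI[of _ "- w"]) auto
qed

lemma A_mult_start_point:
  assumes "b \<in> carrier_vec n"
  shows "start_point B F b \<in> carrier_vec (n + k)" "A *\<^sub>v start_point B F b = b"
proof -
  have "E *\<^sub>v (B *\<^sub>v b) = b"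
    using assoc_mult_mat_vec[of E n n B n b] B E EB assms by simp
  moreover have F0: "F *\<^sub>v 0\<^sub>v k = 0\<^sub>v n" using F by (intro eq_vecI) auto
  ultimately show "A *\<^sub>v start_point B F b = b"
    using A_mult_vec[of "B *\<^sub>v b" "0\<^sub>v k"] B F assms F0 by (simp add: start_point_def)
qed (use B F assms in \<open>simp add: start_point_def\<close>)

lemma A_mult_Q:
  assumes w: "w \<in> carrier_vec k"
  shows "A *\<^sub>v (Q *\<^sub>v w) = 0\<^sub>v n"
proof -
  have "E *\<^sub>v (B * F *\<^sub>v w) = (E * B) *\<^sub>v (F *\<^sub>v w)"
    using E B F w by (simp add: assoc_mult_mat_vec[of _ n n _ k] assoc_mult_mat_vec[of _ n n _ n])
  also have "\<dots> = F *\<^sub>v w" using F w EB by simp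
  finally have "A *\<^sub>v (Q *\<^sub>v w) = F *\<^sub>v w + F *\<^sub>v (- w)"
    using A_mult_vec[of "B * F *\<^sub>v w" "- w"] B F w by (simp add: Q_mult_vec)
  also have "\<dots> = 0\<^sub>v n" using F w by (intro eq_vecI) auto
  finally show ?thesis .
qed

lemma Q_expands:
  assumes "w \<in> carrier_vec k"
  shows "w \<bullet> w \<le> (Q *\<^sub>v w) \<bullet> (Q *\<^sub>v w)"
proof -
  have "(Q *\<^sub>v w) \<bullet> (Q *\<^sub>v w) = (B * F *\<^sub>v w) \<bullet> (B * F *\<^sub>v w) + w \<bullet> w"
    unfolding Q_mult_vec[OF assms] using B F assms by (subst scalar_prod_append[of _ n _ k]) auto
  then show ?thesis using scalar_prod_self_nonneg[of "B * F *\<^sub>v w"] by simp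
qed

lemma col_Q_norm:
  assumes "j < k"
  shows "col Q j \<bullet> col Q j = (B *\<^sub>v col F j) \<bullet> (B *\<^sub>v col F j) + 1"
  unfolding col_Q[OF assms] using B F assms by (subst scalar_prod_append[of _ n _ k]) auto

lemma total_weight_Q: "total_weight Q = (frob_norm (B * F))\<^sup>2 + real k"
proof -
  have "(frob_norm (B * F))\<^sup>2 = (\<Sum>i<n. \<Sum>j<k. ((B * F) $$ (i, j))\<^sup>2)"
    using B F by (simp add: frob_norm_def sum_nonneg)
  also have "\<dots> = (\<Sum>j<k. \<Sum>i<n. ((B * F) $$ (i, j))\<^sup>2)" by (rule sum.swap)
  also have "\<dots> = (\<Sum>j<k. (B *\<^sub>v col F j) \<bullet> (B *\<^sub>v col F j))"
    using B F by (intro sum.cong refl) (simp add: scalar_prod_def power2_eq_square lessThan_atLeast0)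
  finally show ?thesis
    using Q_carrier by (simp add: total_weight_def col_Q_norm sum.distrib)
qed

lemma total_weight_ge_1: "1 \<le> total_weight Q"
  using k_pos by (simp add: total_weight_Q add_increasing)

text \<open>The minimum norm solution is the component of the start point orthogonal to the range of
  \<open>Q\<close>; the expansion property of \<open>Q\<close> supplies the injectivity that the
  projection needs.\<close>

lemma min_norm_solution_split:
  assumes b: "b \<in> carrier_vec n"
  defines "y \<equiv> min_norm_solution (n + k) A b"
  shows "y \<in> carrier_vec (n + k)" "\<And>j. j < k \<Longrightarrow> y \<bullet> col Q j = 0"
    "\<exists>w\<in>carrier_vec k. start_point B F b = y + Q *\<^sub>v w"
proof -
  let ?x = "start_point B F b"
  have inj: "w = 0\<^sub>v k" if "w \<in> carrier_vec k" "Q *\<^sub>v w = 0\<^sub>v (n + k)" for w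
    using Q_expands[OF that(1)] that scalar_prod_self_nonneg[of w]
    by (intro scalar_prod_self_eq_0) auto
  obtain w where w: "w \<in> carrier_vec k" and orth: "\<And>j. j < k \<Longrightarrow> (?x - Q *\<^sub>v w) \<bullet> col Q j = 0"
    using ex_orthogonal_residual[OF Q_carrier A_mult_start_point(1)[OF b] inj] by blast
  let ?y = "?x - Q *\<^sub>v w"
  have yc: "?y \<in> carrier_vec (n + k)" using A_mult_start_point(1)[OF b] Q_carrier w by simp
  have "A *\<^sub>v ?y = b"
    using A_mult_start_point[OF b] A_carrier Q_carrier w A_mult_Q[OF w] b
    by (subst mult_minus_distrib_mat_vec[of _ n "n + k"]) auto
  moreover have "?y \<bullet> z = 0" if "z \<in> carrier_vec (n + k)" "A *\<^sub>v z = 0\<^sub>v n" for z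
  proof -
    from kernel_A[OF that] obtain v where "v \<in> carrier_vec k" "z = Q *\<^sub>v v" by blast
    then show ?thesis using scalar_prod_mult_mat_vec[OF Q_carrier _ yc, of v] orth by simp
  qed
  ultimately have y: "y = ?y"
    unfolding y_def using yc by (intro arg_min_l2norm_eqI[OF A_carrier]) auto
  show "y \<in> carrier_vec (n + k)" "\<And>j. j < k \<Longrightarrow> y \<bullet> col Q j = 0" using yc orth y by auto
  have "?x = y + Q *\<^sub>v w"
    unfolding y using A_mult_start_point(1)[OF b] Q_carrier w by (intro eq_vecI) auto
  then show "\<exists>w\<in>carrier_vec k. ?x = y + Q *\<^sub>v w" using w by blast
qed

theorem expected_sq_error_rate:
  assumes b: "b \<in> carrier_vec n" and "1 < \<rho>"
  shows "\<exists>N. real N \<le> (ln \<rho> + 1) * ((frob_norm (B * F))\<^sup>2 + real k) \<and>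
    (\<forall>t. expected_sq_error (iterate_law Q (start_point B F b) (t + N)) (min_norm_solution (n + k) A b)
      \<le> expected_sq_error (iterate_law Q (start_point B F b) t) (min_norm_solution (n + k) A b) / \<rho>)"
proof -
  let ?x = "start_point B F b" and ?y = "min_norm_solution (n + k) A b"
  note y = min_norm_solution_split[OF b]
  obtain w where "w \<in> carrier_vec k" "?x = ?y + Q *\<^sub>v w" using y(3) by blast
  then have "expected_sq_error (iterate_law Q ?x (Suc t)) ?y
      \<le> (1 - 1 / total_weight Q) * expected_sq_error (iterate_law Q ?x t) ?y" for t
    using Q_carrier Q_expands y total_weight_ge_1 A_mult_start_point(1)[OF b]
    by (intro expected_sq_error_Suc) (auto simp: col_Q_norm scalar_prod_self_nonneg add_nonneg_pos)
  moreover have "0 \<le> expected_sq_error p ?y" for p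
    by (simp add: expected_sq_error_def)
  ultimately show ?thesis
    using linear_rate[of "\<lambda>t. expected_sq_error (iterate_law Q ?x t) ?y" "total_weight Q" \<rho>]
      total_weight_ge_1 \<open>1 < \<rho>\<close> by (simp add: total_weight_Q)
qed

end

lemma setting_split_system:
  assumes "setting n m r d h f P E B F"
  shows "split_system n (m - n) E B F"
  using assms by unfold_locales (auto simp: setting_def inverts_mat_def)

section \<open>Program logic\<close>

text \<open>
  An instruction does not return the address of the cell that it appends. A program is therefore
  given the length of the memory in which it starts, from which all later addresses follow.
\<close>

type_synonym 'a prog = "nat \<Rightarrow> 'a comp"

definition exec :: "'a prog \<Rightarrow> real list \<Rightarrow> ('a \<times> real list \<times> nat) pmf" where
  "exec p s = run (p (length s)) s"

text \<open>Substitutes \<open>f\<close> at the leaves. The length \<open>n\<close> grows at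
  \<open>Const\<close> and \<open>Arith\<close>, the only instructions that append a cell.\<close>

primrec seq_comp :: "'a comp \<Rightarrow> ('a \<Rightarrow> 'b prog) \<Rightarrow> 'b prog" where
  "seq_comp (Return a) f n = f a n"
| "seq_comp (Const z p) f n = Const z (seq_comp p f (Suc n))"
| "seq_comp (Arith g i j p) f n = Arith g i j (seq_comp p f (Suc n))"
| "seq_comp (If_Le i j p q) f n = If_Le i j (seq_comp p f n) (seq_comp q f n)"
| "seq_comp (Uniform k p) f n = Uniform k (\<lambda>j. seq_comp (p j) f n)"
| "seq_comp (Coin i p q) f n = Coin i (seq_comp p f n) (seq_comp q f n)"

definition ret :: "'a \<Rightarrow> 'a prog" where "ret a n = Return a"
definition seq :: "'a prog \<Rightarrow> ('a \<Rightarrow> 'b prog) \<Rightarrow> 'b prog" where "seq p f n = seq_comp (p n) f n"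
definition const_prog :: "int \<Rightarrow> nat prog" where "const_prog z n = Const z (Return n)"
definition arith_prog :: "arith \<Rightarrow> nat \<Rightarrow> nat \<Rightarrow> nat prog" where "arith_prog g i j n = Arith g i j (Return n)"
definition if_le :: "nat \<Rightarrow> nat \<Rightarrow> 'a prog \<Rightarrow> 'a prog \<Rightarrow> 'a prog" where
  "if_le i j p q n = If_Le i j (p n) (q n)"
definition uniform :: "nat \<Rightarrow> (nat \<Rightarrow> 'a prog) \<Rightarrow> 'a prog" where
  "uniform k p n = Uniform k (\<lambda>j. p j n)"
definition coin :: "nat \<Rightarrow> 'a prog \<Rightarrow> 'a prog \<Rightarrow> 'a prog" where
  "coin i p q n = Coin i (p n) (q n)"

definition add_time :: "nat \<Rightarrow> 'a \<times> real list \<times> nat \<Rightarrow> 'a \<times> real list \<times> nat" where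
  "add_time c = (\<lambda>(a, s, c'). (a, s, c + c'))"

lemma add_time_simps [simp]:
  "add_time c (a, s, c') = (a, s, c + c')"
  "add_time 0 = id" "add_time c \<circ> add_time c' = add_time (c + c')"
  by (auto simp: add_time_def fun_eq_iff)

lemma tick_eq: "tick p = map_pmf (add_time 1) p"
  by (simp add: tick_def add_time_def)

lemma run_seq_comp:
  "run (seq_comp p f (length s)) s
    = bind_pmf (run p s) (\<lambda>(a, s', c). map_pmf (add_time c) (exec (f a) s'))"
proof (induction p arbitrary: s)
  case (Return a)
  then show ?case by (simp add: bind_return_pmf exec_def pmf.map_id)
next
  case (Const z p)
  show ?case using Const[of "s @ [of_int z]"]
    by (simp add: tick_eq map_bind_pmf bind_map_pmf pmf.map_comp case_prod_unfold add_time_def o_def)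
next
  case (Arith g i j p)
  show ?case using Arith[of "s @ [arith_op g (s ! i) (s ! j)]"]
    by (simp add: tick_eq map_bind_pmf bind_map_pmf pmf.map_comp case_prod_unfold add_time_def o_def)
next
  case (If_Le i j p q)
  then show ?case
    by (simp add: tick_eq map_bind_pmf bind_map_pmf pmf.map_comp case_prod_unfold add_time_def o_def)
next
  case (Uniform k p)
  then show ?case
    by (simp add: tick_eq map_bind_pmf bind_map_pmf pmf.map_comp case_prod_unfold add_time_def o_def
        bind_assoc_pmf)
next
  case (Coin i p q)
  then show ?case
    by (auto simp: tick_eq map_bind_pmf bind_map_pmf pmf.map_comp case_prod_unfold add_time_def o_def
        bind_assoc_pmf intro!: bind_pmf_cong)
qed

lemma exec_seq:
  "exec (seq p f) s = bind_pmf (exec p s) (\<lambda>(a, s', c). map_pmf (add_time c) (exec (f a) s'))"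
  by (simp add: exec_def[of "seq p f"] exec_def[of p] seq_def run_seq_comp)

lemma exec_simps:
  "exec (ret a) s = return_pmf (a, s, 0)"
  "exec (const_prog z) s = return_pmf (length s, s @ [of_int z], 1)"
  "exec (arith_prog g i j) s = return_pmf (length s, s @ [arith_op g (s ! i) (s ! j)], 1)"
  "exec (if_le i j p q) s = map_pmf (add_time 1) (if s ! i \<le> s ! j then exec p s else exec q s)"
  "exec (uniform k p') s = map_pmf (add_time 1) (bind_pmf (pmf_of_set {..k}) (\<lambda>j. exec (p' j) s))"
  "exec (coin i p q) s
    = map_pmf (add_time 1) (bind_pmf (bernoulli_pmf (s ! i)) (\<lambda>t. if t then exec p s else exec q s))"
  by (simp_all add: exec_def ret_def const_prog_def arith_prog_def if_le_def uniform_def coin_def tick_eq cong: if_cong)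

section \<open>Deterministic programs\<close>

definition holds :: "real list \<Rightarrow> nat \<Rightarrow> real \<Rightarrow> bool" where
  "holds s a x \<longleftrightarrow> a < length s \<and> s ! a = x"

lemma holds_append: "holds s a x \<Longrightarrow> holds (s @ t) a x"
  by (simp add: holds_def nth_append)

text \<open>For program parts that behave deterministically: the law is a point mass, and the memory
  is only extended, so that addresses obtained earlier keep their contents.\<close>

definition computes :: "'a prog \<Rightarrow> real list \<Rightarrow> nat \<Rightarrow> ('a \<Rightarrow> real list \<Rightarrow> bool) \<Rightarrow> bool" where
  "computes p s \<kappa> \<Phi> \<longleftrightarrow> (\<exists>a t c. exec p s = return_pmf (a, s @ t, c) \<and> c \<le> \<kappa> \<and> \<Phi> a (s @ t))"

lemma computes_ret: "\<Phi> a s \<Longrightarrow> computes (ret a) s \<kappa> \<Phi>"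
  unfolding computes_def exec_simps by (intro exI[of _ "[]"] exI[of _ 0] exI) auto

lemma computes_const: "computes (const_prog z) s 1 (\<lambda>a s'. holds s' a (of_int z))"
  unfolding computes_def exec_simps holds_def
  by (intro exI[of _ "[_]"] exI[of _ 1] exI[of _ "length s"] conjI refl) auto

lemma computes_arith:
  "holds s i x \<Longrightarrow> holds s j y \<Longrightarrow> computes (arith_prog g i j) s 1 (\<lambda>a s'. holds s' a (arith_op g x y))"
  unfolding computes_def exec_simps holds_def
  by (intro exI[of _ "[_]"] exI[of _ 1] exI[of _ "length s"] conjI refl) auto

lemma computes_if_le:
  assumes "holds s i x" "holds s j y"
    and "x \<le> y \<Longrightarrow> computes p s \<kappa> \<Phi>" "y < x \<Longrightarrow> computes q s \<kappa> \<Phi>"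
  shows "computes (if_le i j p q) s (Suc \<kappa>) \<Phi>"
proof -
  have "computes (if s ! i \<le> s ! j then p else q) s \<kappa> \<Phi>"
    using assms by (auto simp: holds_def)
  then obtain a t c where "exec (if s ! i \<le> s ! j then p else q) s = return_pmf (a, s @ t, c)"
    "c \<le> \<kappa>" "\<Phi> a (s @ t)" by (auto simp: computes_def)
  then show ?thesis
    unfolding computes_def exec_simps by (intro exI[of _ a] exI[of _ t] exI[of _ "Suc c"]) (auto split: if_splits)
qed

lemma computes_seq:
  assumes "computes p s \<kappa> \<Phi>" and "\<And>a t. \<Phi> a (s @ t) \<Longrightarrow> computes (f a) (s @ t) \<kappa>' \<Psi>" and "\<kappa> + \<kappa>' \<le> \<kappa>''"
  shows "computes (seq p f) s \<kappa>'' \<Psi>"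
proof -
  obtain a t c where 1: "exec p s = return_pmf (a, s @ t, c)" "c \<le> \<kappa>" "\<Phi> a (s @ t)"
    using assms(1) by (auto simp: computes_def)
  then obtain a' t' c' where 2: "exec (f a) (s @ t) = return_pmf (a', s @ t @ t', c')" "c' \<le> \<kappa>'" "\<Psi> a' (s @ t @ t')"
    using assms(2)[OF 1(3)] by (auto simp: computes_def)
  then show ?thesis
    unfolding computes_def exec_seq 1 using 1 assms(3)
    by (intro exI[of _ a'] exI[of _ "t @ t'"] exI[of _ "c + c'"]) (auto simp: bind_return_pmf)
qed

lemma computes_mono:
  "computes p s \<kappa> \<Phi> \<Longrightarrow> \<kappa> \<le> \<kappa>' \<Longrightarrow> (\<And>a t. \<Phi> a (s @ t) \<Longrightarrow> \<Psi> a (s @ t)) \<Longrightarrow> computes p s \<kappa>' \<Psi>"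
  unfolding computes_def by (meson order_trans)

text \<open>Any order will do; it is fixed while the tree is built and costs no time.\<close>

definition enum_set :: "'a set \<Rightarrow> 'a list" where
  "enum_set A = (SOME xs. set xs = A \<and> distinct xs)"

lemma enum_set:
  assumes "finite A"
  shows "set (enum_set A) = A" "distinct (enum_set A)"
  using someI_ex[OF finite_distinct_list[OF assms]] by (auto simp: enum_set_def)

text \<open>The result is a map from keys to addresses that exists only while the tree is built, so
  looking up an entry is free.\<close>

primrec tabulate_list :: "('k \<Rightarrow> 'b prog) \<Rightarrow> 'k list \<Rightarrow> ('k \<Rightarrow> 'b) prog" where
  "tabulate_list p [] = ret (\<lambda>_. undefined)"
| "tabulate_list p (k # ks) = seq (p k) (\<lambda>a. seq (tabulate_list p ks) (\<lambda>g. ret (g(k := a))))"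

definition tabulate :: "'k set \<Rightarrow> ('k \<Rightarrow> 'b prog) \<Rightarrow> ('k \<Rightarrow> 'b) prog" where
  "tabulate A p = tabulate_list p (enum_set A)"

text \<open>The entries are computed one after the other, so each must be computable in any
  extension \<open>s @ t\<close> of the memory.\<close>

lemma computes_tabulate:
  assumes "finite A"
    and p: "\<And>k t. k \<in> A \<Longrightarrow> computes (p k) (s @ t) (c k) (\<lambda>a s'. holds s' a (x k))"
    and "(\<Sum>k\<in>A. c k) \<le> \<kappa>"
  shows "computes (tabulate A p) s \<kappa> (\<lambda>g s'. \<forall>k\<in>A. holds s' (g k) (x k))"
proof -
  have "computes (tabulate_list p ks) (s @ t) (\<Sum>k\<leftarrow>ks. c k) (\<lambda>g s'. \<forall>k\<in>set ks. holds s' (g k) (x k))"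
    if "set ks \<subseteq> A" for ks t
    using that
  proof (induction ks arbitrary: t)
    case Nil
    then show ?case by (auto intro: computes_ret)
  next
    case (Cons k ks)
    have "computes (p k) (s @ t) (c k) (\<lambda>a s'. holds s' a (x k))" using p Cons by simp
    then show ?case unfolding tabulate_list.simps
    proof (rule computes_seq)
      fix a t' assume a: "holds ((s @ t) @ t') a (x k)"
      have "computes (tabulate_list p ks) (s @ (t @ t')) (\<Sum>k\<leftarrow>ks. c k) (\<lambda>g s'. \<forall>k\<in>set ks. holds s' (g k) (x k))"
        using Cons by auto
      then show "computes (seq (tabulate_list p ks) (\<lambda>g. ret (g(k := a)))) ((s @ t) @ t') (\<Sum>k\<leftarrow>ks. c k)
          (\<lambda>g s'. \<forall>k\<in>set (k # ks). holds s' (g k) (x k))"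
        using holds_append[OF a] by (auto intro!: computes_seq[where \<kappa>' = 0] computes_ret)
    qed simp
  qed
  from this[of "enum_set A" "[]"] show ?thesis
    using enum_set[OF assms(1)] assms(3)
    by (auto simp: tabulate_def sum_list_distinct_conv_sum_set intro: computes_mono)
qed

primrec sumprod_list :: "'k list \<Rightarrow> ('k \<Rightarrow> nat) \<Rightarrow> ('k \<Rightarrow> nat) \<Rightarrow> nat prog" where
  "sumprod_list [] \<alpha> \<beta> = const_prog 0"
| "sumprod_list (k # ks) \<alpha> \<beta> =
     seq (sumprod_list ks \<alpha> \<beta>) (\<lambda>a. seq (arith_prog Times (\<alpha> k) (\<beta> k)) (\<lambda>a'. arith_prog Plus a' a))"

definition sumprod :: "'k set \<Rightarrow> ('k \<Rightarrow> nat) \<Rightarrow> ('k \<Rightarrow> nat) \<Rightarrow> nat prog" where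
  "sumprod A = sumprod_list (enum_set A)"

lemma computes_sumprod:
  assumes "finite A" and "\<And>k. k \<in> A \<Longrightarrow> holds s (\<alpha> k) (x k)" "\<And>k. k \<in> A \<Longrightarrow> holds s (\<beta> k) (y k)"
  shows "computes (sumprod A \<alpha> \<beta>) s (1 + 2 * card A) (\<lambda>a s'. holds s' a (\<Sum>k\<in>A. x k * y k))"
proof -
  have "computes (sumprod_list ks \<alpha> \<beta>) s (1 + 2 * length ks) (\<lambda>a s'. holds s' a (\<Sum>k\<leftarrow>ks. x k * y k))"
    if "set ks \<subseteq> A" for ks
    using that
  proof (induction ks)
    case Nil
    then show ?case using computes_const[of 0] by simp
  next
    case (Cons k ks)
    have "computes (sumprod_list ks \<alpha> \<beta>) s (1 + 2 * length ks) (\<lambda>a s'. holds s' a (\<Sum>k\<leftarrow>ks. x k * y k))"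
      using Cons by simp
    then show ?case unfolding sumprod_list.simps
    proof (rule computes_seq)
      fix a t assume a: "holds (s @ t) a (\<Sum>k\<leftarrow>ks. x k * y k)"
      have "holds (s @ t) (\<alpha> k) (x k)" "holds (s @ t) (\<beta> k) (y k)"
        using Cons assms by (auto intro: holds_append)
      from computes_arith[OF this]
      show "computes (seq (arith_prog Times (\<alpha> k) (\<beta> k)) (\<lambda>a'. arith_prog Plus a' a)) (s @ t) 2
          (\<lambda>a s'. holds s' a (\<Sum>k\<leftarrow>k # ks. x k * y k))"
      proof (rule computes_seq)
        fix a' t' assume "holds ((s @ t) @ t') a' (arith_op Times (x k) (y k))"
        from computes_arith[OF this holds_append[OF a], of Plus]
        show "computes (arith_prog Plus a' a) ((s @ t) @ t') 1 (\<lambda>a s'. holds s' a (\<Sum>k\<leftarrow>k # ks. x k * y k))"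
          by simp
      qed simp
    qed simp
  qed
  from this[of "enum_set A"] show ?thesis
    using enum_set[OF assms(1)]
    by (simp add: sumprod_def sum_list_distinct_conv_sum_set flip: distinct_card)
qed

section \<open>Randomized programs\<close>

definition outvec :: "nat list \<times> real list \<times> nat \<Rightarrow> real Matrix.vec" where
  "outvec = (\<lambda>(cells, s, c). vec_of_list (map (\<lambda>i. s ! i) cells))"

lemma outvec_add_time: "outvec \<circ> add_time c = outvec"
  by (auto simp: outvec_def)

definition spec :: "nat list prog \<Rightarrow> real list \<Rightarrow> nat \<Rightarrow> real Matrix.vec pmf \<Rightarrow> bool" where
  "spec p s \<kappa> L \<longleftrightarrow> map_pmf outvec (exec p s) = L \<and> (\<forall>(a, s', c)\<in>set_pmf (exec p s). c \<le> \<kappa>)"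

text \<open>The law \<open>L\<close> is the same for all outcomes of \<open>p\<close>, so
  \<open>p\<close> may itself be random. This admits a randomized factorization whose outcomes
  differ while the law of the iterate does not.\<close>

lemma spec_seq:
  assumes p: "\<And>a s' c. (a, s', c) \<in> set_pmf (exec p s) \<Longrightarrow> c \<le> \<kappa> \<and> spec (f a) s' \<kappa>' L"
    and le: "\<kappa> + \<kappa>' \<le> \<kappa>''"
  shows "spec (seq p f) s \<kappa>'' L"
proof -
  have "map_pmf outvec (exec (seq p f) s) = bind_pmf (exec p s) (\<lambda>_. L)"
    unfolding exec_seq map_bind_pmf
    by (intro bind_pmf_cong refl) (use p in \<open>auto simp: pmf.map_comp outvec_add_time spec_def\<close>)
  moreover have "\<forall>(a, s', c)\<in>set_pmf (exec (seq p f) s). c \<le> \<kappa>''"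
    unfolding exec_seq using p le by (fastforce simp: spec_def)
  ultimately show ?thesis by (simp add: spec_def)
qed

lemma spec_computes_seq:
  assumes "computes p s \<kappa> \<Phi>" and "\<And>a t. \<Phi> a (s @ t) \<Longrightarrow> spec (f a) (s @ t) \<kappa>' L" and "\<kappa> + \<kappa>' \<le> \<kappa>''"
  shows "spec (seq p f) s \<kappa>'' L"
  using assms by (intro spec_seq[of p s \<kappa>]) (auto simp: computes_def)

lemma spec_ret: "spec (ret cells) s \<kappa> (return_pmf (vec_of_list (map (\<lambda>i. s ! i) cells)))"
  by (simp add: spec_def exec_simps outvec_def)

lemma spec_uniform:
  assumes "\<And>j. j \<le> k \<Longrightarrow> spec (p j) s \<kappa> (L j)"
  shows "spec (uniform k p) s (Suc \<kappa>) (bind_pmf (pmf_of_set {..k}) L)"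
  using assms
  by (fastforce simp: spec_def exec_simps pmf.map_comp outvec_add_time map_bind_pmf intro!: bind_pmf_cong)

lemma spec_coin:
  assumes "holds s i x" "spec p s \<kappa> L" "spec q s \<kappa> L'"
  shows "spec (coin i p q) s (Suc \<kappa>) (bind_pmf (bernoulli_pmf x) (\<lambda>t. if t then L else L'))"
  using assms
  by (fastforce simp: spec_def holds_def exec_simps pmf.map_comp outvec_add_time map_bind_pmf
      intro!: bind_pmf_cong split: if_splits)

lemma spec_mono: "spec p s \<kappa> L \<Longrightarrow> \<kappa> \<le> \<kappa>' \<Longrightarrow> spec p s \<kappa>' L"
  by (fastforce simp: spec_def)

section \<open>Sampling with an alias table\<close>

text \<open>
  Walker's alias method: a law \<open>r / k\<close> on \<open>k\<close> indices is the uniform mixture of \<open>k\<close> laws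
  on at most two indices each, the \<open>j\<close>-th one being supported on \<open>j\<close> and its alias. The table
  pairs an index of weight at most \<open>1\<close> with one of weight above \<open>1\<close>, which passes on the missing
  weight, until one of the two lists is exhausted.
\<close>

function alias_table ::
  "nat \<Rightarrow> (nat \<times> nat) list \<Rightarrow> (nat \<times> nat) list \<Rightarrow> (nat \<Rightarrow> nat \<times> nat) prog" where
  "alias_table c1 [] L = ret (\<lambda>j. (c1, j))"
| "alias_table c1 (x # S) [] = ret (\<lambda>j. (c1, j))"
| "alias_table c1 ((j, a) # S) ((i, b) # L) =
     seq (arith_prog Plus b a) (\<lambda>t. seq (arith_prog Minus t c1) (\<lambda>b'.
       seq (if_le b' c1 (alias_table c1 ((i, b') # S) L) (alias_table c1 S ((i, b') # L)))
         (\<lambda>g. ret (g(j := (a, i))))))"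
  by pat_completeness auto
termination by (relation "Wellfounded.measure (\<lambda>(c1, S, L). length S + length L)") auto

text \<open>Probability that row \<open>j\<close> of the table yields \<open>x\<close>: the coin
  with bias \<open>c j\<close> keeps \<open>j\<close>, otherwise the alias \<open>al j\<close> is
  taken.\<close>

definition alias_weight :: "(nat \<Rightarrow> nat) \<Rightarrow> (nat \<Rightarrow> real) \<Rightarrow> nat \<Rightarrow> nat \<Rightarrow> real" where
  "alias_weight al c x j = (if j = x then c j else 0) + (if al j = x then 1 - c j else 0)"

text \<open>Weights are scaled to have mean 1, so that a uniform choice of a row yields
  \<open>x\<close> with probability \<open>r x / card R\<close>. The cell \<open>fst (g j)\<close>
  holds the bias of the coin.\<close>

definition valid_alias ::
  "nat set \<Rightarrow> (nat \<Rightarrow> real) \<Rightarrow> (nat \<Rightarrow> nat \<times> nat) \<Rightarrow> real list \<Rightarrow> bool" where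
  "valid_alias R r g s \<longleftrightarrow> (\<exists>c.
     (\<forall>j\<in>R. snd (g j) \<in> R \<and> holds s (fst (g j)) (c j) \<and> 0 \<le> c j \<and> c j \<le> 1) \<and>
     (\<forall>x\<in>R. (\<Sum>j\<in>R. alias_weight (snd \<circ> g) c x j) = r x))"

lemma valid_alias_uniform:
  assumes "finite R" "\<And>j. j \<in> R \<Longrightarrow> r j = 1" "holds s c1 1"
  shows "valid_alias R r (\<lambda>j. (c1, j)) s"
  unfolding valid_alias_def using assms
  by (intro exI[of _ "\<lambda>_. 1"]) (auto simp: alias_weight_def o_def)

text \<open>Row \<open>j\<close> gives \<open>r j\<close> to \<open>j\<close> itself and the missing
  \<open>1 - r j\<close> to \<open>i\<close>, so the other rows only owe \<open>i\<close> the weight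
  \<open>r i + r j - 1\<close>. They give nothing to \<open>j\<close>, since they and their aliases
  lie in \<open>R\<close>.\<close>

lemma valid_alias_insert:
  assumes g: "valid_alias R (r(i := r i + r j - 1)) g s"
    and "finite R" "j \<notin> R" "i \<in> R" "holds s a (r j)" "0 \<le> r j" "r j \<le> 1"
  shows "valid_alias (insert j R) r (g(j := (a, i))) s"
proof -
  let ?r = "r(i := r i + r j - 1)" and ?g = "g(j := (a, i))"
  obtain c where c: "\<And>j. j \<in> R \<Longrightarrow> snd (g j) \<in> R \<and> holds s (fst (g j)) (c j) \<and> 0 \<le> c j \<and> c j \<le> 1"
    and sum: "\<And>x. x \<in> R \<Longrightarrow> (\<Sum>j\<in>R. alias_weight (snd \<circ> g) c x j) = ?r x"
    using g unfolding valid_alias_def by blast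
  let ?c = "c(j := r j)"
  have "(\<Sum>j'\<in>insert j R. alias_weight (snd \<circ> ?g) ?c x j') = r x" if x: "x \<in> insert j R" for x
  proof -
    have rest: "(\<Sum>j'\<in>R. alias_weight (snd \<circ> ?g) ?c x j') = (\<Sum>j'\<in>R. alias_weight (snd \<circ> g) c x j')"
      using \<open>j \<notin> R\<close> by (intro sum.cong refl) (auto simp: alias_weight_def)
    have "(\<Sum>j'\<in>R. alias_weight (snd \<circ> g) c x j') = (if x = j then 0 else ?r x)"
    proof (cases "x = j")
      case True
      then have "alias_weight (snd \<circ> g) c x j' = 0" if "j' \<in> R" for j'
        using c[OF that] that \<open>j \<notin> R\<close> by (auto simp: alias_weight_def)
      then show ?thesis using True by simp
    qed (use sum x in auto)
    moreover have "alias_weight (snd \<circ> ?g) ?c x j = (if x = j then r j else 0) + (if x = i then 1 - r j else 0)"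
      by (auto simp: alias_weight_def)
    moreover have "i \<noteq> j" using assms by blast
    ultimately show ?thesis using rest \<open>finite R\<close> \<open>j \<notin> R\<close> by auto
  qed
  then show ?thesis
    unfolding valid_alias_def using c assms by (intro exI[of _ ?c]) auto
qed

text \<open>The total weight stays equal to the number of indices. Once one list is empty, all
  remaining weights lie on the same side of 1, so each equals 1. Every round costs two operations
  and a comparison and settles one index, hence the factor 3.\<close>

lemma computes_alias_table:
  assumes "distinct (map fst (S @ L))"
    and "\<And>i a. (i, a) \<in> set (S @ L) \<Longrightarrow> holds s a (r i)" and "holds s c1 1"
    and "\<And>i a. (i, a) \<in> set S \<Longrightarrow> 0 \<le> r i \<and> r i \<le> 1"
    and "\<And>i a. (i, a) \<in> set L \<Longrightarrow> 1 < r i"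
    and "(\<Sum>i\<in>fst ` set (S @ L). r i) = real (card (fst ` set (S @ L)))"
  shows "computes (alias_table c1 S L) s (3 * length (S @ L)) (valid_alias (fst ` set (S @ L)) r)"
  using assms
proof (induction c1 S L arbitrary: s r rule: alias_table.induct)
  case (1 c1 L)
  let ?R = "fst ` set ([] @ L)"
  have "r j = 1" if "j \<in> ?R" for j
  proof (rule ccontr)
    assume "r j \<noteq> 1"
    then have "(\<Sum>i\<in>?R. 1) < (\<Sum>i\<in>?R. r i)"
      using 1(5) that by (intro sum_strict_mono) auto
    then show False using 1(6) by simp
  qed
  then show ?case using 1(3) by (auto intro!: computes_ret valid_alias_uniform)
next
  case (2 c1 x S)
  let ?R = "fst ` set ((x # S) @ [])"
  have le: "r i \<le> 1" if "i \<in> ?R" for i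
  proof -
    from that obtain y where "y \<in> set (x # S)" "i = fst y" by (metis append_Nil2 imageE)
    then show ?thesis using 2(4)[of "fst y" "snd y"] by simp
  qed
  have "r j = 1" if "j \<in> ?R" for j
  proof (rule ccontr)
    assume "r j \<noteq> 1"
    then have "(\<Sum>i\<in>?R. r i) < (\<Sum>i\<in>?R. 1)"
      using le that by (intro sum_strict_mono_ex1) (auto intro!: bexI[of _ j] simp: less_le)
    then show False using 2(6) by simp
  qed
  then show ?case using 2(3) unfolding alias_table.simps by (intro computes_ret valid_alias_uniform) auto
next
  case (3 c1 j a S i b L)
  let ?R = "fst ` set (((j, a) # S) @ (i, b) # L)" and ?R' = "fst ` set (S @ (i, b) # L)"
  \<comment> \<open>The weights that the remaining rows still have to produce; \<open>i\<close>
    continues with the new cell \<open>b'\<close>, in whichever list its reduced weight belongs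
    to.\<close>
  let ?r = "r(i := r i + r j - 1)"
  have R: "?R = insert j ?R'" "j \<notin> ?R'" "i \<in> ?R'" "finite ?R'" "i \<noteq> j"
    using 3(3) by (auto simp: image_iff)
  have rj: "0 \<le> r j" "r j \<le> 1" "1 < r i" and ha: "holds s a (r j)" and hb: "holds s b (r i)"
    using 3(4)[of j a] 3(4)[of i b] 3(6)[of j a] 3(7)[of i b] by simp_all
  have "(\<Sum>i\<in>?R'. ?r i) = (\<Sum>i\<in>?R'. r i) + (r j - 1)"
    using R sum.remove[of ?R' i r] sum.remove[of ?R' i ?r] by simp
  then have sum: "(\<Sum>i\<in>?R'. ?r i) = real (card ?R')"
    using 3(8) R by simp
  have other: "?r i' = r i'" if "(i', a') \<in> set (S @ L)" for i' a'
    using 3(3) that by (force simp: image_iff)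
  have step: "computes (if_le b' c1 (alias_table c1 ((i, b') # S) L) (alias_table c1 S ((i, b') # L)))
      ((s @ t) @ t') (Suc (3 * length (S @ (i, b) # L))) (valid_alias ?R' ?r)"
    if b': "holds ((s @ t) @ t') b' (?r i)" for b' t t'
  proof -
    let ?s = "(s @ t) @ t'"
    have c1: "holds ?s c1 1" using 3(5) by (simp add: holds_append)
    have SL: "holds ?s a' (?r i')" if "(i', a') \<in> set (S @ L)" for i' a'
      using 3(4)[of i' a'] that other[OF that] by (auto simp: holds_append)
    have SL': "holds ?s a' (?r i')" if "(i', a') = (i, b') \<or> (i', a') \<in> set (S @ L)" for i' a'
      using that
    proof
      assume "(i', a') = (i, b')"
      then show ?thesis using b' by (simp only: prod.inject)
    qed (rule SL)
    have A: "computes (alias_table c1 ((i, b') # S) L) ?s (3 * length (((i, b') # S) @ L))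
        (valid_alias (fst ` set (((i, b') # S) @ L)) ?r)" if "?r i \<le> 1"
    proof (rule 3(1))
      show "holds ?s a' (?r i')" if "(i', a') \<in> set (((i, b') # S) @ L)" for i' a'
        using that by (intro SL') simp
      show "0 \<le> ?r i' \<and> ?r i' \<le> 1" if "(i', a') \<in> set ((i, b') # S)" for i' a'
        using that 3(6)[of i' a'] other[of i' a'] \<open>?r i \<le> 1\<close> rj by auto
      show "1 < ?r i'" if "(i', a') \<in> set L" for i' a'
        using that 3(7)[of i' a'] other[of i' a'] by simp
      show "sum ?r (fst ` set (((i, b') # S) @ L)) = real (card (fst ` set (((i, b') # S) @ L)))"
        using sum by (simp add: image_Un)
    qed (use 3(3) c1 in auto)
    have B: "computes (alias_table c1 S ((i, b') # L)) ?s (3 * length (S @ (i, b') # L))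
        (valid_alias (fst ` set (S @ (i, b') # L)) ?r)" if "1 < ?r i"
    proof (rule 3(2))
      show "holds ?s a' (?r i')" if "(i', a') \<in> set (S @ (i, b') # L)" for i' a'
        using that by (intro SL') auto
      show "0 \<le> ?r i' \<and> ?r i' \<le> 1" if "(i', a') \<in> set S" for i' a'
        using that 3(6)[of i' a'] other[of i' a'] by simp
      show "1 < ?r i'" if "(i', a') \<in> set ((i, b') # L)" for i' a'
        using that 3(7)[of i' a'] other[of i' a'] \<open>1 < ?r i\<close> by auto
      show "sum ?r (fst ` set (S @ (i, b') # L)) = real (card (fst ` set (S @ (i, b') # L)))"
        using sum by simp
    qed (use 3(3) c1 in auto)
    show ?thesis
    proof (rule computes_if_le[OF b' c1])
      show "computes (alias_table c1 ((i, b') # S) L) ?s (3 * length (S @ (i, b) # L)) (valid_alias ?R' ?r)"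
        if "?r i \<le> 1" using A[OF that] by simp
      show "computes (alias_table c1 S ((i, b') # L)) ?s (3 * length (S @ (i, b) # L)) (valid_alias ?R' ?r)"
        if "1 < ?r i" using B[OF that] by simp
    qed
  qed
  show ?case unfolding alias_table.simps
  proof (rule computes_seq[OF computes_arith[OF hb ha]])
    fix x t assume x: "holds (s @ t) x (arith_op Plus (r i) (r j))"
    show "computes (seq (arith_prog Minus x c1) (\<lambda>b'.
        seq (if_le b' c1 (alias_table c1 ((i, b') # S) L) (alias_table c1 S ((i, b') # L)))
          (\<lambda>g. ret (g(j := (a, i)))))) (s @ t) (2 + 3 * length (S @ (i, b) # L))
        (valid_alias ?R r)"
    proof (rule computes_seq[OF computes_arith[OF x holds_append[OF 3(5)]]])
      fix b' t' assume b': "holds ((s @ t) @ t') b' (arith_op Minus (arith_op Plus (r i) (r j)) 1)"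
      show "computes (seq (if_le b' c1 (alias_table c1 ((i, b') # S) L) (alias_table c1 S ((i, b') # L)))
          (\<lambda>g. ret (g(j := (a, i))))) ((s @ t) @ t') (Suc (3 * length (S @ (i, b) # L))) (valid_alias ?R r)"
      proof (rule computes_seq[OF step])
        fix g t'' assume "valid_alias ?R' ?r g (((s @ t) @ t') @ t'')"
        then show "computes (ret (g(j := (a, i)))) (((s @ t) @ t') @ t'') 0 (valid_alias ?R r)"
          unfolding R(1) using R rj ha by (intro computes_ret valid_alias_insert) (auto simp: holds_append)
      qed (use b' in auto)
    qed simp
  qed simp
qed

primrec sort_alias ::
  "nat \<Rightarrow> (nat \<times> nat) list \<Rightarrow> (nat \<times> nat) list \<Rightarrow> (nat \<times> nat) list \<Rightarrow> (nat \<Rightarrow> nat \<times> nat) prog" where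
  "sort_alias c1 [] S L = alias_table c1 S L"
| "sort_alias c1 (x # xs) S L =
     if_le (snd x) c1 (sort_alias c1 xs (x # S) L) (sort_alias c1 xs S (x # L))"

lemma computes_sort_alias:
  assumes "distinct (map fst (xs @ S @ L))"
    and "\<And>i a. (i, a) \<in> set (xs @ S @ L) \<Longrightarrow> holds s a (r i) \<and> 0 \<le> r i" and "holds s c1 1"
    and "\<And>i a. (i, a) \<in> set S \<Longrightarrow> r i \<le> 1"
    and "\<And>i a. (i, a) \<in> set L \<Longrightarrow> 1 < r i"
    and "(\<Sum>i\<in>fst ` set (xs @ S @ L). r i) = real (card (fst ` set (xs @ S @ L)))"
  shows "computes (sort_alias c1 xs S L) s (length xs + 3 * length (xs @ S @ L))
    (valid_alias (fst ` set (xs @ S @ L)) r)"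
  using assms
proof (induction xs arbitrary: S L)
  case Nil
  then show ?case using computes_alias_table[of S L s r c1] by auto
next
  case (Cons x xs)
  obtain i a where x: "x = (i, a)" by fastforce
  have eq: "fst ` set (xs @ (x # S) @ L) = fst ` set ((x # xs) @ S @ L)"
    "fst ` set (xs @ S @ (x # L)) = fst ` set ((x # xs) @ S @ L)" by auto
  have "computes (sort_alias c1 xs (x # S) L) s (length xs + 3 * length (xs @ (x # S) @ L))
      (valid_alias (fst ` set (xs @ (x # S) @ L)) r)" if "r i \<le> 1"
    by (rule Cons(1)) (use Cons(2-7) that x in auto)
  moreover have "computes (sort_alias c1 xs S (x # L)) s (length xs + 3 * length (xs @ S @ (x # L)))
      (valid_alias (fst ` set (xs @ S @ (x # L))) r)" if "1 < r i"
    by (rule Cons(1)) (use Cons(2-7) that x in auto)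
  ultimately show ?case
    unfolding sort_alias.simps using eq Cons(3)[of i a] Cons(4) x
    by (intro computes_mono[OF computes_if_le[of s _ "r i" _ 1]]) auto
qed

text \<open>The bound is \<open>k - 1\<close> because \<open>Uniform\<close> includes its upper
  end.\<close>

definition sample :: "nat \<Rightarrow> (nat \<Rightarrow> nat \<times> nat) \<Rightarrow> (nat \<Rightarrow> nat list prog) \<Rightarrow> nat list prog" where
  "sample k g p = uniform (k - 1) (\<lambda>j. coin (fst (g j)) (p j) (p (snd (g j))))"

lemma spec_sample:
  assumes g: "valid_alias {..<k} r g s" and "0 < k"
    and law: "\<And>x. pmf law x = (if x < k then r x / real k else 0)"
    and p: "\<And>i. i < k \<Longrightarrow> spec (p i) s \<kappa> (L i)"
  shows "spec (sample k g p) s (\<kappa> + 2) (bind_pmf law L)"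
proof -
  obtain c where c: "\<And>j. j < k \<Longrightarrow> snd (g j) < k \<and> holds s (fst (g j)) (c j) \<and> 0 \<le> c j \<and> c j \<le> 1"
    and sum: "\<And>x. x < k \<Longrightarrow> (\<Sum>j<k. alias_weight (snd \<circ> g) c x j) = r x"
    using g unfolding valid_alias_def by auto
  \<comment> \<open>The law of one row of the table; \<open>law\<close> is shown to be the uniform
    mixture of these.\<close>
  let ?two = "\<lambda>j. map_pmf (\<lambda>t. if t then j else snd (g j)) (bernoulli_pmf (c j))"
  have k: "{..k - 1} = {..<k}" using \<open>0 < k\<close> by auto
  have two: "pmf (?two j) x = alias_weight (snd \<circ> g) c x j" if "j < k" for j x
    using c[OF that] unfolding map_pmf_def
    by (simp add: pmf_bind alias_weight_def indicator_def)
  have "law = bind_pmf (pmf_of_set {..k - 1}) ?two"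
  proof (rule pmf_eqI)
    fix x
    have "pmf (bind_pmf (pmf_of_set {..k - 1}) ?two) x = (\<Sum>j<k. alias_weight (snd \<circ> g) c x j) / real k"
      unfolding k using \<open>0 < k\<close> by (subst pmf_bind_pmf_of_set) (auto simp: two)
    also have "\<dots> = (if x < k then r x / real k else 0)"
    proof (cases "x < k")
      case False
      then have "alias_weight (snd \<circ> g) c x j = 0" if "j < k" for j
        using c[OF that] that by (auto simp: alias_weight_def)
      then show ?thesis using False by simp
    qed (simp add: sum)
    finally show "pmf law x = pmf (bind_pmf (pmf_of_set {..k - 1}) ?two) x" by (simp add: law)
  qed
  then have "bind_pmf law L = bind_pmf (pmf_of_set {..k - 1})
      (\<lambda>j. bind_pmf (bernoulli_pmf (c j)) (\<lambda>t. if t then L j else L (snd (g j))))"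
    by (simp add: bind_assoc_pmf bind_map_pmf if_distrib[of L])
  moreover have "spec (uniform (k - 1) (\<lambda>j. coin (fst (g j)) (p j) (p (snd (g j))))) s (Suc (Suc \<kappa>))
      (bind_pmf (pmf_of_set {..k - 1}) (\<lambda>j. bind_pmf (bernoulli_pmf (c j)) (\<lambda>t. if t then L j else L (snd (g j)))))"
  proof (intro spec_uniform spec_coin p)
    fix j assume "j \<le> k - 1"
    then show "j < k" using \<open>0 < k\<close> by simp
    then show "holds s (fst (g j)) (c j)" "snd (g j) < k" using c[of j] by auto
  qed
  ultimately show ?thesis by (simp add: sample_def)
qed

section \<open>The programs\<close>

definition holds_on :: "real list \<Rightarrow> 'k set \<Rightarrow> ('k \<Rightarrow> nat) \<Rightarrow> ('k \<Rightarrow> real) \<Rightarrow> bool" where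
  "holds_on s A g x \<longleftrightarrow> (\<forall>k\<in>A. holds s (g k) (x k))"

lemma holds_onD: "holds_on s A g x \<Longrightarrow> k \<in> A \<Longrightarrow> holds s (g k) (x k)"
  by (simp add: holds_on_def)

lemma holds_on_append: "holds_on s A g x \<Longrightarrow> holds_on (s @ t) A g x"
  by (simp add: holds_on_def holds_append)

lemma computes_tabulate_holds_on:
  assumes "finite A"
    and "\<And>k t. k \<in> A \<Longrightarrow> computes (p k) (s @ t) (c k) (\<lambda>a s'. holds s' a (x k))"
    and "(\<Sum>k\<in>A. c k) \<le> \<kappa>"
  shows "computes (tabulate A p) s \<kappa> (\<lambda>g s'. holds_on s' A g x)"
  unfolding holds_on_def using assms by (rule computes_tabulate)

lemma computes_sumprod_bound:
  assumes "finite A" "\<And>k. k \<in> A \<Longrightarrow> holds s (\<alpha> k) (x k)" "\<And>k. k \<in> A \<Longrightarrow> holds s (\<beta> k) (y k)"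
    and "(\<Sum>k\<in>A. x k * y k) = z" "1 + 2 * card A \<le> \<kappa>"
  shows "computes (sumprod A \<alpha> \<beta>) s \<kappa> (\<lambda>a s'. holds s' a z)"
  using computes_sumprod[of A s \<alpha> x \<beta> y] assms by (simp add: computes_mono)

text \<open>
  The memory layout: \<open>SC\<close>, \<open>SD\<close>, \<open>SF\<close> are the nonzero positions of \<open>C\<close>, \<open>D\<close>, \<open>F\<close>, and
  \<open>\<alpha>C\<close>, \<open>\<alpha>D\<close>, \<open>\<alpha>F\<close>, \<open>\<alpha>b\<close> the addresses of the entries. The programs depend on nothing else.
\<close>

locale sparse_layout =
  fixes n k l :: nat and SC SD SF :: "(nat \<times> nat) set"
    and \<alpha>C \<alpha>D \<alpha>F :: "nat \<times> nat \<Rightarrow> nat" and \<alpha>b :: "nat \<Rightarrow> nat"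
begin

definition colC :: "nat \<Rightarrow> nat set" where "colC a = {i. (i, a) \<in> SC}"
definition FO :: "nat \<Rightarrow> nat set" where "FO a = {b. a \<le> b \<and> b < l \<and> colC a \<inter> colC b \<noteq> {}}"
definition colD :: "nat \<Rightarrow> nat set" where "colD j = {a. (a, j) \<in> SD}"
text \<open>\<open>W j\<close> is the set whose size sparsity bounds. Both column \<open>j\<close>
  of \<open>D\<close> and its product with \<open>T^t\<close> are supported in it, and
  \<open>V i\<close> plays the same role for \<open>v_i\<close>.\<close>

definition W :: "nat \<Rightarrow> nat set" where "W j = (\<Union>a\<in>colD j. FO a)"
definition colF :: "nat \<Rightarrow> nat set" where "colF i = {j. (j, i) \<in> SF}"
definition V :: "nat \<Rightarrow> nat set" where "V i = (\<Union>j\<in>colF i. W j)"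

text \<open>Only integers are built in, so the factor one half for the diagonal is computed as
  \<open>1 / (1 + 1)\<close>.\<close>

definition gram_prog :: "nat \<Rightarrow> (nat \<times> nat \<Rightarrow> nat) prog" where
  "gram_prog c1 = seq (arith_prog Plus c1 c1) (\<lambda>c2. seq (arith_prog Divide c1 c2) (\<lambda>ch.
     tabulate (SIGMA a:{..<l}. FO a) (\<lambda>(a, b).
       seq (sumprod (colC a \<inter> colC b) (\<lambda>i. \<alpha>C (i, a)) (\<lambda>i. \<alpha>C (i, b)))
         (\<lambda>p. arith_prog Times p (if a = b then ch else c1)))))"

definition half_D_prog :: "(nat \<times> nat \<Rightarrow> nat) \<Rightarrow> (nat \<times> nat \<Rightarrow> nat) prog" where
  "half_D_prog T = tabulate (SIGMA j:{..<n}. W j) (\<lambda>(j, b).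
     sumprod {a \<in> colD j. b \<in> FO a} (\<lambda>a. \<alpha>D (a, j)) (\<lambda>a. T (a, b)))"

definition dir_prog :: "(nat \<times> nat \<Rightarrow> nat) prog" where
  "dir_prog = tabulate (SIGMA i:{..<k}. V i) (\<lambda>(i, a).
     sumprod {j \<in> colF i. a \<in> colD j} (\<lambda>j. \<alpha>F (j, i)) (\<lambda>j. \<alpha>D (a, j)))"

definition half_dir_prog :: "(nat \<times> nat \<Rightarrow> nat) \<Rightarrow> (nat \<times> nat \<Rightarrow> nat) prog" where
  "half_dir_prog e = tabulate (SIGMA i:{..<k}. V i) (\<lambda>(i, b).
     sumprod {j \<in> colF i. b \<in> W j} (\<lambda>j. \<alpha>F (j, i)) (\<lambda>j. e (j, b)))"

text \<open>The squared norm of \<open>q_i = (C v_i, -e_i)\<close> is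
  \<open>2 * (T^t v_i) . v_i + 1\<close>, because both triangles of the Gram matrix contribute
  equally.\<close>

definition sq_norm_prog :: "nat \<Rightarrow> (nat \<times> nat \<Rightarrow> nat) \<Rightarrow> (nat \<times> nat \<Rightarrow> nat) \<Rightarrow> (nat \<Rightarrow> nat) prog" where
  "sq_norm_prog c1 v g = tabulate {..<k} (\<lambda>i.
     seq (sumprod (V i) (\<lambda>a. g (i, a)) (\<lambda>a. v (i, a))) (\<lambda>p.
       seq (arith_prog Plus p p) (\<lambda>q. arith_prog Plus q c1)))"

definition start_prog :: "(nat \<Rightarrow> nat) prog" where
  "start_prog = tabulate {..<l} (\<lambda>a. sumprod {j \<in> {..<n}. a \<in> colD j} \<alpha>b (\<lambda>j. \<alpha>D (a, j)))"

definition half_start_prog :: "(nat \<times> nat \<Rightarrow> nat) \<Rightarrow> (nat \<Rightarrow> nat) prog" where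
  "half_start_prog e = tabulate {..<l} (\<lambda>b. sumprod {j \<in> {..<n}. b \<in> W j} \<alpha>b (\<lambda>j. e (j, b)))"

text \<open>Scaling by \<open>k / \<tau>\<close> gives the weights mean 1, the normalization of the
  alias table.\<close>

definition weight_prog :: "nat \<Rightarrow> (nat \<Rightarrow> nat) \<Rightarrow> (nat \<Rightarrow> nat \<times> nat) prog" where
  "weight_prog c1 \<nu> = seq (sumprod {..<k} \<nu> (\<lambda>_. c1)) (\<lambda>\<tau>. seq (const_prog (int k)) (\<lambda>ck.
     seq (arith_prog Divide ck \<tau>) (\<lambda>\<sigma>. seq (tabulate {..<k} (\<lambda>i. arith_prog Times (\<nu> i) \<sigma>))
       (\<lambda>p. sort_alias c1 (map (\<lambda>i. (i, p i)) [0..<k]) [] []))))"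

type_synonym state = "(nat \<Rightarrow> nat) \<times> (nat \<Rightarrow> nat) \<times> (nat \<Rightarrow> nat)"

text \<open>Memory is never overwritten. New cells are made for the indices in \<open>A\<close>
  only, and all other indices keep their old addresses.\<close>

definition update_prog :: "nat set \<Rightarrow> nat \<Rightarrow> (nat \<Rightarrow> nat) \<Rightarrow> (nat \<Rightarrow> nat) \<Rightarrow> (nat \<Rightarrow> nat) prog" where
  "update_prog A c d u = seq (tabulate A (\<lambda>a. seq (arith_prog Times c (d a)) (\<lambda>p. arith_prog Minus (u a) p)))
     (\<lambda>u'. ret (override_on u u' A))"

text \<open>\<open>p + q - w i\<close> is the inner product of the iterate with \<open>q_i\<close>.
  The component \<open>w i\<close> grows by \<open>c\<close> because \<open>q_i\<close> has the
  entry -1 there.\<close>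

definition step_prog :: "(nat \<times> nat \<Rightarrow> nat) \<Rightarrow> (nat \<times> nat \<Rightarrow> nat) \<Rightarrow> (nat \<Rightarrow> nat) \<Rightarrow> state \<Rightarrow> nat \<Rightarrow> state prog" where
  "step_prog v g \<nu> = (\<lambda>(u, y, w) i.
     seq (sumprod (V i) (\<lambda>a. g (i, a)) u) (\<lambda>p. seq (sumprod (V i) (\<lambda>a. v (i, a)) y) (\<lambda>q.
     seq (arith_prog Plus p q) (\<lambda>p'. seq (arith_prog Minus p' (w i)) (\<lambda>q'. seq (arith_prog Divide q' (\<nu> i)) (\<lambda>c.
     seq (update_prog (V i) c (\<lambda>a. v (i, a)) u) (\<lambda>u'. seq (update_prog (V i) c (\<lambda>a. g (i, a)) y) (\<lambda>y'.
     seq (arith_prog Plus (w i) c) (\<lambda>w'. ret (u', y', w(i := w')))))))))))"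

definition output_prog :: "state \<Rightarrow> nat list prog" where
  "output_prog = (\<lambda>(u, y, w).
     seq (tabulate {..<n} (\<lambda>i. sumprod {a \<in> {..<l}. i \<in> colC a} (\<lambda>a. \<alpha>C (i, a)) u))
       (\<lambda>x. ret (map x [0..<n] @ map w [0..<k])))"

text \<open>The remaining loop is a continuation of each single draw, since the addresses in the
  state depend on the index drawn.\<close>

primrec loop_prog ::
  "(state \<Rightarrow> nat \<Rightarrow> state prog) \<Rightarrow> (nat \<Rightarrow> nat \<times> nat) \<Rightarrow> nat \<Rightarrow> state \<Rightarrow> nat list prog" where
  "loop_prog step tbl 0 = output_prog"
| "loop_prog step tbl (Suc N) = (\<lambda>st. sample k tbl (\<lambda>i. seq (step st i) (loop_prog step tbl N)))"

text \<open>Initially all entries of \<open>w\<close> share the one cell \<open>c0\<close> that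
  holds 0.\<close>

definition kaczmarz_prog :: "nat \<Rightarrow> nat list prog" where
  "kaczmarz_prog N = seq (const_prog 1) (\<lambda>c1. seq (const_prog 0) (\<lambda>c0.
     seq (gram_prog c1) (\<lambda>T. seq (half_D_prog T) (\<lambda>e. seq dir_prog (\<lambda>v. seq (half_dir_prog e) (\<lambda>g.
     seq (sq_norm_prog c1 v g) (\<lambda>\<nu>. seq start_prog (\<lambda>u. seq (half_start_prog e) (\<lambda>y.
     seq (weight_prog c1 \<nu>) (\<lambda>tbl. loop_prog (step_prog v g \<nu>) tbl N (u, y, \<lambda>_. c0)))))))))))"

end

section \<open>Correctness and running time\<close>

lemma sum_card_swap:
  assumes "finite X" "finite Y"
  shows "(\<Sum>x\<in>X. card {y \<in> Y. R x y}) = (\<Sum>y\<in>Y. card {x \<in> X. R x y})"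
  using sum.swap_restrict[OF assms, of "\<lambda>_ _. 1 :: nat" R] by simp

text \<open>The left side is the time as the stages of \<open>kaczmarz_prog\<close> accumulate it.
  Everything independent of \<open>N\<close> is dominated by \<open>n * X\<close> or
  \<open>k * X\<close>, with coefficients 23 and 18 that are both rounded up to 50; the loop needs
  \<open>8 + 8 * (f * \<kappa>) <= 16 * (f * \<kappa>)\<close>.\<close>

lemma kaczmarz_cost:
  fixes N n k f \<kappa> :: nat
  assumes "0 < n" "0 < f" "0 < \<kappa>"
  shows "1 + (1 + (2 + 4 * n * \<kappa>\<^sup>2 + (n * \<kappa> * (1 + 2 * \<kappa>) + (k * (f * \<kappa>) * (1 + 2 * f) + (k * (f * \<kappa>) * (1 + 2 * f) +
      (k * (3 + 2 * (f * \<kappa>)) + (3 * n * \<kappa> + (3 * n * \<kappa> + (3 + 7 * k + (N * (8 + 8 * (f * \<kappa>)) + n * (1 + 2 * \<kappa>)))))))))))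
    \<le> N * (16 * (f * \<kappa>)) + 50 * ((n + k) * f\<^sup>2 * \<kappa>\<^sup>2)" (is "?lhs \<le> _")
proof -
  define X where "X = f\<^sup>2 * \<kappa>\<^sup>2"
  have fk: "1 \<le> f" "1 \<le> \<kappa>" using assms by auto
  have f2: "f \<le> f\<^sup>2" and k2: "\<kappa> \<le> \<kappa>\<^sup>2" using fk by (simp_all add: power2_eq_square)
  have k2X: "\<kappa>\<^sup>2 \<le> X" using fk by (simp add: X_def)
  have f2kX: "f\<^sup>2 * \<kappa> \<le> X" using k2 by (simp add: X_def)
  have fkX: "f * \<kappa> \<le> X" using f2 k2 unfolding X_def by (rule mult_mono) auto
  have kX: "\<kappa> \<le> X" using k2 k2X by (rule order_trans)
  have X: "1 \<le> X" using fk(2) kX by (rule order_trans)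
  have n: "n * 1 \<le> n * X" "n * \<kappa> \<le> n * X" "n * \<kappa>\<^sup>2 \<le> n * X"
    using X kX k2X by (intro mult_le_mono order_refl; simp)+
  have k: "k * 1 \<le> k * X" "k * (f * \<kappa>) \<le> k * X" "k * (f\<^sup>2 * \<kappa>) \<le> k * X"
    using X fkX f2kX by (intro mult_le_mono order_refl; simp)+
  have nX: "1 \<le> n * X" using mult_le_mono[of 1 n 1 X] assms X by simp
  have N: "N * 1 \<le> N * (f * \<kappa>)" using assms by simp
  have "?lhs = 7 + 8 * (N * 1) + 8 * (N * (f * \<kappa>)) + n * 1 + 9 * (n * \<kappa>) + 6 * (n * \<kappa>\<^sup>2)
      + 10 * (k * 1) + 4 * (k * (f * \<kappa>)) + 4 * (k * (f\<^sup>2 * \<kappa>))"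
    by (simp add: power2_eq_square algebra_simps)
  also have "\<dots> \<le> 16 * (N * (f * \<kappa>)) + 23 * (n * X) + 18 * (k * X)"
    using n k nX N by linarith
  also have "\<dots> \<le> 16 * (N * (f * \<kappa>)) + 50 * (n * X) + 50 * (k * X)" by simp
  also have "\<dots> = N * (16 * (f * \<kappa>)) + 50 * ((n + k) * f\<^sup>2 * \<kappa>\<^sup>2)"
    by (simp add: X_def algebra_simps)
  finally show ?thesis .
qed

locale sparse_data =
  split_system n k E B F + sparse_layout n k l SC SD SF \<alpha>C \<alpha>D \<alpha>F \<alpha>b
  for n k E B F l SC SD SF \<alpha>C \<alpha>D \<alpha>F \<alpha>b +
  fixes C D :: "real mat" and b :: "real Matrix.vec" and \<kappa> f :: nat
  assumes C: "C \<in> carrier_mat n l" and D: "D \<in> carrier_mat l n"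
    and factorization: "sparse_factorization \<kappa> B C D"
    and SC: "SC = mat_support C" and SD: "SD = mat_support D" and SF: "SF = mat_support F"
    and F_sparse: "column_sparse f F" and b: "b \<in> carrier_vec n"
    and n_pos: "0 < n" and f_pos: "0 < f"
begin

lemma factorizationD:
  shows "B = C * D" "\<And>a. a < l \<Longrightarrow> col C a \<noteq> 0\<^sub>v n" "\<And>a. a < l \<Longrightarrow> row D a \<noteq> 0\<^sub>v n"
    "\<And>j. j < n \<Longrightarrow> card (\<Union>a\<in>col_support D j. forward_overlap C a) \<le> \<kappa>"
proof -
  note dims = carrier_matD[OF C] carrier_matD[OF D]
  have *: "B = C * D \<and> (\<forall>a<l. col C a \<noteq> 0\<^sub>v n) \<and> (\<forall>a<l. row D a \<noteq> 0\<^sub>v n) \<and>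
      (\<forall>j<n. card (\<Union>a\<in>col_support D j. forward_overlap C a) \<le> \<kappa>)"
    using factorization unfolding sparse_factorization_def dims by (elim conjE, intro conjI)
  show "B = C * D" using * by (rule conjunct1)
  note * = *[THEN conjunct2]
  show "col C a \<noteq> 0\<^sub>v n" "row D a \<noteq> 0\<^sub>v n" if "a < l" for a using * that by simp_all
  show "card (\<Union>a\<in>col_support D j. forward_overlap C a) \<le> \<kappa>" if "j < n" for j using * that by simp
qed

lemma mem_colC: "i \<in> colC a \<longleftrightarrow> i < n \<and> a < l \<and> C $$ (i, a) \<noteq> 0"
  unfolding colC_def unfolding SC mat_support_def using C by auto

lemma mem_colD: "a \<in> colD j \<longleftrightarrow> a < l \<and> j < n \<and> D $$ (a, j) \<noteq> 0"
  unfolding colD_def unfolding SD mat_support_def using D by auto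

lemma mem_colF: "j \<in> colF i \<longleftrightarrow> j < n \<and> i < k \<and> F $$ (j, i) \<noteq> 0"
  unfolding colF_def unfolding SF mat_support_def using F by auto

lemma finite_supports [simp]: "finite (colC a)" "finite (FO a)" "finite (colD j)" "finite (W j)"
  "finite (colF i)" "finite (V i)"
proof -
  show FO: "finite (FO a)" for a by (simp add: FO_def)
  show "finite (colC a)" by (rule finite_subset[of _ "{..<n}"]) (auto simp: mem_colC)
  show colF: "finite (colF i)" by (rule finite_subset[of _ "{..<n}"]) (auto simp: mem_colF)
  show "finite (colD j)" for j by (rule finite_subset[of _ "{..<l}"]) (auto simp: mem_colD)
  then show "finite (W j)" for j using FO by (simp add: W_def)
  then show "finite (V i)" using colF by (simp add: V_def)
qed

lemma FO_subset: "FO a \<subseteq> {..<l}" by (auto simp: FO_def)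
lemma W_subset: "W j \<subseteq> {..<l}" using FO_subset by (auto simp: W_def)
lemma V_subset: "V i \<subseteq> {..<l}" using W_subset by (auto simp: V_def)

lemma FO_refl: "a < l \<Longrightarrow> a \<in> FO a"
proof -
  assume a: "a < l"
  then have "col C a \<noteq> 0\<^sub>v n" by (rule factorizationD)
  then obtain i where "i < n" "col C a $ i \<noteq> 0" using C a by (metis eq_vecI carrier_matD(1) dim_col index_zero_vec)
  then have "i \<in> colC a" using a C by (simp add: mem_colC)
  then show ?thesis using a by (auto simp: FO_def)
qed

lemma colD_subset_W: "colD j \<subseteq> W j"
  using FO_refl by (auto simp: W_def mem_colD)

lemma row_D_nonzero: "a < l \<Longrightarrow> \<exists>j<n. a \<in> colD j"
proof -
  assume a: "a < l"
  then have "row D a \<noteq> 0\<^sub>v n" by (rule factorizationD)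
  then obtain j where "j < n" "row D a $ j \<noteq> 0" using D a by (metis eq_vecI carrier_matD(2) index_row(2) index_zero_vec)
  then show ?thesis using a D by (auto simp: mem_colD)
qed

lemma card_W: "card (W j) \<le> \<kappa>"
proof (cases "j < n")
  case True
  have "colD j = col_support D j" using D True by (auto simp: mem_colD col_support_def)
  moreover have "FO a = forward_overlap C a" if "a \<in> colD j" for a
    using C that by (auto simp: FO_def forward_overlap_def col_support_def mem_colC mem_colD)
  ultimately have "W j = (\<Union>a\<in>col_support D j. forward_overlap C a)" by (simp add: W_def)
  then show ?thesis using factorizationD(4)[OF True] by simp
next
  case False
  then have "colD j = {}" by (auto simp: mem_colD)
  then show ?thesis by (simp add: W_def)
qed

lemma card_colD: "card (colD j) \<le> \<kappa>"
  using card_mono[OF _ colD_subset_W, of j] card_W[of j] by simp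

lemma card_colF: "card (colF i) \<le> f"
proof (cases "i < k")
  case True
  then have "colF i = col_support F i" using F by (auto simp: mem_colF col_support_def)
  then show ?thesis using F_sparse True F by (simp add: column_sparse_def)
next
  case False
  then have "colF i = {}" by (auto simp: mem_colF)
  then show ?thesis by simp
qed

lemma card_V: "card (V i) \<le> f * \<kappa>"
proof -
  have "card (V i) \<le> (\<Sum>j\<in>colF i. card (W j))" unfolding V_def by (rule card_UN_le) simp
  also have "\<dots> \<le> card (colF i) * \<kappa>" using sum_bounded_above[of "colF i" "\<lambda>j. card (W j)" \<kappa>] card_W by simp
  also have "\<dots> \<le> f * \<kappa>" using card_colF by simp
  finally show ?thesis .
qed

text \<open>All columns of \<open>C\<close> through row \<open>i\<close> lie in the forward overlap of the first one.\<close>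

lemma card_row_C: "card {a \<in> {..<l}. i \<in> colC a} \<le> \<kappa>"
proof (cases "{a \<in> {..<l}. i \<in> colC a} = {}")
  case False
  let ?R = "{a \<in> {..<l}. i \<in> colC a}"
  define a where "a = Min ?R"
  have a: "a \<in> ?R" unfolding a_def using False by (intro Min_in) auto
  have "?R \<subseteq> FO a" using a unfolding FO_def a_def by (auto intro!: Min_le)
  \<comment> \<open>Row \<open>a\<close> of \<open>D\<close> is nonzero, so some \<open>W j\<close>
    contains the whole forward overlap of \<open>a\<close>.\<close>
  moreover obtain j where "a \<in> colD j" using row_D_nonzero[of a] a by auto
  ultimately have "?R \<subseteq> W j" by (auto simp: W_def)
  then show ?thesis using card_mono[of "W j" ?R] card_W[of j] by simp
qed (simp only: card.empty)

text \<open>Without columns in \<open>C\<close> the product \<open>B = C * D\<close> would be zero,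
  which contradicts \<open>B * E = 1\<^sub>m n\<close>. A nonzero row of \<open>D\<close> then makes
  some \<open>W j\<close> nonempty.\<close>

lemma \<kappa>_pos: "0 < \<kappa>"
proof -
  have "0 < l"
  proof (rule ccontr)
    assume "\<not> 0 < l"
    then have "B $$ (0, j) = 0" if "j < n" for j
      unfolding factorizationD(1) using C D n_pos that by (simp add: scalar_prod_def)
    then have "(B * E) $$ (0, 0) = 0" using B E n_pos by (simp add: scalar_prod_def)
    then show False using BE n_pos by simp
  qed
  then obtain j where "0 \<in> colD j" using row_D_nonzero by blast
  then have "W j \<noteq> {}" using colD_subset_W by auto
  then have "0 < card (W j)" by (simp add: card_gt_0_iff)
  then show ?thesis using card_W[of j] by simp
qed

text \<open>Counts the nonzero entries of \<open>D\<close>: every row has at least one, every column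
  at most \<open>\<kappa>\<close>.\<close>

lemma l_le: "l \<le> n * \<kappa>"
proof -
  have "l = (\<Sum>a<l. 1)" by simp
  also have "\<dots> \<le> (\<Sum>a<l. card {j \<in> {..<n}. a \<in> colD j})"
    using row_D_nonzero by (intro sum_mono) (auto simp: Suc_le_eq card_gt_0_iff)
  also have "\<dots> = (\<Sum>j<n. card {a \<in> {..<l}. a \<in> colD j})" by (rule sum_card_swap) auto
  also have "\<dots> \<le> (\<Sum>j<n. \<kappa>)"
  proof (rule sum_mono)
    fix j
    have "{a \<in> {..<l}. a \<in> colD j} = colD j" by (auto simp: mem_colD)
    then show "card {a \<in> {..<l}. a \<in> colD j} \<le> \<kappa>" using card_colD by simp
  qed
  finally show ?thesis by simp
qed

section \<open>Inner products through one triangle of the Gram matrix\<close>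

definition G :: "nat \<Rightarrow> nat \<Rightarrow> real" where "G a a' = (\<Sum>i<n. C $$ (i, a) * C $$ (i, a'))"

text \<open>
  \<open>T\<close> is the upper triangle of the Gram matrix \<open>G\<close> with its diagonal halved, so that
  \<open>G\<close> is the sum of \<open>T\<close> and its transpose. For \<open>T\<close> only forward overlaps matter.
\<close>

definition T :: "nat \<Rightarrow> nat \<Rightarrow> real" where
  "T a a' = (if a < a' then G a a' else if a = a' then G a a / 2 else 0)"

text \<open>Multiplication by the transpose of \<open>T\<close>. It moves weight only forwards, from
  \<open>a\<close> to the columns in \<open>FO a\<close>.\<close>

definition half :: "(nat \<Rightarrow> real) \<Rightarrow> nat \<Rightarrow> real" where "half x a' = (\<Sum>a<l. T a a' * x a)"

definition lift :: "(nat \<Rightarrow> real) \<Rightarrow> nat \<Rightarrow> real" where "lift x i = (\<Sum>a<l. C $$ (i, a) * x a)"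

lemma G_eq: "a < l \<Longrightarrow> a' < l \<Longrightarrow> G a a' = (\<Sum>i\<in>colC a \<inter> colC a'. C $$ (i, a) * C $$ (i, a'))"
  unfolding G_def by (intro sum.mono_neutral_right) (auto simp: mem_colC)

text \<open>Outside \<open>FO a\<close> the index either precedes \<open>a\<close>, where the
  triangle is empty, or its column has support disjoint from that of column
  \<open>a\<close>.\<close>

lemma T_eq_0: "a < l \<Longrightarrow> a' < l \<Longrightarrow> a' \<notin> FO a \<Longrightarrow> T a a' = 0"
  by (cases "a \<le> a'") (auto simp: FO_def T_def G_eq)

lemma G_eq_T: "G a a' = T a a' + T a' a"
  by (auto simp: T_def G_def mult.commute)

text \<open>In matrix notation, \<open>(C x) . (C z) = x^t (T + T^t) z\<close>. Each of the two
  vectors passes through \<open>half\<close> once, which is why both \<open>g i\<close> and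
  \<open>half u\<close> occur in a step.\<close>

lemma lift_inner: "(\<Sum>i<n. lift x i * lift z i) = (\<Sum>b<l. half x b * z b) + (\<Sum>b<l. x b * half z b)"
proof -
  have "(\<Sum>i<n. lift x i * lift z i) = (\<Sum>i<n. \<Sum>a<l. \<Sum>b<l. (C $$ (i, a) * x a) * (C $$ (i, b) * z b))"
    by (simp add: lift_def sum_product)
  also have "\<dots> = (\<Sum>a<l. \<Sum>b<l. \<Sum>i<n. (C $$ (i, a) * x a) * (C $$ (i, b) * z b))"
    by (subst sum.swap) (intro sum.cong refl sum.swap)
  also have "\<dots> = (\<Sum>a<l. \<Sum>b<l. G a b * (x a * z b))"
    by (simp add: G_def sum_distrib_left mult_ac)
  also have "\<dots> = (\<Sum>a<l. \<Sum>b<l. T a b * x a * z b) + (\<Sum>a<l. \<Sum>b<l. x a * (T b a * z b))"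
    by (simp add: G_eq_T[of _ _] algebra_simps sum.distrib)
  also have "(\<Sum>a<l. \<Sum>b<l. T a b * x a * z b) = (\<Sum>b<l. half x b * z b)"
    by (subst sum.swap) (simp add: half_def sum_distrib_right)
  also have "(\<Sum>a<l. \<Sum>b<l. x a * (T b a * z b)) = (\<Sum>b<l. x b * half z b)"
    by (simp add: half_def sum_distrib_left)
  finally show ?thesis .
qed

text \<open>\<open>v i\<close> is \<open>D f_i\<close> for the column \<open>f_i\<close> of
  \<open>F\<close>; \<open>eD j\<close> and \<open>g i\<close> are the products of
  \<open>T^t\<close> with column \<open>j\<close> of \<open>D\<close> and with \<open>v i\<close>;
  \<open>u\<^sub>0\<close> is \<open>D b\<close>.\<close>

definition v :: "nat \<Rightarrow> nat \<Rightarrow> real" where "v i a = (\<Sum>j<n. F $$ (j, i) * D $$ (a, j))"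
definition eD :: "nat \<Rightarrow> nat \<Rightarrow> real" where "eD j = half (\<lambda>a. D $$ (a, j))"
definition g :: "nat \<Rightarrow> nat \<Rightarrow> real" where "g i = half (v i)"
definition \<nu> :: "nat \<Rightarrow> real" where "\<nu> i = col Q i \<bullet> col Q i"
definition u\<^sub>0 :: "nat \<Rightarrow> real" where "u\<^sub>0 a = (\<Sum>j<n. b $ j * D $$ (a, j))"

lemma half_linear: "half (\<lambda>a. \<Sum>j\<in>J. c j * x j a) a' = (\<Sum>j\<in>J. c j * half (x j) a')"
proof -
  have "half (\<lambda>a. \<Sum>j\<in>J. c j * x j a) a' = (\<Sum>a<l. \<Sum>j\<in>J. c j * (T a a' * x j a))"
    by (simp add: half_def sum_distrib_left mult_ac)
  also have "\<dots> = (\<Sum>j\<in>J. c j * half (x j) a')"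
    by (subst sum.swap) (simp add: half_def sum_distrib_left)
  finally show ?thesis .
qed

lemma half_diff: "half (\<lambda>a. x a - c * z a) a' = half x a' - c * half z a'"
  by (simp add: half_def right_diff_distrib sum_subtractf sum_distrib_left mult_ac)

lemma lift_diff: "lift (\<lambda>a. x a - c * z a) i = lift x i - c * lift z i"
  by (simp add: lift_def right_diff_distrib sum_subtractf sum_distrib_left mult_ac)

lemma eD_eq: "j < n \<Longrightarrow> a' < l \<Longrightarrow> eD j a' = (\<Sum>a\<in>{a \<in> colD j. a' \<in> FO a}. D $$ (a, j) * T a a')"
  unfolding eD_def half_def
  by (rule sum.mono_neutral_cong_right) (use T_eq_0 in \<open>auto simp: mem_colD\<close>)

lemma eD_eq_0: "j < n \<Longrightarrow> a < l \<Longrightarrow> a \<notin> W j \<Longrightarrow> eD j a = 0"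
  by (subst eD_eq) (auto simp: W_def intro!: sum.neutral)

lemma v_eq: "i < k \<Longrightarrow> a < l \<Longrightarrow> v i a = (\<Sum>j\<in>{j \<in> colF i. a \<in> colD j}. F $$ (j, i) * D $$ (a, j))"
  unfolding v_def by (rule sum.mono_neutral_cong_right) (auto simp: mem_colD mem_colF)

lemma v_eq_0: "i < k \<Longrightarrow> a < l \<Longrightarrow> a \<notin> V i \<Longrightarrow> v i a = 0"
  using colD_subset_W by (subst v_eq) (auto simp: V_def intro!: sum.neutral)

lemma g_eq_sum: "g i a = (\<Sum>j<n. F $$ (j, i) * eD j a)"
  by (simp add: g_def v_def[abs_def] half_linear eD_def)

lemma g_eq: "i < k \<Longrightarrow> a < l \<Longrightarrow> g i a = (\<Sum>j\<in>{j \<in> colF i. a \<in> W j}. F $$ (j, i) * eD j a)"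
  unfolding g_eq_sum by (rule sum.mono_neutral_cong_right) (use eD_eq_0 in \<open>auto simp: mem_colF\<close>)

lemma g_eq_0: "i < k \<Longrightarrow> a < l \<Longrightarrow> a \<notin> V i \<Longrightarrow> g i a = 0"
  by (subst g_eq) (auto simp: V_def intro!: sum.neutral)

lemma sum_V: "i < k \<Longrightarrow> (\<Sum>a\<in>V i. g i a * x a) = (\<Sum>a<l. g i a * x a)"
  "i < k \<Longrightarrow> (\<Sum>a\<in>V i. v i a * x a) = (\<Sum>a<l. v i a * x a)"
  using V_subset g_eq_0 v_eq_0 by (auto intro!: sum.mono_neutral_left)

lemma B_mult_vec:
  assumes "x \<in> carrier_vec n"
  shows "B *\<^sub>v x = Matrix.vec n (lift (\<lambda>a. \<Sum>j<n. x $ j * D $$ (a, j)))"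
proof (rule eq_vecI)
  fix i assume "i < dim_vec (Matrix.vec n (lift (\<lambda>a. \<Sum>j<n. x $ j * D $$ (a, j))))"
  then have i: "i < n" by simp
  have "B *\<^sub>v x = C *\<^sub>v (D *\<^sub>v x)"
    unfolding factorizationD(1) using C D assms by (intro assoc_mult_mat_vec) auto
  then show "(B *\<^sub>v x) $ i = Matrix.vec n (lift (\<lambda>a. \<Sum>j<n. x $ j * D $$ (a, j))) $ i"
    using C D assms i by (simp add: scalar_prod_def lift_def lessThan_atLeast0 mult.commute)
qed (use B in simp)

text \<open>The vector \<open>(C u, w)\<close>, the form in which all iterates and directions are
  kept.\<close>

definition unlift :: "(nat \<Rightarrow> real) \<Rightarrow> (nat \<Rightarrow> real) \<Rightarrow> real Matrix.vec" where
  "unlift u w = Matrix.vec n (lift u) @\<^sub>v Matrix.vec k w"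

lemma unlift_inner:
  "unlift u w \<bullet> unlift u' w' = (\<Sum>b<l. half u b * u' b) + (\<Sum>b<l. u b * half u' b) + (\<Sum>j<k. w j * w' j)"
proof -
  have "unlift u w \<bullet> unlift u' w' = (\<Sum>i<n. lift u i * lift u' i) + (\<Sum>j<k. w j * w' j)"
    unfolding unlift_def by (subst scalar_prod_append[of _ n _ k]) (auto simp: scalar_prod_def lessThan_atLeast0)
  then show ?thesis by (simp add: lift_inner)
qed

lemma col_Q_unlift: "i < k \<Longrightarrow> col Q i = unlift (v i) (\<lambda>j. if j = i then - 1 else 0)"
  unfolding unlift_def col_Q using F
  by (subst B_mult_vec) (auto simp: v_def[abs_def] unit_vec_def intro!: eq_vecI)

lemma start_point_unlift: "start_point B F b = unlift u\<^sub>0 (\<lambda>_. 0)"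
  unfolding start_point_def unlift_def B_mult_vec[OF b] using F
  by (auto simp: u\<^sub>0_def[abs_def] intro!: eq_vecI)

lemma half_u\<^sub>0: "half u\<^sub>0 a = (\<Sum>j<n. b $ j * eD j a)"
  by (simp add: u\<^sub>0_def[abs_def] half_linear eD_def)

text \<open>\<open>g i\<close> and \<open>v i\<close> vanish outside \<open>V i\<close>, so both
  sums are short although \<open>u\<close> and \<open>half u\<close> may be dense.\<close>

lemma inner_col_Q:
  assumes "i < k"
  shows "unlift u w \<bullet> col Q i = (\<Sum>a\<in>V i. g i a * u a) + (\<Sum>a\<in>V i. v i a * half u a) - w i"
proof -
  have "(\<Sum>j<k. w j * (if j = i then - 1 else 0)) = - w i"
    using assms by (subst sum.remove[of _ i]) (auto intro!: sum.neutral)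
  then show ?thesis
    unfolding sum_V[OF assms] using assms
    by (simp add: col_Q_unlift unlift_inner g_def[symmetric]) (simp add: mult.commute)
qed

text \<open>The case \<open>u = v i\<close> of the formula for the inner product, where the last
  term is \<open>- (- 1)\<close>.\<close>

lemma \<nu>_eq:
  assumes "i < k"
  shows "\<nu> i = (\<Sum>a\<in>V i. g i a * v i a) + (\<Sum>a\<in>V i. g i a * v i a) + 1"
  using inner_col_Q[OF assms, of "v i" "\<lambda>j. if j = i then - 1 else 0"] col_Q_unlift[OF assms]
  by (simp add: \<nu>_def g_def[symmetric] mult.commute)

lemma \<nu>_ge_1: "i < k \<Longrightarrow> 1 \<le> \<nu> i"
  by (simp add: \<nu>_def col_Q_norm scalar_prod_self_nonneg)

lemma iteration_step_unlift:
  assumes "i < k" and c: "c = ((\<Sum>a\<in>V i. g i a * u a) + (\<Sum>a\<in>V i. v i a * half u a) - w i) / \<nu> i"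
  shows "iteration_step (col Q i) (unlift u w)
    = unlift (\<lambda>a. u a - c * v i a) (w(i := w i + c))"
proof -
  have "iteration_step (col Q i) (unlift u w) = unlift u w - c \<cdot>\<^sub>v unlift (v i) (\<lambda>j. if j = i then - 1 else 0)"
    using assms by (simp add: iteration_step_def inner_col_Q \<nu>_def col_Q_unlift[symmetric])
  also have "\<dots> = unlift (\<lambda>a. u a - c * v i a) (w(i := w i + c))"
    unfolding unlift_def by (intro eq_vecI) (auto simp: lift_diff)
  finally show ?thesis .
qed

section \<open>The precomputed tables\<close>

lemma sigma_sum_const:
  assumes "\<And>j. j < p \<Longrightarrow> card (S j) \<le> q" "\<And>j. finite (S j)"
  shows "(\<Sum>x\<in>(SIGMA j:{..<p}. S j). c) \<le> p * q * (c :: nat)"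
proof -
  have "(\<Sum>x\<in>(SIGMA j:{..<p}. S j). c) = (\<Sum>j<p. card (S j)) * c"
    using assms by (simp add: card_SigmaI)
  also have "\<dots> \<le> (\<Sum>j<p. q) * c" using assms by (intro mult_right_mono sum_mono) auto
  finally show ?thesis by simp
qed

lemma computes_gram_prog:
  assumes mC: "holds_on s SC \<alpha>C (\<lambda>x. C $$ x)" and c1: "holds s c1 1"
  shows "computes (gram_prog c1) s (2 + 4 * n * \<kappa>\<^sup>2)
    (\<lambda>t s'. holds_on s' (SIGMA a:{..<l}. FO a) t (\<lambda>(a, a'). T a a'))"
  unfolding gram_prog_def
proof (rule computes_seq[OF computes_arith[OF c1 c1]])
  fix c2 t assume "holds (s @ t) c2 (arith_op Plus 1 1)"
  then have c2: "holds (s @ t) c2 2" by simp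
  show "computes (seq (arith_prog Divide c1 c2) (\<lambda>ch. tabulate (SIGMA a:{..<l}. FO a) (\<lambda>(a, b).
      seq (sumprod (colC a \<inter> colC b) (\<lambda>i. \<alpha>C (i, a)) (\<lambda>i. \<alpha>C (i, b)))
        (\<lambda>p. arith_prog Times p (if a = b then ch else c1))))) (s @ t) (1 + 4 * n * \<kappa>\<^sup>2)
    (\<lambda>t s'. holds_on s' (SIGMA a:{..<l}. FO a) t (\<lambda>(a, a'). T a a'))"
  proof (rule computes_seq[OF computes_arith[OF holds_append[OF c1] c2]])
    fix ch t' assume "holds ((s @ t) @ t') ch (arith_op Divide 1 2)"
    then have ch: "holds (s @ t @ t') ch (1 / 2)" by simp
    let ?c = "\<lambda>(a, a'). 2 + 2 * card (colC a \<inter> colC a')"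
    show "computes (tabulate (SIGMA a:{..<l}. FO a) (\<lambda>(a, b).
      seq (sumprod (colC a \<inter> colC b) (\<lambda>i. \<alpha>C (i, a)) (\<lambda>i. \<alpha>C (i, b)))
        (\<lambda>p. arith_prog Times p (if a = b then ch else c1)))) ((s @ t) @ t') (4 * n * \<kappa>\<^sup>2)
      (\<lambda>t s'. holds_on s' (SIGMA a:{..<l}. FO a) t (\<lambda>(a, a'). T a a'))"
    proof (rule computes_tabulate_holds_on[where c = ?c])
      show "finite (SIGMA a:{..<l}. FO a)" by simp
    next
      fix x t'' assume "x \<in> (SIGMA a:{..<l}. FO a)"
      then obtain a a' where x: "x = (a, a')" "a < l" "a' \<in> FO a" by blast
      then have a': "a' < l" "a \<le> a'" by (auto simp: FO_def)
      let ?s = "((s @ t) @ t') @ t''"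
      have mem: "holds ?s (\<alpha>C (i, a)) (C $$ (i, a))" "holds ?s (\<alpha>C (i, a')) (C $$ (i, a'))"
        if "i \<in> colC a \<inter> colC a'" for i
        using that mC by (auto simp: colC_def holds_on_def holds_append)
      have "computes (sumprod (colC a \<inter> colC a') (\<lambda>i. \<alpha>C (i, a)) (\<lambda>i. \<alpha>C (i, a'))) ?s
          (1 + 2 * card (colC a \<inter> colC a')) (\<lambda>p s'. holds s' p (G a a'))"
        by (rule computes_sumprod_bound[OF _ mem]) (use G_eq x a' in auto)
      then have "computes (seq (sumprod (colC a \<inter> colC a') (\<lambda>i. \<alpha>C (i, a)) (\<lambda>i. \<alpha>C (i, a')))
          (\<lambda>p. arith_prog Times p (if a = a' then ch else c1))) ?s
          (2 + 2 * card (colC a \<inter> colC a')) (\<lambda>p s'. holds s' p (T a a'))"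
      proof (rule computes_seq)
        fix p r assume p: "holds (?s @ r) p (G a a')"
        have "holds (?s @ r) (if a = a' then ch else c1) (if a = a' then 1 / 2 else 1)"
          using holds_append[OF ch, of "t'' @ r"] holds_append[OF c1, of "t @ t' @ t'' @ r"] by simp
        from computes_arith[OF p this, of Times]
        show "computes (arith_prog Times p (if a = a' then ch else c1)) (?s @ r) 1 (\<lambda>p s'. holds s' p (T a a'))"
          using a' by (auto simp: T_def elim!: computes_mono)
      qed simp
      then show "computes (case x of (a, b) \<Rightarrow> seq (sumprod (colC a \<inter> colC b) (\<lambda>i. \<alpha>C (i, a)) (\<lambda>i. \<alpha>C (i, b)))
        (\<lambda>p. arith_prog Times p (if a = b then ch else c1))) ?s (?c x)
        (\<lambda>p s'. holds s' p (case x of (a, a') \<Rightarrow> T a a'))"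
        by (simp add: x)
    next
      let ?X = "SIGMA a:{..<l}. FO a"
      let ?R = "\<lambda>i. {a \<in> {..<l}. i \<in> colC a}"
      \<comment> \<open>Double counting. Two overlapping columns share a row, so the fixed cost 2 of
        a pair is absorbed by charging 4 instead of 2 per common row; each row lies in at most
        \<open>\<kappa>\<^sup>2\<close> pairs.\<close>
      have "(\<Sum>x\<in>?X. ?c x) \<le> (\<Sum>x\<in>?X. 4 * card {i \<in> {..<n}. i \<in> colC (fst x) \<inter> colC (snd x)})"
      proof (rule sum_mono)
        fix x assume "x \<in> ?X"
        then have "colC (fst x) \<inter> colC (snd x) \<noteq> {}" by (auto simp: FO_def)
        then have "1 \<le> card (colC (fst x) \<inter> colC (snd x))" by (simp add: Suc_le_eq card_gt_0_iff)
        moreover have "{i \<in> {..<n}. i \<in> colC (fst x) \<inter> colC (snd x)} = colC (fst x) \<inter> colC (snd x)"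
          by (auto simp: mem_colC)
        ultimately show "?c x \<le> 4 * card {i \<in> {..<n}. i \<in> colC (fst x) \<inter> colC (snd x)}"
          by (simp add: case_prod_unfold)
      qed
      also have "\<dots> = 4 * (\<Sum>i<n. card {x \<in> ?X. i \<in> colC (fst x) \<inter> colC (snd x)})"
        unfolding sum_distrib_left[symmetric] by (subst sum_card_swap) auto
      also have "\<dots> \<le> 4 * (\<Sum>i<n. \<kappa>\<^sup>2)"
      proof (intro mult_left_mono sum_mono)
        fix i
        have "card {x \<in> ?X. i \<in> colC (fst x) \<inter> colC (snd x)} \<le> card (?R i \<times> ?R i)"
          by (rule card_mono) (auto simp: FO_def)
        also have "\<dots> \<le> \<kappa>\<^sup>2"
          unfolding card_cartesian_product power2_eq_square by (intro mult_mono card_row_C) auto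
        finally show "card {x \<in> ?X. i \<in> colC (fst x) \<inter> colC (snd x)} \<le> \<kappa>\<^sup>2" .
      qed simp
      finally show "(\<Sum>x\<in>?X. ?c x) \<le> 4 * n * \<kappa>\<^sup>2" by simp
    qed
  qed simp
qed simp

lemma computes_half_D_prog:
  assumes mD: "holds_on s SD \<alpha>D (\<lambda>x. D $$ x)"
    and mT: "holds_on s (SIGMA a:{..<l}. FO a) t (\<lambda>(a, a'). T a a')"
  shows "computes (half_D_prog t) s (n * \<kappa> * (1 + 2 * \<kappa>))
    (\<lambda>e s'. holds_on s' (SIGMA j:{..<n}. W j) e (\<lambda>(j, a). eD j a))"
  unfolding half_D_prog_def
proof (rule computes_tabulate_holds_on)
  show "finite (SIGMA j:{..<n}. W j)" by simp
next
  fix x t' assume "x \<in> (SIGMA j:{..<n}. W j)"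
  then obtain j a' where x: "x = (j, a')" "j < n" "a' \<in> W j" by blast
  have a': "a' < l" using W_subset x by auto
  have "computes (sumprod {a \<in> colD j. a' \<in> FO a} (\<lambda>a. \<alpha>D (a, j)) (\<lambda>a. t (a, a'))) (s @ t') (1 + 2 * \<kappa>)
    (\<lambda>p s'. holds s' p (eD j a'))"
  proof (rule computes_sumprod_bound)
    fix a assume a: "a \<in> {a \<in> colD j. a' \<in> FO a}"
    show "holds (s @ t') (\<alpha>D (a, j)) (D $$ (a, j))"
      using a holds_onD[OF mD, of "(a, j)"] by (simp add: colD_def holds_append)
    show "holds (s @ t') (t (a, a')) (T a a')"
      using a holds_onD[OF mT, of "(a, a')"] by (simp add: mem_colD holds_append)
  next
    show "(\<Sum>a\<in>{a \<in> colD j. a' \<in> FO a}. D $$ (a, j) * T a a') = eD j a'"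
      using eD_eq[OF x(2) a'] by simp
    have "card {a \<in> colD j. a' \<in> FO a} \<le> card (colD j)" by (rule card_mono) auto
    then show "1 + 2 * card {a \<in> colD j. a' \<in> FO a} \<le> 1 + 2 * \<kappa>" using card_colD[of j] by simp
  qed simp
  then show "computes (case x of (j, b) \<Rightarrow> sumprod {a \<in> colD j. b \<in> FO a} (\<lambda>a. \<alpha>D (a, j)) (\<lambda>a. t (a, b)))
      (s @ t') (1 + 2 * \<kappa>) (\<lambda>p s'. holds s' p (case x of (j, a) \<Rightarrow> eD j a))"
    by (simp add: x)
qed (intro sigma_sum_const card_W, simp)

lemma computes_dir_prog:
  assumes mD: "holds_on s SD \<alpha>D (\<lambda>x. D $$ x)" and mF: "holds_on s SF \<alpha>F (\<lambda>x. F $$ x)"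
  shows "computes dir_prog s (k * (f * \<kappa>) * (1 + 2 * f))
    (\<lambda>d s'. holds_on s' (SIGMA i:{..<k}. V i) d (\<lambda>(i, a). v i a))"
  unfolding dir_prog_def
proof (rule computes_tabulate_holds_on)
  show "finite (SIGMA i:{..<k}. V i)" by simp
next
  fix x t assume "x \<in> (SIGMA i:{..<k}. V i)"
  then obtain i a where x: "x = (i, a)" "i < k" "a \<in> V i" by blast
  have a: "a < l" using V_subset x by auto
  have "computes (sumprod {j \<in> colF i. a \<in> colD j} (\<lambda>j. \<alpha>F (j, i)) (\<lambda>j. \<alpha>D (a, j))) (s @ t) (1 + 2 * f)
    (\<lambda>p s'. holds s' p (v i a))"
  proof (rule computes_sumprod_bound)
    fix j assume j: "j \<in> {j \<in> colF i. a \<in> colD j}"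
    show "holds (s @ t) (\<alpha>F (j, i)) (F $$ (j, i))"
      using j holds_onD[OF mF, of "(j, i)"] by (simp add: colF_def holds_append)
    show "holds (s @ t) (\<alpha>D (a, j)) (D $$ (a, j))"
      using j holds_onD[OF mD, of "(a, j)"] by (simp add: colD_def holds_append)
  next
    show "(\<Sum>j\<in>{j \<in> colF i. a \<in> colD j}. F $$ (j, i) * D $$ (a, j)) = v i a"
      using v_eq[OF x(2) a] by simp
    have "card {j \<in> colF i. a \<in> colD j} \<le> card (colF i)" by (rule card_mono) auto
    then show "1 + 2 * card {j \<in> colF i. a \<in> colD j} \<le> 1 + 2 * f" using card_colF[of i] by simp
  qed simp
  then show "computes (case x of (i, a) \<Rightarrow> sumprod {j \<in> colF i. a \<in> colD j} (\<lambda>j. \<alpha>F (j, i)) (\<lambda>j. \<alpha>D (a, j)))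
      (s @ t) (1 + 2 * f) (\<lambda>p s'. holds s' p (case x of (i, a) \<Rightarrow> v i a))"
    by (simp add: x)
qed (intro sigma_sum_const card_V, simp)

lemma computes_half_dir_prog:
  assumes mF: "holds_on s SF \<alpha>F (\<lambda>x. F $$ x)"
    and me: "holds_on s (SIGMA j:{..<n}. W j) e (\<lambda>(j, a). eD j a)"
  shows "computes (half_dir_prog e) s (k * (f * \<kappa>) * (1 + 2 * f))
    (\<lambda>d s'. holds_on s' (SIGMA i:{..<k}. V i) d (\<lambda>(i, a). g i a))"
  unfolding half_dir_prog_def
proof (rule computes_tabulate_holds_on)
  show "finite (SIGMA i:{..<k}. V i)" by simp
next
  fix x t assume "x \<in> (SIGMA i:{..<k}. V i)"
  then obtain i a where x: "x = (i, a)" "i < k" "a \<in> V i" by blast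
  have a: "a < l" using V_subset x by auto
  have "computes (sumprod {j \<in> colF i. a \<in> W j} (\<lambda>j. \<alpha>F (j, i)) (\<lambda>j. e (j, a))) (s @ t) (1 + 2 * f)
    (\<lambda>p s'. holds s' p (g i a))"
  proof (rule computes_sumprod_bound)
    fix j assume j: "j \<in> {j \<in> colF i. a \<in> W j}"
    show "holds (s @ t) (\<alpha>F (j, i)) (F $$ (j, i))"
      using j holds_onD[OF mF, of "(j, i)"] by (simp add: colF_def holds_append)
    show "holds (s @ t) (e (j, a)) (eD j a)"
      using j holds_onD[OF me, of "(j, a)"] by (simp add: mem_colF holds_append)
  next
    show "(\<Sum>j\<in>{j \<in> colF i. a \<in> W j}. F $$ (j, i) * eD j a) = g i a"
      using g_eq[OF x(2) a] by simp
    have "card {j \<in> colF i. a \<in> W j} \<le> card (colF i)" by (rule card_mono) auto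
    then show "1 + 2 * card {j \<in> colF i. a \<in> W j} \<le> 1 + 2 * f" using card_colF[of i] by simp
  qed simp
  then show "computes (case x of (i, b) \<Rightarrow> sumprod {j \<in> colF i. b \<in> W j} (\<lambda>j. \<alpha>F (j, i)) (\<lambda>j. e (j, b)))
      (s @ t) (1 + 2 * f) (\<lambda>p s'. holds s' p (case x of (i, a) \<Rightarrow> g i a))"
    by (simp add: x)
qed (intro sigma_sum_const card_V, simp)

lemma computes_sq_norm_prog:
  assumes c1: "holds s c1 1"
    and mv: "holds_on s (SIGMA i:{..<k}. V i) \<beta>v (\<lambda>(i, a). v i a)"
    and mg: "holds_on s (SIGMA i:{..<k}. V i) \<beta>g (\<lambda>(i, a). g i a)"
  shows "computes (sq_norm_prog c1 \<beta>v \<beta>g) s (k * (3 + 2 * (f * \<kappa>))) (\<lambda>d s'. holds_on s' {..<k} d \<nu>)"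
  unfolding sq_norm_prog_def
proof (rule computes_tabulate_holds_on)
  fix i t assume "i \<in> {..<k}"
  then have i: "i < k" by simp
  let ?z = "\<Sum>a\<in>V i. g i a * v i a"
  have "computes (sumprod (V i) (\<lambda>a. \<beta>g (i, a)) (\<lambda>a. \<beta>v (i, a))) (s @ t) (1 + 2 * (f * \<kappa>)) (\<lambda>p s'. holds s' p ?z)"
  proof (rule computes_sumprod_bound)
    fix a assume "a \<in> V i"
    then show "holds (s @ t) (\<beta>g (i, a)) (g i a)" "holds (s @ t) (\<beta>v (i, a)) (v i a)"
      using i holds_onD[OF mg, of "(i, a)"] holds_onD[OF mv, of "(i, a)"] by (auto simp: holds_append)
  qed (use card_V[of i] in auto)
  then show "computes (seq (sumprod (V i) (\<lambda>a. \<beta>g (i, a)) (\<lambda>a. \<beta>v (i, a))) (\<lambda>p.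
       seq (arith_prog Plus p p) (\<lambda>q. arith_prog Plus q c1))) (s @ t) (3 + 2 * (f * \<kappa>)) (\<lambda>p s'. holds s' p (\<nu> i))"
  proof (rule computes_seq)
    fix p t' assume p: "holds ((s @ t) @ t') p ?z"
    show "computes (seq (arith_prog Plus p p) (\<lambda>q. arith_prog Plus q c1)) ((s @ t) @ t') 2 (\<lambda>p s'. holds s' p (\<nu> i))"
    proof (rule computes_seq[OF computes_arith[OF p p]])
      fix q t'' assume q: "holds (((s @ t) @ t') @ t'') q (arith_op Plus ?z ?z)"
      have "holds (((s @ t) @ t') @ t'') c1 1" using c1 by (simp add: holds_append)
      from computes_arith[OF q this, of Plus]
      show "computes (arith_prog Plus q c1) (((s @ t) @ t') @ t'') 1 (\<lambda>p s'. holds s' p (\<nu> i))"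
        by (simp add: \<nu>_eq[OF i])
    qed simp
  qed simp
qed auto

text \<open>Exchanging the order of counting bounds the incidences by \<open>n * \<kappa>\<close>,
  and \<open>l <= n * \<kappa>\<close> covers the fixed cost of each of the \<open>l\<close>
  sums.\<close>

lemma sum_incidence_le:
  assumes "\<And>j. card (S j) \<le> \<kappa>" "\<And>j. finite (S j)"
  shows "(\<Sum>a<l. 1 + 2 * card {j \<in> {..<n}. a \<in> S j}) \<le> 3 * n * \<kappa>"
proof -
  have "(\<Sum>a<l. card {j \<in> {..<n}. a \<in> S j}) = (\<Sum>j<n. card {a \<in> {..<l}. a \<in> S j})"
    by (rule sum_card_swap) auto
  also have "\<dots> \<le> (\<Sum>j<n. \<kappa>)"
  proof (rule sum_mono)
    fix j
    have "card {a \<in> {..<l}. a \<in> S j} \<le> card (S j)" using assms by (intro card_mono) auto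
    then show "card {a \<in> {..<l}. a \<in> S j} \<le> \<kappa>" using assms(1)[of j] by simp
  qed
  finally have *: "(\<Sum>a<l. card {j \<in> {..<n}. a \<in> S j}) \<le> n * \<kappa>" by simp
  have "(\<Sum>a<l. 1 + 2 * card {j \<in> {..<n}. a \<in> S j}) = l + 2 * (\<Sum>a<l. card {j \<in> {..<n}. a \<in> S j})"
    unfolding sum.distrib sum_distrib_left by simp
  then show ?thesis using l_le * by simp
qed

lemma computes_start_prog:
  assumes mD: "holds_on s SD \<alpha>D (\<lambda>x. D $$ x)" and mb: "holds_on s {..<n} \<alpha>b (\<lambda>j. b $ j)"
  shows "computes start_prog s (3 * n * \<kappa>) (\<lambda>d s'. holds_on s' {..<l} d u\<^sub>0)"
  unfolding start_prog_def
proof (rule computes_tabulate_holds_on)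
  fix a t assume "a \<in> {..<l}"
  then have a: "a < l" by simp
  show "computes (sumprod {j \<in> {..<n}. a \<in> colD j} \<alpha>b (\<lambda>j. \<alpha>D (a, j))) (s @ t)
      (1 + 2 * card {j \<in> {..<n}. a \<in> colD j}) (\<lambda>p s'. holds s' p (u\<^sub>0 a))"
  proof (rule computes_sumprod_bound)
    fix j assume j: "j \<in> {j \<in> {..<n}. a \<in> colD j}"
    show "holds (s @ t) (\<alpha>b j) (b $ j)" using j holds_onD[OF mb] by (simp add: holds_append)
    show "holds (s @ t) (\<alpha>D (a, j)) (D $$ (a, j))"
      using j holds_onD[OF mD, of "(a, j)"] by (simp add: colD_def holds_append)
  next
    show "(\<Sum>j\<in>{j \<in> {..<n}. a \<in> colD j}. b $ j * D $$ (a, j)) = u\<^sub>0 a"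
      unfolding u\<^sub>0_def by (rule sum.mono_neutral_cong_left) (use a in \<open>auto simp: mem_colD\<close>)
  qed auto
qed (simp, rule sum_incidence_le, simp_all add: card_colD)

lemma computes_half_start_prog:
  assumes me: "holds_on s (SIGMA j:{..<n}. W j) e (\<lambda>(j, a). eD j a)" and mb: "holds_on s {..<n} \<alpha>b (\<lambda>j. b $ j)"
  shows "computes (half_start_prog e) s (3 * n * \<kappa>) (\<lambda>d s'. holds_on s' {..<l} d (half u\<^sub>0))"
  unfolding half_start_prog_def
proof (rule computes_tabulate_holds_on)
  fix a t assume "a \<in> {..<l}"
  then have a: "a < l" by simp
  show "computes (sumprod {j \<in> {..<n}. a \<in> W j} \<alpha>b (\<lambda>j. e (j, a))) (s @ t)
      (1 + 2 * card {j \<in> {..<n}. a \<in> W j}) (\<lambda>p s'. holds s' p (half u\<^sub>0 a))"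
  proof (rule computes_sumprod_bound)
    fix j assume j: "j \<in> {j \<in> {..<n}. a \<in> W j}"
    show "holds (s @ t) (\<alpha>b j) (b $ j)" using j holds_onD[OF mb] by (simp add: holds_append)
    show "holds (s @ t) (e (j, a)) (eD j a)"
      using j holds_onD[OF me, of "(j, a)"] by (simp add: holds_append)
  next
    show "(\<Sum>j\<in>{j \<in> {..<n}. a \<in> W j}. b $ j * eD j a) = half u\<^sub>0 a"
      unfolding half_u\<^sub>0 by (rule sum.mono_neutral_cong_left) (use a eD_eq_0 in auto)
  qed auto
qed (simp, rule sum_incidence_le, simp_all add: card_W)

text \<open>The time is \<open>1 + 2 * k\<close> for the sum, 2 for the scaling factor,
  \<open>k\<close> for scaling and \<open>4 * k\<close> for sorting and building the alias
  table.\<close>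

lemma computes_weight_prog:
  assumes c1: "holds s c1 1" and m\<nu>: "holds_on s {..<k} \<beta> \<nu>"
  shows "computes (weight_prog c1 \<beta>) s (3 + 7 * k)
    (\<lambda>tbl s'. valid_alias {..<k} (\<lambda>i. \<nu> i * (real k / total_weight Q)) tbl s')"
  unfolding weight_prog_def
proof (rule computes_seq)
  have \<tau>: "(\<Sum>i<k. \<nu> i * 1) = total_weight Q"
    using Q_carrier by (simp add: total_weight_def \<nu>_def)
  show "computes (sumprod {..<k} \<beta> (\<lambda>_. c1)) s (1 + 2 * k) (\<lambda>p s'. holds s' p (total_weight Q))"
    by (rule computes_sumprod_bound[OF _ _ _ \<tau>]) (use c1 holds_onD[OF m\<nu>] in auto)
next
  fix ct t assume ct: "holds (s @ t) ct (total_weight Q)"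
  show "computes (seq (const_prog (int k)) (\<lambda>ck.
     seq (arith_prog Divide ck ct) (\<lambda>\<sigma>. seq (tabulate {..<k} (\<lambda>i. arith_prog Times (\<beta> i) \<sigma>))
       (\<lambda>p. sort_alias c1 (map (\<lambda>i. (i, p i)) [0..<k]) [] [])))) (s @ t) (2 + 5 * k)
    (\<lambda>tbl s'. valid_alias {..<k} (\<lambda>i. \<nu> i * (real k / total_weight Q)) tbl s')"
  proof (rule computes_seq[OF computes_const])
    fix ck t' assume ck: "holds ((s @ t) @ t') ck (real_of_int (int k))"
    show "computes (seq (arith_prog Divide ck ct) (\<lambda>\<sigma>. seq (tabulate {..<k} (\<lambda>i. arith_prog Times (\<beta> i) \<sigma>))
       (\<lambda>p. sort_alias c1 (map (\<lambda>i. (i, p i)) [0..<k]) [] []))) ((s @ t) @ t') (1 + 5 * k)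
      (\<lambda>tbl s'. valid_alias {..<k} (\<lambda>i. \<nu> i * (real k / total_weight Q)) tbl s')"
    proof (rule computes_seq[OF computes_arith[OF ck holds_append[OF ct]]])
      fix cs t'' assume "holds (((s @ t) @ t') @ t'') cs (arith_op Divide (real_of_int (int k)) (total_weight Q))"
      then have cs: "holds (((s @ t) @ t') @ t'') cs (real k / total_weight Q)" by simp
      let ?s = "((s @ t) @ t') @ t''" and ?r = "\<lambda>i. \<nu> i * (real k / total_weight Q)"
      show "computes (seq (tabulate {..<k} (\<lambda>i. arith_prog Times (\<beta> i) cs))
         (\<lambda>p. sort_alias c1 (map (\<lambda>i. (i, p i)) [0..<k]) [] [])) ?s (5 * k)
        (\<lambda>tbl s'. valid_alias {..<k} ?r tbl s')"
      proof (rule computes_seq[OF computes_tabulate_holds_on[where c = "\<lambda>_. 1" and \<kappa> = k]])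
        fix i r assume "i \<in> {..<k}"
        then have "holds (?s @ r) (\<beta> i) (\<nu> i)" using holds_onD[OF m\<nu>] by (simp add: holds_append)
        from computes_arith[OF this holds_append[OF cs], of Times]
        show "computes (arith_prog Times (\<beta> i) cs) (?s @ r) 1 (\<lambda>p s'. holds s' p (?r i))" by simp
      next
        fix p r assume p: "holds_on (?s @ r) {..<k} p ?r"
        let ?xs = "map (\<lambda>i. (i, p i)) [0..<k]"
        have img: "fst ` set (?xs @ [] @ []) = {..<k}" by (auto simp: image_image)
        have "(\<Sum>i<k. ?r i) = (\<Sum>i<k. \<nu> i) * (real k / total_weight Q)" by (simp only: sum_distrib_right)
        also have "(\<Sum>i<k. \<nu> i) = total_weight Q"
          using Q_carrier by (simp add: total_weight_def \<nu>_def)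
        also have "total_weight Q * (real k / total_weight Q) = real k" using total_weight_ge_1 by simp
        finally have sum: "(\<Sum>i<k. ?r i) = real k" .
        have "computes (sort_alias c1 ?xs [] []) (?s @ r) (length ?xs + 3 * length (?xs @ [] @ []))
          (valid_alias (fst ` set (?xs @ [] @ [])) ?r)"
        proof (rule computes_sort_alias)
          show "holds (?s @ r) a (?r i) \<and> 0 \<le> ?r i" if "(i, a) \<in> set (?xs @ [] @ [])" for i a
            using that holds_onD[OF p, of i] \<nu>_ge_1[of i] total_weight_ge_1 by auto
          show "holds (?s @ r) c1 1" using c1 by (simp add: holds_append)
          show "(\<Sum>i\<in>fst ` set (?xs @ [] @ []). ?r i) = real (card (fst ` set (?xs @ [] @ [])))"
            unfolding img using sum by simp
        qed (auto simp: o_def)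
        then show "computes (sort_alias c1 ?xs [] []) (?s @ r) (4 * k) (valid_alias {..<k} ?r)"
          unfolding img by simp
      qed auto
    qed simp
  qed simp
qed simp

section \<open>One iteration, the loop and the whole run\<close>

text \<open>The invariant of the loop. The coefficients \<open>u\<close> are existentially
  quantified because \<open>x\<close> need not determine them, but the same \<open>u\<close> must
  underlie the first two address maps.\<close>

definition stores :: "real list \<Rightarrow> state \<Rightarrow> real Matrix.vec \<Rightarrow> bool" where
  "stores s = (\<lambda>(\<alpha>, \<beta>, \<gamma>) x. \<exists>u w. x = unlift u w \<and>
     holds_on s {..<l} \<alpha> u \<and> holds_on s {..<l} \<beta> (half u) \<and> holds_on s {..<k} \<gamma> w)"

text \<open>Indices outside \<open>J\<close> keep their old cells, which is right because
  \<open>z\<close> vanishes there.\<close>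

lemma computes_update_prog:
  assumes c: "holds s c x" and d: "holds_on s J d z" and u: "holds_on s {..<l} \<alpha> u"
    and J: "J \<subseteq> {..<l}" and z: "\<And>a. a < l \<Longrightarrow> a \<notin> J \<Longrightarrow> z a = 0" and "2 * card J \<le> \<kappa>'"
  shows "computes (update_prog J c d \<alpha>) s \<kappa>' (\<lambda>\<alpha>' s'. holds_on s' {..<l} \<alpha>' (\<lambda>a. u a - x * z a))"
  unfolding update_prog_def
proof (rule computes_seq[OF computes_tabulate_holds_on[where c = "\<lambda>_. 2" and x = "\<lambda>a. u a - x * z a"]])
  show "finite J" using J finite_subset by blast
next
  fix a t assume "a \<in> J"
  then have da: "holds (s @ t) (d a) (z a)" and ua: "holds (s @ t) (\<alpha> a) (u a)"
    using holds_onD[OF d] holds_onD[OF u] J by (auto simp: holds_append)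
  show "computes (seq (arith_prog Times c (d a)) (\<lambda>p. arith_prog Minus (\<alpha> a) p)) (s @ t) 2
      (\<lambda>p s'. holds s' p (u a - x * z a))"
  proof (rule computes_seq[OF computes_arith[OF holds_append[OF c] da]])
    fix p t' assume "holds ((s @ t) @ t') p (arith_op Times x (z a))"
    from computes_arith[OF holds_append[OF ua] this, of Minus]
    show "computes (arith_prog Minus (\<alpha> a) p) ((s @ t) @ t') 1 (\<lambda>p s'. holds s' p (u a - x * z a))"
      by simp
  qed simp
next
  show "(\<Sum>a\<in>J. 2) \<le> \<kappa>'" using assms(6) by simp
next
  fix \<alpha>' t assume \<alpha>': "holds_on (s @ t) J \<alpha>' (\<lambda>a. u a - x * z a)"
  have "holds (s @ t) (override_on \<alpha> \<alpha>' J a) (u a - x * z a)" if "a < l" for a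
    using holds_onD[OF \<alpha>', of a] holds_onD[OF u, of a] z[OF that] that
    by (cases "a \<in> J") (auto simp: holds_append)
  then show "computes (ret (override_on \<alpha> \<alpha>' J)) (s @ t) 0 (\<lambda>\<alpha>' s'. holds_on s' {..<l} \<alpha>' (\<lambda>a. u a - x * z a))"
    by (intro computes_ret) (simp add: holds_on_def)
qed simp

text \<open>The two products cost \<open>1 + 2 * (f * \<kappa>)\<close> each, the two updates
  \<open>2 * (f * \<kappa>)\<close> each, and four scalar operations remain.\<close>

lemma computes_step_prog:
  assumes mv: "holds_on s (SIGMA i:{..<k}. V i) \<beta>v (\<lambda>(i, a). v i a)"
    and mg: "holds_on s (SIGMA i:{..<k}. V i) \<beta>g (\<lambda>(i, a). g i a)"
    and m\<nu>: "holds_on s {..<k} \<beta>\<nu> \<nu>" and st: "stores s st x" and i: "i < k"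
  shows "computes (step_prog \<beta>v \<beta>g \<beta>\<nu> st i) s (6 + 8 * (f * \<kappa>))
    (\<lambda>st' s'. stores s' st' (iteration_step (col Q i) x))"
proof -
  obtain \<alpha> \<beta> \<gamma> u w where st_eq: "st = (\<alpha>, \<beta>, \<gamma>)" and x: "x = unlift u w" and \<alpha>: "holds_on s {..<l} \<alpha> u"
    and \<beta>: "holds_on s {..<l} \<beta> (half u)" and \<gamma>: "holds_on s {..<k} \<gamma> w"
    using st by (auto simp: stores_def)
  have hv: "holds_on s (V i) (\<lambda>a. \<beta>v (i, a)) (v i)" and hg: "holds_on s (V i) (\<lambda>a. \<beta>g (i, a)) (g i)"
    using mv mg i by (auto simp: holds_on_def)
  have h\<nu>: "holds s (\<beta>\<nu> i) (\<nu> i)" and hw: "holds s (\<gamma> i) (w i)"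
    using holds_onD[OF m\<nu>] holds_onD[OF \<gamma>] i by auto
  have mem: "holds s (\<alpha> a) (u a)" "holds s (\<beta> a) (half u a)" if "a \<in> V i" for a
    using holds_onD[OF \<alpha>] holds_onD[OF \<beta>] V_subset that by blast+
  let ?p = "\<Sum>a\<in>V i. g i a * u a" and ?q = "\<Sum>a\<in>V i. v i a * half u a"
  define c where "c = (?p + ?q - w i) / \<nu> i"
  show ?thesis unfolding st_eq step_prog_def prod.case
  proof (rule computes_seq)
    show "computes (sumprod (V i) (\<lambda>a. \<beta>g (i, a)) \<alpha>) s (1 + 2 * (f * \<kappa>)) (\<lambda>a s'. holds s' a ?p)"
      by (rule computes_sumprod_bound) (use holds_onD[OF hg] mem card_V[of i] in auto)
  next
    fix p t assume p: "holds (s @ t) p ?p"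
    show "computes (seq (sumprod (V i) (\<lambda>a. \<beta>v (i, a)) \<beta>) (\<lambda>q.
     seq (arith_prog Plus p q) (\<lambda>p'. seq (arith_prog Minus p' (\<gamma> i)) (\<lambda>q'. seq (arith_prog Divide q' (\<beta>\<nu> i)) (\<lambda>c.
     seq (update_prog (V i) c (\<lambda>a. \<beta>v (i, a)) \<alpha>) (\<lambda>u'. seq (update_prog (V i) c (\<lambda>a. \<beta>g (i, a)) \<beta>) (\<lambda>y'.
     seq (arith_prog Plus (\<gamma> i) c) (\<lambda>w'. ret (u', y', \<gamma>(i := w'))))))))))
      (s @ t) (5 + 6 * (f * \<kappa>)) (\<lambda>st' s'. stores s' st' (iteration_step (col Q i) x))"
    proof (rule computes_seq)
      show "computes (sumprod (V i) (\<lambda>a. \<beta>v (i, a)) \<beta>) (s @ t) (1 + 2 * (f * \<kappa>)) (\<lambda>a s'. holds s' a ?q)"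
        by (rule computes_sumprod_bound) (use holds_onD[OF hv] mem card_V[of i] in \<open>auto simp: holds_append\<close>)
    next
      fix q t' assume q: "holds ((s @ t) @ t') q ?q"
      show "computes (seq (arith_prog Plus p q) (\<lambda>p'. seq (arith_prog Minus p' (\<gamma> i)) (\<lambda>q'. seq (arith_prog Divide q' (\<beta>\<nu> i)) (\<lambda>c.
         seq (update_prog (V i) c (\<lambda>a. \<beta>v (i, a)) \<alpha>) (\<lambda>u'. seq (update_prog (V i) c (\<lambda>a. \<beta>g (i, a)) \<beta>) (\<lambda>y'.
         seq (arith_prog Plus (\<gamma> i) c) (\<lambda>w'. ret (u', y', \<gamma>(i := w')))))))))
        ((s @ t) @ t') (4 + 4 * (f * \<kappa>)) (\<lambda>st' s'. stores s' st' (iteration_step (col Q i) x))"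
      proof (rule computes_seq[OF computes_arith[OF holds_append[OF p] q]])
        fix p' r assume p': "holds (((s @ t) @ t') @ r) p' (arith_op Plus ?p ?q)"
        have w': "holds (((s @ t) @ t') @ r) (\<gamma> i) (w i)" using hw by (simp add: holds_append)
        show "computes (seq (arith_prog Minus p' (\<gamma> i)) (\<lambda>q'. seq (arith_prog Divide q' (\<beta>\<nu> i)) (\<lambda>c.
           seq (update_prog (V i) c (\<lambda>a. \<beta>v (i, a)) \<alpha>) (\<lambda>u'. seq (update_prog (V i) c (\<lambda>a. \<beta>g (i, a)) \<beta>) (\<lambda>y'.
           seq (arith_prog Plus (\<gamma> i) c) (\<lambda>w'. ret (u', y', \<gamma>(i := w'))))))))
          (((s @ t) @ t') @ r) (3 + 4 * (f * \<kappa>)) (\<lambda>st' s'. stores s' st' (iteration_step (col Q i) x))"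
        proof (rule computes_seq[OF computes_arith[OF p' w']])
          fix q' r' assume q': "holds ((((s @ t) @ t') @ r) @ r') q' (arith_op Minus (arith_op Plus ?p ?q) (w i))"
          have n': "holds ((((s @ t) @ t') @ r) @ r') (\<beta>\<nu> i) (\<nu> i)" using h\<nu> by (simp add: holds_append)
          show "computes (seq (arith_prog Divide q' (\<beta>\<nu> i)) (\<lambda>c.
             seq (update_prog (V i) c (\<lambda>a. \<beta>v (i, a)) \<alpha>) (\<lambda>u'. seq (update_prog (V i) c (\<lambda>a. \<beta>g (i, a)) \<beta>) (\<lambda>y'.
             seq (arith_prog Plus (\<gamma> i) c) (\<lambda>w'. ret (u', y', \<gamma>(i := w')))))))
            ((((s @ t) @ t') @ r) @ r') (2 + 4 * (f * \<kappa>)) (\<lambda>st' s'. stores s' st' (iteration_step (col Q i) x))"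
          proof (rule computes_seq[OF computes_arith[OF q' n']])
            fix cc t'' assume "holds (((((s @ t) @ t') @ r) @ r') @ t'') cc
              (arith_op Divide (arith_op Minus (arith_op Plus ?p ?q) (w i)) (\<nu> i))"
            moreover define s' where "s' = ((((s @ t) @ t') @ r) @ r') @ t''"
            ultimately have cc: "holds s' cc c" by (simp add: c_def)
            have s': "holds_on s' {..<l} \<alpha> u" "holds_on s' {..<l} \<beta> (half u)" "holds_on s' {..<k} \<gamma> w"
              "holds_on s' (V i) (\<lambda>a. \<beta>v (i, a)) (v i)" "holds_on s' (V i) (\<lambda>a. \<beta>g (i, a)) (g i)"
              using \<alpha> \<beta> \<gamma> hv hg by (simp_all add: s'_def holds_on_append)
            show "computes (seq (update_prog (V i) cc (\<lambda>a. \<beta>v (i, a)) \<alpha>) (\<lambda>u'. seq (update_prog (V i) cc (\<lambda>a. \<beta>g (i, a)) \<beta>) (\<lambda>y'.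
               seq (arith_prog Plus (\<gamma> i) cc) (\<lambda>w'. ret (u', y', \<gamma>(i := w'))))))
              (((((s @ t) @ t') @ r) @ r') @ t'') (1 + 4 * (f * \<kappa>)) (\<lambda>st' s'. stores s' st' (iteration_step (col Q i) x))"
              unfolding s'_def[symmetric]
            proof (rule computes_seq[OF computes_update_prog[OF cc s'(4,1) V_subset, where \<kappa>' = "2 * (f * \<kappa>)"]])
              fix \<alpha>' t1 assume \<alpha>': "holds_on (s' @ t1) {..<l} \<alpha>' (\<lambda>a. u a - c * v i a)"
              show "computes (seq (update_prog (V i) cc (\<lambda>a. \<beta>g (i, a)) \<beta>) (\<lambda>y'.
                 seq (arith_prog Plus (\<gamma> i) cc) (\<lambda>w'. ret (\<alpha>', y', \<gamma>(i := w'))))) (s' @ t1) (1 + 2 * (f * \<kappa>))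
                (\<lambda>st' s'. stores s' st' (iteration_step (col Q i) x))"
              proof (rule computes_seq[OF computes_update_prog[OF holds_append[OF cc] holds_on_append[OF s'(5)]
                    holds_on_append[OF s'(2)] V_subset, where \<kappa>' = "2 * (f * \<kappa>)"]])
                fix \<beta>' t2 assume \<beta>': "holds_on ((s' @ t1) @ t2) {..<l} \<beta>' (\<lambda>a. half u a - c * g i a)"
                have wi: "holds ((s' @ t1) @ t2) (\<gamma> i) (w i)" "holds ((s' @ t1) @ t2) cc c"
                  using holds_onD[OF s'(3)] i cc by (auto simp: holds_append)
                show "computes (seq (arith_prog Plus (\<gamma> i) cc) (\<lambda>w'. ret (\<alpha>', \<beta>', \<gamma>(i := w')))) ((s' @ t1) @ t2) 1
                  (\<lambda>st' s'. stores s' st' (iteration_step (col Q i) x))"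
                proof (rule computes_seq[OF computes_arith[OF wi]])
                  fix w' t3 assume w': "holds (((s' @ t1) @ t2) @ t3) w' (arith_op Plus (w i) c)"
                  have "holds_on (((s' @ t1) @ t2) @ t3) {..<k} (\<gamma>(i := w')) (w(i := w i + c))"
                    using w' s'(3) by (auto simp: holds_on_def holds_append)
                  moreover have "iteration_step (col Q i) x = unlift (\<lambda>a. u a - c * v i a) (w(i := w i + c))"
                    unfolding x by (rule iteration_step_unlift[of i c u w, OF i c_def])
                  \<comment> \<open>Linearity of \<open>half\<close> keeps the second address map in
                    line with the new \<open>u\<close> without recomputing it.\<close>
                  moreover have "half (\<lambda>a. u a - c * v i a) = (\<lambda>a. half u a - c * g i a)"
                    by (simp add: fun_eq_iff half_diff g_def)
                  ultimately have "stores (((s' @ t1) @ t2) @ t3) (\<alpha>', \<beta>', \<gamma>(i := w')) (iteration_step (col Q i) x)"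
                    unfolding stores_def prod.case using holds_on_append[OF \<alpha>', of "t2 @ t3"] holds_on_append[OF \<beta>', of t3]
                    by (intro exI[of _ "\<lambda>a. u a - c * v i a"] exI[of _ "w(i := w i + c)"]) auto
                  then show "computes (ret (\<alpha>', \<beta>', \<gamma>(i := w'))) (((s' @ t1) @ t2) @ t3) 0
                    (\<lambda>st' s'. stores s' st' (iteration_step (col Q i) x))"
                    by (rule computes_ret)
                qed simp
              qed (use g_eq_0[OF i] card_V[of i] in auto)
            qed (use v_eq_0[OF i] card_V[of i] in auto)
          qed simp
        qed simp
      qed simp
    qed simp
  qed simp
qed

text \<open>Only here is \<open>C u\<close> written out, with at most \<open>\<kappa>\<close> terms
  for each row of \<open>C\<close>.\<close>

lemma spec_output_prog:
  assumes mC: "holds_on s SC \<alpha>C (\<lambda>x. C $$ x)" and st: "stores s st x"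
  shows "spec (output_prog st) s (n * (1 + 2 * \<kappa>)) (return_pmf x)"
proof -
  obtain \<alpha> \<beta> \<gamma> u w where st_eq: "st = (\<alpha>, \<beta>, \<gamma>)" and x: "x = unlift u w" and \<alpha>: "holds_on s {..<l} \<alpha> u"
    and \<gamma>: "holds_on s {..<k} \<gamma> w"
    using st by (auto simp: stores_def)
  show ?thesis unfolding st_eq output_prog_def prod.case
  proof (rule spec_computes_seq[OF computes_tabulate_holds_on[where x = "lift u" and c = "\<lambda>_. 1 + 2 * \<kappa>"]])
    fix i t assume "i \<in> {..<n}"
    then have i: "i < n" by simp
    show "computes (sumprod {a \<in> {..<l}. i \<in> colC a} (\<lambda>a. \<alpha>C (i, a)) \<alpha>) (s @ t) (1 + 2 * \<kappa>) (\<lambda>p s'. holds s' p (lift u i))"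
    proof (rule computes_sumprod_bound)
      fix a assume a: "a \<in> {a \<in> {..<l}. i \<in> colC a}"
      show "holds (s @ t) (\<alpha>C (i, a)) (C $$ (i, a))"
        using a holds_onD[OF mC, of "(i, a)"] by (simp add: colC_def holds_append)
      show "holds (s @ t) (\<alpha> a) (u a)" using a holds_onD[OF \<alpha>] by (simp add: holds_append)
    next
      show "(\<Sum>a\<in>{a \<in> {..<l}. i \<in> colC a}. C $$ (i, a) * u a) = lift u i"
        unfolding lift_def by (rule sum.mono_neutral_cong_left) (use i in \<open>auto simp: mem_colC\<close>)
    qed (use card_row_C[of i] in auto)
  next
    fix \<xi> t assume \<xi>: "holds_on (s @ t) {..<n} \<xi> (lift u)"
    have "map ((!) (s @ t)) (map \<xi> [0..<n] @ map \<gamma> [0..<k]) = map (lift u) [0..<n] @ map w [0..<k]"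
      using holds_onD[OF \<xi>] holds_onD[OF holds_on_append[OF \<gamma>, of t]] by (simp add: holds_def)
    moreover have "vec_of_list (map (lift u) [0..<n] @ map w [0..<k]) = x"
      unfolding x unlift_def by (intro eq_vecI) (auto simp: vec_of_list_index nth_append)
    ultimately show "spec (ret (map \<xi> [0..<n] @ map \<gamma> [0..<k])) (s @ t) 0 (return_pmf x)"
      using spec_ret[of "map \<xi> [0..<n] @ map \<gamma> [0..<k]" "s @ t" 0] by (simp only:)
  qed auto
qed

text \<open>\<open>iterate_law\<close> splits off the last step, whereas the program draws the first
  step and continues with the rest.\<close>

lemma iterate_law_Suc_left:
  "iterate_law M x (Suc t) = bind_pmf (column_law M) (\<lambda>j. iterate_law M (iteration_step (col M j) x) t)"
proof (induction t)
  case 0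
  then show ?case by (simp add: bind_return_pmf map_pmf_def)
next
  case (Suc t)
  then show ?case by (simp only: iterate_law.simps(2)[of M x "Suc t"] bind_assoc_pmf iterate_law.simps(2)[of M _ t])
qed

text \<open>Each round costs the step plus 2 for the draw, one uniform choice and one coin. The same
  table serves every round, so its validity is assumed in all extensions of the memory.\<close>

lemma spec_loop_prog:
  assumes "holds_on s SC \<alpha>C (\<lambda>x. C $$ x)"
    and "holds_on s (SIGMA i:{..<k}. V i) \<beta>v (\<lambda>(i, a). v i a)"
    and "holds_on s (SIGMA i:{..<k}. V i) \<beta>g (\<lambda>(i, a). g i a)"
    and "holds_on s {..<k} \<beta>\<nu> \<nu>" and "stores s st x"
    and tbl: "\<And>t. valid_alias {..<k} (\<lambda>i. \<nu> i * (real k / total_weight Q)) tbl (s @ t)"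
  shows "spec (loop_prog (step_prog \<beta>v \<beta>g \<beta>\<nu>) tbl N st) s (N * (8 + 8 * (f * \<kappa>)) + n * (1 + 2 * \<kappa>))
    (iterate_law Q x N)"
  using assms
proof (induction N arbitrary: s st x)
  case 0
  then show ?case using spec_output_prog[of s st x] by simp
next
  case (Suc N)
  have "spec (sample k tbl (\<lambda>i. seq (step_prog \<beta>v \<beta>g \<beta>\<nu> st i) (loop_prog (step_prog \<beta>v \<beta>g \<beta>\<nu>) tbl N))) s
      ((6 + 8 * (f * \<kappa>) + (N * (8 + 8 * (f * \<kappa>)) + n * (1 + 2 * \<kappa>))) + 2)
      (bind_pmf (column_law Q) (\<lambda>j. iterate_law Q (iteration_step (col Q j) x) N))"
  proof (rule spec_sample)
    show "valid_alias {..<k} (\<lambda>i. \<nu> i * (real k / total_weight Q)) tbl s" using Suc(7)[of "[]"] by simp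
    show "pmf (column_law Q) j = (if j < k then \<nu> j * (real k / total_weight Q) / real k else 0)" for j
      using pmf_column_law[of Q j] total_weight_ge_1 Q_carrier k_pos by (simp add: \<nu>_def)
  next
    fix i assume i: "i < k"
    show "spec (seq (step_prog \<beta>v \<beta>g \<beta>\<nu> st i) (loop_prog (step_prog \<beta>v \<beta>g \<beta>\<nu>) tbl N)) s
        (6 + 8 * (f * \<kappa>) + (N * (8 + 8 * (f * \<kappa>)) + n * (1 + 2 * \<kappa>)))
        (iterate_law Q (iteration_step (col Q i) x) N)"
    proof (rule spec_computes_seq[OF computes_step_prog[OF Suc(3-6) i]])
      fix st' t assume "stores (s @ t) st' (iteration_step (col Q i) x)"
      then show "spec (loop_prog (step_prog \<beta>v \<beta>g \<beta>\<nu>) tbl N st') (s @ t)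
          (N * (8 + 8 * (f * \<kappa>)) + n * (1 + 2 * \<kappa>)) (iterate_law Q (iteration_step (col Q i) x) N)"
        using Suc(2-5) Suc(7) by (intro Suc(1)) (auto intro: holds_on_append)
    qed simp
  qed (rule k_pos)
  then show ?case unfolding loop_prog.simps iterate_law_Suc_left
    by (rule spec_mono) simp
qed

lemma valid_alias_append: "valid_alias R r tbl s \<Longrightarrow> valid_alias R r tbl (s @ t)"
  unfolding valid_alias_def by (meson holds_append)

theorem spec_kaczmarz_prog:
  assumes mC: "holds_on s SC \<alpha>C (\<lambda>x. C $$ x)" and mD: "holds_on s SD \<alpha>D (\<lambda>x. D $$ x)"
    and mF: "holds_on s SF \<alpha>F (\<lambda>x. F $$ x)" and mb: "holds_on s {..<n} \<alpha>b (\<lambda>j. b $ j)"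
  shows "spec (kaczmarz_prog N) s (N * (16 * (f * \<kappa>)) + 50 * ((n + k) * f\<^sup>2 * \<kappa>\<^sup>2))
    (iterate_law Q (start_point B F b) N)"
proof -
  let ?L = "iterate_law Q (start_point B F b) N"
  \<comment> \<open>\<open>?c9\<close> is the time of loop and output, and each lower number adds
    the stage before it, so that the total has the exact shape of the left side of
    \<open>kaczmarz_cost\<close>.\<close>
  let ?c9 = "N * (8 + 8 * (f * \<kappa>)) + n * (1 + 2 * \<kappa>)"
  let ?c8 = "3 + 7 * k + ?c9" let ?c7 = "3 * n * \<kappa> + ?c8" let ?c6 = "3 * n * \<kappa> + ?c7"
  let ?c5 = "k * (3 + 2 * (f * \<kappa>)) + ?c6" let ?c4 = "k * (f * \<kappa>) * (1 + 2 * f) + ?c5"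
  let ?c3 = "k * (f * \<kappa>) * (1 + 2 * f) + ?c4" let ?c2 = "n * \<kappa> * (1 + 2 * \<kappa>) + ?c3"
  let ?c1 = "2 + 4 * n * \<kappa>\<^sup>2 + ?c2"
  note in1 = mC mD mF mb
  have "spec (kaczmarz_prog N) s (1 + (1 + ?c1)) ?L"
    unfolding kaczmarz_prog_def
  proof (rule spec_computes_seq[OF computes_const _ order_refl],
         rule spec_computes_seq[OF computes_const _ order_refl])
    fix c1 t c0 t'
    assume c1: "holds (s @ t) c1 (real_of_int 1)" and c0: "holds ((s @ t) @ t') c0 (real_of_int 0)"
    define s1 where "s1 = (s @ t) @ t'"
    have c: "holds s1 c1 1" "holds s1 c0 0" using holds_append[OF c1, of t'] c0 by (simp_all add: s1_def)
    note in1 = in1[THEN holds_on_append, of "t @ t'", folded append_assoc, folded s1_def]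
    show "spec (seq (gram_prog c1) (\<lambda>T. seq (half_D_prog T) (\<lambda>e. seq dir_prog (\<lambda>v. seq (half_dir_prog e) (\<lambda>g.
        seq (sq_norm_prog c1 v g) (\<lambda>\<nu>. seq start_prog (\<lambda>u. seq (half_start_prog e) (\<lambda>y.
        seq (weight_prog c1 \<nu>) (\<lambda>tbl. loop_prog (step_prog v g \<nu>) tbl N (u, y, \<lambda>_. c0))))))))))
      ((s @ t) @ t') ?c1 ?L"
      unfolding s1_def[symmetric]
    proof (rule spec_computes_seq[OF computes_gram_prog[OF in1(1) c(1)] _ order_refl])
      fix \<beta>T t1 assume T: "holds_on (s1 @ t1) (SIGMA a:{..<l}. FO a) \<beta>T (\<lambda>(a, a'). T a a')"
      note in2 = in1[THEN holds_on_append, of t1] and c2 = c[THEN holds_append, of t1]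
      show "spec (seq (half_D_prog \<beta>T) (\<lambda>e. seq dir_prog (\<lambda>v. seq (half_dir_prog e) (\<lambda>g.
          seq (sq_norm_prog c1 v g) (\<lambda>\<nu>. seq start_prog (\<lambda>u. seq (half_start_prog e) (\<lambda>y.
          seq (weight_prog c1 \<nu>) (\<lambda>tbl. loop_prog (step_prog v g \<nu>) tbl N (u, y, \<lambda>_. c0)))))))))
        (s1 @ t1) ?c2 ?L"
      proof (rule spec_computes_seq[OF computes_half_D_prog[OF in2(2) T] _ order_refl])
        fix \<beta>e t2 assume e: "holds_on ((s1 @ t1) @ t2) (SIGMA j:{..<n}. W j) \<beta>e (\<lambda>(j, a). eD j a)"
        moreover define s2 where "s2 = (s1 @ t1) @ t2"
        ultimately have e: "holds_on s2 (SIGMA j:{..<n}. W j) \<beta>e (\<lambda>(j, a). eD j a)" by simp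
        note in3 = in2[THEN holds_on_append, of t2, folded s2_def] e
          and c3 = c2[THEN holds_append, of t2, folded s2_def]
        show "spec (seq dir_prog (\<lambda>v. seq (half_dir_prog \<beta>e) (\<lambda>g.
            seq (sq_norm_prog c1 v g) (\<lambda>\<nu>. seq start_prog (\<lambda>u. seq (half_start_prog \<beta>e) (\<lambda>y.
            seq (weight_prog c1 \<nu>) (\<lambda>tbl. loop_prog (step_prog v g \<nu>) tbl N (u, y, \<lambda>_. c0))))))))
          ((s1 @ t1) @ t2) ?c3 ?L"
          unfolding s2_def[symmetric]
        proof (rule spec_computes_seq[OF computes_dir_prog[OF in3(2,3)] _ order_refl])
          fix \<beta>v t3 assume v: "holds_on (s2 @ t3) (SIGMA i:{..<k}. V i) \<beta>v (\<lambda>(i, a). v i a)"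
          note in4 = in3[THEN holds_on_append, of t3] v and c4 = c3[THEN holds_append, of t3]
          show "spec (seq (half_dir_prog \<beta>e) (\<lambda>g.
              seq (sq_norm_prog c1 \<beta>v g) (\<lambda>\<nu>. seq start_prog (\<lambda>u. seq (half_start_prog \<beta>e) (\<lambda>y.
              seq (weight_prog c1 \<nu>) (\<lambda>tbl. loop_prog (step_prog \<beta>v g \<nu>) tbl N (u, y, \<lambda>_. c0)))))))
            (s2 @ t3) ?c4 ?L"
          proof (rule spec_computes_seq[OF computes_half_dir_prog[OF in4(3,5)] _ order_refl])
            fix \<beta>g t4 assume g: "holds_on ((s2 @ t3) @ t4) (SIGMA i:{..<k}. V i) \<beta>g (\<lambda>(i, a). g i a)"
            note in5 = in4[THEN holds_on_append, of t4] g and c5 = c4[THEN holds_append, of t4]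
            show "spec (seq (sq_norm_prog c1 \<beta>v \<beta>g) (\<lambda>\<nu>. seq start_prog (\<lambda>u. seq (half_start_prog \<beta>e) (\<lambda>y.
                seq (weight_prog c1 \<nu>) (\<lambda>tbl. loop_prog (step_prog \<beta>v \<beta>g \<nu>) tbl N (u, y, \<lambda>_. c0))))))
              ((s2 @ t3) @ t4) ?c5 ?L"
            proof (rule spec_computes_seq[OF computes_sq_norm_prog[OF c5(1) in5(6,7)] _ order_refl])
              fix \<beta>\<nu> t5 assume "holds_on (((s2 @ t3) @ t4) @ t5) {..<k} \<beta>\<nu> \<nu>"
              moreover define s3 where "s3 = ((s2 @ t3) @ t4) @ t5"
              ultimately have n: "holds_on s3 {..<k} \<beta>\<nu> \<nu>" by simp
              note in6 = in5[THEN holds_on_append, of t5, folded s3_def] n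
                and c6 = c5[THEN holds_append, of t5, folded s3_def]
              show "spec (seq start_prog (\<lambda>u. seq (half_start_prog \<beta>e) (\<lambda>y.
                  seq (weight_prog c1 \<beta>\<nu>) (\<lambda>tbl. loop_prog (step_prog \<beta>v \<beta>g \<beta>\<nu>) tbl N (u, y, \<lambda>_. c0)))))
                (((s2 @ t3) @ t4) @ t5) ?c6 ?L"
                unfolding s3_def[symmetric]
              proof (rule spec_computes_seq[OF computes_start_prog[OF in6(2,4)] _ order_refl])
                fix \<alpha> t6 assume u: "holds_on (s3 @ t6) {..<l} \<alpha> u\<^sub>0"
                note in7 = in6[THEN holds_on_append, of t6] u and c7 = c6[THEN holds_append, of t6]
                show "spec (seq (half_start_prog \<beta>e) (\<lambda>y.
                    seq (weight_prog c1 \<beta>\<nu>) (\<lambda>tbl. loop_prog (step_prog \<beta>v \<beta>g \<beta>\<nu>) tbl N (\<alpha>, y, \<lambda>_. c0))))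
                  (s3 @ t6) ?c7 ?L"
                proof (rule spec_computes_seq[OF computes_half_start_prog[OF in7(5,4)] _ order_refl])
                  fix \<beta> t7 assume y: "holds_on ((s3 @ t6) @ t7) {..<l} \<beta> (half u\<^sub>0)"
                  note in8 = in7[THEN holds_on_append, of t7] y and c8 = c7[THEN holds_append, of t7]
                  show "spec (seq (weight_prog c1 \<beta>\<nu>) (\<lambda>tbl. loop_prog (step_prog \<beta>v \<beta>g \<beta>\<nu>) tbl N (\<alpha>, \<beta>, \<lambda>_. c0)))
                    ((s3 @ t6) @ t7) ?c8 ?L"
                  proof (rule spec_computes_seq[OF computes_weight_prog[OF c8(1) in8(8)] _ order_refl])
                    fix tbl t8 assume tbl: "valid_alias {..<k} (\<lambda>i. \<nu> i * (real k / total_weight Q)) tbl (((s3 @ t6) @ t7) @ t8)"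
                    note in9 = in8[THEN holds_on_append, of t8] and c9 = c8[THEN holds_append, of t8]
                    have "stores (((s3 @ t6) @ t7) @ t8) (\<alpha>, \<beta>, \<lambda>_. c0) (start_point B F b)"
                      unfolding stores_def prod.case start_point_unlift
                      using in9(9,10) c9(2) by (intro exI[of _ u\<^sub>0] exI[of _ "\<lambda>_. 0"]) (simp add: holds_on_def[of _ "{..<k}"])
                    then show "spec (loop_prog (step_prog \<beta>v \<beta>g \<beta>\<nu>) tbl N (\<alpha>, \<beta>, \<lambda>_. c0)) (((s3 @ t6) @ t7) @ t8) ?c9 ?L"
                      using spec_loop_prog[OF in9(1,6,7,8) _ valid_alias_append[OF tbl]] by blast
                  qed
                qed
              qed
            qed
          qed
        qed
      qed
    qed
  qed
  then show ?thesis by (rule spec_mono) (rule kaczmarz_cost[OF n_pos f_pos \<kappa>_pos])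
qed

end

section \<open>Factorizing and iterating on the input memory\<close>

text \<open>The program \<open>fac\<close> is arbitrary; this is what guarantees that
  \<open>F\<close> and \<open>b\<close> are still at their original addresses after it has
  run.\<close>

lemma run_appends: "(a, s', c) \<in> set_pmf (run p s) \<Longrightarrow> \<exists>t. s' = s @ t"
proof (induction p arbitrary: s a s' c)
  case (Const z p)
  then obtain c' where "(a, s', c') \<in> set_pmf (run p (s @ [of_int z]))" by (auto simp: tick_def)
  from Const.IH[OF this] show ?case by auto
next
  case (Arith g i j p)
  then obtain c' where "(a, s', c') \<in> set_pmf (run p (s @ [arith_op g (s ! i) (s ! j)]))"
    by (auto simp: tick_def)
  from Arith.IH[OF this] show ?case by auto
qed (fastforce simp: tick_def split: if_splits)+

section \<open>Layout of the input memory\<close>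

lemma length_concat_uniform:
  assumes "\<And>xs. xs \<in> set xss \<Longrightarrow> length xs = c"
  shows "length (concat xss) = length xss * c"
  using assms by (induction xss) auto

lemma nth_concat_uniform:
  assumes "\<And>xs. xs \<in> set xss \<Longrightarrow> length xs = c" "i < length xss" "j < c"
  shows "concat xss ! (i * c + j) = xss ! i ! j"
  using assms
proof (induction xss arbitrary: i)
  case (Cons xs xss)
  then show ?case by (cases i) (auto simp: nth_append)
qed simp

lemma concat_mat_to_list:
  assumes "M \<in> carrier_mat p q"
  shows "length (concat (mat_to_list M)) = p * q"
    and "i < p \<Longrightarrow> j < q \<Longrightarrow> concat (mat_to_list M) ! (i * q + j) = M $$ (i, j)"
proof -
  have len: "length xs = q" if "xs \<in> set (mat_to_list M)" for xs
    using that assms by (auto simp: mat_to_list_def)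
  show "length (concat (mat_to_list M)) = p * q"
    using length_concat_uniform[of "mat_to_list M" q, OF len] assms by (simp add: mat_to_list_def)
  show "concat (mat_to_list M) ! (i * q + j) = M $$ (i, j)" if "i < p" "j < q"
    using nth_concat_uniform[of "mat_to_list M" q i j, OF len] assms that by (simp add: mat_to_list_def)
qed

text \<open>Row by row, \<open>E\<close> fills the first \<open>n * n\<close> cells and
  \<open>F\<close> the next \<open>n * k\<close>; \<open>b\<close> follows.\<close>

lemma initial_memory_layout:
  assumes E: "E \<in> carrier_mat n n" and F: "F \<in> carrier_mat n k" and b: "b \<in> carrier_vec n"
  shows "length (initial_memory E F b) = n * n + n * k + n"
    and "holds_on (initial_memory E F b) (mat_support F) (\<lambda>(j, i). n * n + (j * k + i)) (\<lambda>x. F $$ x)"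
    and "holds_on (initial_memory E F b) {..<n} (\<lambda>j. n * n + n * k + j) (\<lambda>j. b $ j)"
proof -
  note E' = concat_mat_to_list[OF E] and F' = concat_mat_to_list[OF F]
  show len: "length (initial_memory E F b) = n * n + n * k + n"
    using carrier_vecD[OF b] by (simp add: initial_memory_def E'(1) F'(1))
  have "j * k + i < n * k" if "j < n" "i < k" for i j
  proof -
    have "j * k + i < Suc j * k" using that by simp
    also have "\<dots> \<le> n * k" using that by (intro mult_le_mono1) simp
    finally show ?thesis .
  qed
  then show "holds_on (initial_memory E F b) (mat_support F) (\<lambda>(j, i). n * n + (j * k + i)) (\<lambda>x. F $$ x)"
    using F F'(2) unfolding holds_on_def holds_def len
    by (auto simp: trans_less_add1 initial_memory_def mat_support_def nth_append E'(1) F'(1))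
  show "holds_on (initial_memory E F b) {..<n} (\<lambda>j. n * n + n * k + j) (\<lambda>j. b $ j)"
    unfolding holds_on_def holds_def len by (auto simp: initial_memory_def nth_append E'(1) F'(1) list_of_vec_index)
qed

lemma represents_holds_on:
  assumes "represents s R M"
  shows "holds_on s (mat_support M) (\<lambda>x. the (map_of R x)) (\<lambda>x. M $$ x)"
  unfolding holds_on_def
proof
  fix x assume "x \<in> mat_support M"
  then obtain a where "map_of R x = Some a"
    using assms by (metis represents_def map_of_eq_None_iff not_None_eq)
  then show "holds s (the (map_of R x)) (M $$ x)"
    using assms map_of_SomeD[of R x a] by (auto simp: represents_def holds_def)
qed

text \<open>Besides \<open>C\<close> and \<open>D\<close> the iteration reads only \<open>F\<close>
  and \<open>b\<close> from the data; the entries of \<open>E\<close> matter to it through the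
  factorization alone.\<close>

definition factor_and_iterate ::
  "nat \<Rightarrow> nat \<Rightarrow> (nat \<times> nat) set \<Rightarrow> (nat \<times> coordinate_format \<times> coordinate_format) comp \<Rightarrow> nat \<Rightarrow>
     nat list prog" where
  "factor_and_iterate n k S fac N = seq (\<lambda>_. fac) (\<lambda>(l, TC, TD).
     sparse_layout.kaczmarz_prog n k l (fst ` set TC) (fst ` set TD) S
       (\<lambda>x. the (map_of TC x)) (\<lambda>x. the (map_of TD x))
       (\<lambda>(j, i). n * n + (j * k + i)) (\<lambda>j. n * n + n * k + j) N)"

lemma spec_factor_and_iterate:
  assumes set: "setting n m r d h f P E B F" and b: "b \<in> carrier_vec n" and "0 < f"
    and fac: "computes_factorization \<kappa> B fac (initial_memory E F b) \<kappa>'"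
  shows "spec (factor_and_iterate n (m - n) (mat_support F) fac N) (initial_memory E F b)
    (\<kappa>' + (N * (16 * (f * \<kappa>)) + 50 * (m * f\<^sup>2 * \<kappa>\<^sup>2)))
    (iterate_law (directions B F) (start_point B F b) N)"
  unfolding factor_and_iterate_def
proof (rule spec_seq[OF _ order_refl])
  let ?s = "initial_memory E F b" and ?k = "m - n"
  have n: "0 < n" using set dendrogram_size_pos by (auto simp: setting_def)
  interpret split_system n ?k E B F by (rule setting_split_system[OF set])
  fix out s' c assume out: "(out, s', c) \<in> set_pmf (exec (\<lambda>_. fac) ?s)"
  obtain l TC TD where out_eq: "out = (l, TC, TD)" by (cases out) auto
  have run: "((l, TC, TD), s', c) \<in> set_pmf (run fac ?s)" using out by (simp add: exec_def out_eq)
  obtain C D where c: "c \<le> \<kappa>'" and C: "C \<in> carrier_mat n l" and D: "D \<in> carrier_mat l n"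
    and CD: "sparse_factorization \<kappa> B C D" and TC: "represents s' TC C" and TD: "represents s' TD D"
    using fac run B unfolding computes_factorization_def by fastforce
  \<comment> \<open>The layout depends on the outcome of \<open>fac\<close>, so the locale is
    instantiated for each outcome separately; the law obtained is always the same.\<close>
  interpret sparse_data n ?k E B F l "fst ` set TC" "fst ` set TD" "mat_support F"
    "\<lambda>x. the (map_of TC x)" "\<lambda>x. the (map_of TD x)"
    "\<lambda>(j, i). n * n + (j * ?k + i)" "\<lambda>j. n * n + n * ?k + j" C D b \<kappa> f
    using C D CD TC TD b n \<open>0 < f\<close> set by unfold_locales (auto simp: represents_def setting_def)
  obtain t where s': "s' = ?s @ t" using run_appends[OF run] by blast
  have "n + ?k = m" using set by (simp add: setting_def)
  then have "spec (kaczmarz_prog N) s' (N * (16 * (f * \<kappa>)) + 50 * (m * f\<^sup>2 * \<kappa>\<^sup>2))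
      (iterate_law Q (start_point B F b) N)"
    using spec_kaczmarz_prog[of s' N] represents_holds_on[OF TC] represents_holds_on[OF TD]
      holds_on_append[OF initial_memory_layout(2)[OF E F b], of t]
      holds_on_append[OF initial_memory_layout(3)[OF E F b], of t]
    by (simp add: s' SC SD)
  then show "c \<le> \<kappa>' \<and> spec (case out of (l, TC, TD) \<Rightarrow>
      sparse_layout.kaczmarz_prog n ?k l (fst ` set TC) (fst ` set TD) (mat_support F)
       (\<lambda>x. the (map_of TC x)) (\<lambda>x. the (map_of TD x))
       (\<lambda>(j, i). n * n + (j * ?k + i)) (\<lambda>j. n * n + n * ?k + j) N) s'
      (N * (16 * (f * \<kappa>)) + 50 * (m * f\<^sup>2 * \<kappa>\<^sup>2)) (iterate_law Q (start_point B F b) N)"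
    using c by (simp add: out_eq)
qed

lemma sparse_factorization_mono:
  "sparse_factorization k M C D \<Longrightarrow> k \<le> k' \<Longrightarrow> sparse_factorization k' M C D"
  unfolding sparse_factorization_def by (meson order_trans)

text \<open>For \<open>h > 0\<close> one has \<open>h + 1 <= 2 * h\<close>. Squaring turns this 2
  into a 4, and \<open>4 * 50 = 200\<close>.\<close>

lemma total_cost_bound:
  fixes N f r d h m :: nat
  assumes "0 < h"
  shows "N * (16 * (f * (r * d\<^sup>2 * (h + 1)))) + 50 * (m * f\<^sup>2 * (r * d\<^sup>2 * (h + 1))\<^sup>2)
    \<le> 200 * (N * f * r * d\<^sup>2 * h + m * f\<^sup>2 * r\<^sup>2 * d ^ 4 * h\<^sup>2)"
proof -
  let ?\<kappa> = "r * d\<^sup>2 * h"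
  have le: "r * d\<^sup>2 * (h + 1) \<le> 2 * ?\<kappa>" using assms by simp
  have "N * (16 * (f * (r * d\<^sup>2 * (h + 1)))) \<le> N * (16 * (f * (2 * ?\<kappa>)))"
    by (intro mult_le_mono order_refl le)
  also have "\<dots> \<le> 200 * (N * f * r * d\<^sup>2 * h)" by (simp add: mult_ac)
  finally have 1: "N * (16 * (f * (r * d\<^sup>2 * (h + 1)))) \<le> 200 * (N * f * r * d\<^sup>2 * h)" .
  have "50 * (m * f\<^sup>2 * (r * d\<^sup>2 * (h + 1))\<^sup>2) \<le> 50 * (m * f\<^sup>2 * (2 * ?\<kappa>)\<^sup>2)"
    by (intro mult_le_mono order_refl power_mono le) simp
  also have "\<dots> = 200 * (m * f\<^sup>2 * r\<^sup>2 * d ^ 4 * h\<^sup>2)"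
    by (simp add: power2_eq_square power4_eq_xxxx mult_ac)
  finally show ?thesis unfolding distrib_left[of 200] by (rule add_mono[OF 1])
qed

text \<open>The constants \<open>K\<close> precede the parameters and are thus uniform in them. The
  program precedes \<open>E\<close>, \<open>F\<close> and \<open>b\<close>: one tree serves all real
  data with the same support of \<open>F\<close>, so it cannot have the answer built in.\<close>

theorem theorem5p1:
  shows
    "(\<forall>n m r d h f P E B F.
        setting n m r d h f P E B F \<longrightarrow> 0 < h \<longrightarrow>
        (\<exists>C D. sparse_factorization (r * d\<^sup>2 * (h + 1)) B C D))
     \<and>
     (\<exists>K::nat. \<forall>n m r d h f P S N
         (fac :: (nat \<times> coordinate_format \<times> coordinate_format) comp).
        0 < h \<longrightarrow> 0 < f \<longrightarrow>
        (\<exists>prog :: nat list comp. \<forall>E B F b \<kappa>.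
           setting n m r d h f P E B F \<longrightarrow> mat_support F = S \<longrightarrow> b \<in> carrier_vec n \<longrightarrow>
           computes_factorization (r * d\<^sup>2 * (h + 1)) B fac (initial_memory E F b) \<kappa> \<longrightarrow>
           output_law prog (initial_memory E F b)
             = iterate_law (directions B F) (start_point B F b) N
           \<and> (\<forall>(cells, s, c)\<in>set_pmf (run prog (initial_memory E F b)).
                c \<le> K * (N * f * r * d\<^sup>2 * h + m * f\<^sup>2 * r\<^sup>2 * d ^ 4 * h\<^sup>2) + \<kappa>)))
     \<and>
     (\<forall>\<rho>::real. 1 < \<rho> \<longrightarrow>
       (\<exists>K::real. \<forall>n m r d h f P E B F b.
          setting n m r d h f P E B F \<longrightarrow> b \<in> carrier_vec n \<longrightarrow>
          (\<exists>N\<^sub>1::nat. real N\<^sub>1 \<le> K * ((frob_norm (B * F))\<^sup>2 + real m) \<and>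
             (\<forall>t. expected_sq_error (iterate_law (directions B F) (start_point B F b) (t + N\<^sub>1))
                     (min_norm_solution m (system_matrix E F) b)
                  \<le> expected_sq_error (iterate_law (directions B F) (start_point B F b) t)
                     (min_norm_solution m (system_matrix E F) b) / \<rho>))))"
proof (intro conjI allI impI)
  fix n m r d h f P E B F
  assume set: "setting n m r d h f P E B F" and h: "0 < h"
  have "r * d\<^sup>2 * h \<le> r * d\<^sup>2 * (h + 1)" by simp
  then show "\<exists>C D. sparse_factorization (r * d\<^sup>2 * (h + 1)) B C D"
    using hierarchical_sparse_factorization[of n h P r B d] sparse_factorization_mono set h
    unfolding setting_def by blast
next
  show "\<exists>K::nat. \<forall>n m r d h f P S N (fac :: (nat \<times> coordinate_format \<times> coordinate_format) comp).
        0 < h \<longrightarrow> 0 < f \<longrightarrow>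
        (\<exists>prog :: nat list comp. \<forall>E B F b \<kappa>.
           setting n m r d h f P E B F \<longrightarrow> mat_support F = S \<longrightarrow> b \<in> carrier_vec n \<longrightarrow>
           computes_factorization (r * d\<^sup>2 * (h + 1)) B fac (initial_memory E F b) \<kappa> \<longrightarrow>
           output_law prog (initial_memory E F b)
             = iterate_law (directions B F) (start_point B F b) N
           \<and> (\<forall>(cells, s, c)\<in>set_pmf (run prog (initial_memory E F b)).
                c \<le> K * (N * f * r * d\<^sup>2 * h + m * f\<^sup>2 * r\<^sup>2 * d ^ 4 * h\<^sup>2) + \<kappa>))"
  proof (rule exI[of _ 200], intro allI impI)
    fix n m r d h f :: nat and P S N and fac :: "(nat \<times> coordinate_format \<times> coordinate_format) comp"
    assume h: "0 < h" and f: "0 < f"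
    let ?k = "m - n"
    \<comment> \<open>A \<open>prog\<close> becomes a tree once the length of the memory is fixed,
      here that of the initial memory.\<close>
    let ?prog = "factor_and_iterate n ?k S fac N (n * n + n * ?k + n)"
    show "\<exists>prog :: nat list comp. \<forall>E B F b \<kappa>.
           setting n m r d h f P E B F \<longrightarrow> mat_support F = S \<longrightarrow> b \<in> carrier_vec n \<longrightarrow>
           computes_factorization (r * d\<^sup>2 * (h + 1)) B fac (initial_memory E F b) \<kappa> \<longrightarrow>
           output_law prog (initial_memory E F b)
             = iterate_law (directions B F) (start_point B F b) N
           \<and> (\<forall>(cells, s, c)\<in>set_pmf (run prog (initial_memory E F b)).
                c \<le> 200 * (N * f * r * d\<^sup>2 * h + m * f\<^sup>2 * r\<^sup>2 * d ^ 4 * h\<^sup>2) + \<kappa>)"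
    proof (rule exI[of _ ?prog], intro allI impI)
      fix E B F b \<kappa>
      assume set: "setting n m r d h f P E B F" and S: "mat_support F = S" and b: "b \<in> carrier_vec n"
        and fac: "computes_factorization (r * d\<^sup>2 * (h + 1)) B fac (initial_memory E F b) \<kappa>"
      let ?s = "initial_memory E F b"
      have "length ?s = n * n + n * ?k + n"
        using set b by (intro initial_memory_layout) (auto simp: setting_def)
      then have exec: "exec (factor_and_iterate n ?k S fac N) ?s = run ?prog ?s"
        by (simp add: exec_def)
      have "spec (factor_and_iterate n ?k S fac N) ?s
          (200 * (N * f * r * d\<^sup>2 * h + m * f\<^sup>2 * r\<^sup>2 * d ^ 4 * h\<^sup>2) + \<kappa>)
          (iterate_law (directions B F) (start_point B F b) N)"
        using spec_factor_and_iterate[OF set b f fac, of N] unfolding S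
        by (rule spec_mono) (use total_cost_bound[OF h, of N f r d m] in simp)
      then show "output_law ?prog ?s = iterate_law (directions B F) (start_point B F b) N
           \<and> (\<forall>(cells, s, c)\<in>set_pmf (run ?prog ?s).
                c \<le> 200 * (N * f * r * d\<^sup>2 * h + m * f\<^sup>2 * r\<^sup>2 * d ^ 4 * h\<^sup>2) + \<kappa>)"
        unfolding spec_def exec output_law_def outvec_def .
    qed
  qed
next
  fix \<rho> :: real
  assume \<rho>: "1 < \<rho>"
  show "\<exists>K::real. \<forall>n m r d h f P E B F b.
          setting n m r d h f P E B F \<longrightarrow> b \<in> carrier_vec n \<longrightarrow>
          (\<exists>N\<^sub>1::nat. real N\<^sub>1 \<le> K * ((frob_norm (B * F))\<^sup>2 + real m) \<and>
             (\<forall>t. expected_sq_error (iterate_law (directions B F) (start_point B F b) (t + N\<^sub>1))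
                     (min_norm_solution m (system_matrix E F) b)
                  \<le> expected_sq_error (iterate_law (directions B F) (start_point B F b) t)
                     (min_norm_solution m (system_matrix E F) b) / \<rho>))"
  proof (rule exI[of _ "ln \<rho> + 1"], intro allI impI)
    fix n m r d h f P E B F and b :: "real Matrix.vec"
    assume set: "setting n m r d h f P E B F" and b: "b \<in> carrier_vec n"
    interpret split_system n "m - n" E B F by (rule setting_split_system[OF set])
    have m: "n + (m - n) = m" using set by (simp add: setting_def)
    obtain N where N: "real N \<le> (ln \<rho> + 1) * ((frob_norm (B * F))\<^sup>2 + real (m - n))"
      and rate: "\<forall>t. expected_sq_error (iterate_law Q (start_point B F b) (t + N)) (min_norm_solution m A b)
        \<le> expected_sq_error (iterate_law Q (start_point B F b) t) (min_norm_solution m A b) / \<rho>"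
      using expected_sq_error_rate[OF b \<rho>] unfolding m by blast
    \<comment> \<open>The rate is governed by the \<open>m - n\<close> columns of \<open>Q\<close>;
      passing to \<open>m\<close> only weakens the bound.\<close>
    have "(ln \<rho> + 1) * ((frob_norm (B * F))\<^sup>2 + real (m - n)) \<le> (ln \<rho> + 1) * ((frob_norm (B * F))\<^sup>2 + real m)"
      using \<rho> by (intro mult_left_mono) (auto simp: add_nonneg_nonneg)
    then show "\<exists>N\<^sub>1::nat. real N\<^sub>1 \<le> (ln \<rho> + 1) * ((frob_norm (B * F))\<^sup>2 + real m) \<and>
             (\<forall>t. expected_sq_error (iterate_law Q (start_point B F b) (t + N\<^sub>1)) (min_norm_solution m A b)
                  \<le> expected_sq_error (iterate_law Q (start_point B F b) t) (min_norm_solution m A b) / \<rho>)"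
      using N rate by (intro exI[of _ N]) auto
  qed
qed

end
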